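(* Let $d\ge1$, $a_1,\dots,a_d>0$, and let $H$ be the Hamiltonian on the $d$-dimensional hyperrectangular lattice graph with edge lengths $a_1,\dots,a_d$ and $\delta$ couplings of strength $\alpha<0$ at all vertices. Then: (1) every spectral gap of $H$ has its upper endpoint equal to $\left(\frac{m\pi}{a_j}\right)^2$ for some $j\in\{1,\dots,d\}$ and some $m\in\mathbb{N}$; (2) for $\ell\in\{1,\dots,d\}$ and $m\in\mathbb{N}$, there is a spectral gap with upper endpoint $\left(\frac{m\pi}{a_\ell}\right)^2$ if and only if $$\frac{2m\pi}{a_{\ell}}\sum_{j=1}^d\tan\left(\frac{\pi}{2}\left(\left\lceil m\frac{a_j}{a_{\ell}}\right\rceil-m\frac{a_j}{a_{\ell}}\right)\right)<|\alpha|.$$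
   Context: The lattice graph $\Gamma$ has vertex set $\{(n_1a_1,\dots,n_da_d): n_i\in\mathbb{Z}\}\subset\mathbb{R}^d$, with an edge (segment of length $a_j$) between two vertices iff they differ by $a_je_j$ for some $j$. $H$ is the self-adjoint operator on $L^2(\Gamma)$ acting as $\psi\mapsto-\psi''$ on each edge, with domain consisting of functions $H^2$ on each edge satisfying at every vertex $v$: $\psi$ is continuous at $v$, and the sum over the $2d$ incident edges of the derivatives at $v$ taken in the direction away from $v$ equals $\alpha\psi(v)$. A spectral gap is an open interval $(E_1,E_2)$ with $E_1<E_2$, $E_1,E_2\in\sigma(H)$ and $(E_1,E_2)\cap\sigma(H)=\emptyset$. $\lceil\cdot\rceil$ is the ceiling function, $\mathbb{N}=\{1,2,\dots\}$. *)

theory Defs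
  imports "HOL-Analysis.Analysis"
begin

text \<open>Lattice graph with coordinate index type 'd (finite, so d = CARD('d) \<ge> 1).
  Vertices: v :: 'd \<Rightarrow> int (standing for (v_1 a_1, ..., v_d a_d)).
  Edges: (v, j), the segment from vertex v to vertex v + e_j, of length a j,
  parametrised by x \<in> [0, a j] (x = 0 at v, x = a j at v + e_j).
  A function on the graph: psi :: edge \<Rightarrow> real \<Rightarrow> complex.\<close>

type_synonym 'd edge = "('d \<Rightarrow> int) \<times> 'd"

definition edge_L2 :: "real \<Rightarrow> (real \<Rightarrow> complex) \<Rightarrow> bool" where
  "edge_L2 l f \<longleftrightarrow> set_borel_measurable lborel {0..l} f \<and>
     set_integrable lborel {0..l} (\<lambda>x. (cmod (f x))^2)"

definition edge_H2 :: "real \<Rightarrow> (real \<Rightarrow> complex) \<Rightarrow> (real \<Rightarrow> complex) \<Rightarrow> (real \<Rightarrow> complex) \<Rightarrow> bool" where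
  "edge_H2 l f f' f'' \<longleftrightarrow> edge_L2 l f'' \<and>
     (\<forall>x\<in>{0..l}. (f' has_integral (f x - f 0)) {0..x}) \<and>
     (\<forall>x\<in>{0..l}. (f'' has_integral (f' x - f' 0)) {0..x})"

definition graph_L2 :: "('d \<Rightarrow> real) \<Rightarrow> ('d edge \<Rightarrow> real \<Rightarrow> complex) \<Rightarrow> bool" where
  "graph_L2 a f \<longleftrightarrow> (\<forall>e. edge_L2 (a (snd e)) (f e)) \<and>
     (\<lambda>e. LINT x:{0..a (snd e)}|lborel. (cmod (f e x))^2) summable_on UNIV"

text \<open>Domain of H (psi' and psi'' are the first and second derivatives on each edge):
  edgewise H^2, psi and psi'' in L^2(Gamma), continuity at the vertices, and the
  delta condition: sum of outgoing derivatives = alpha * psi(v).\<close>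
definition delta_domain :: "('d::finite \<Rightarrow> real) \<Rightarrow> real \<Rightarrow> ('d edge \<Rightarrow> real \<Rightarrow> complex)
   \<Rightarrow> ('d edge \<Rightarrow> real \<Rightarrow> complex) \<Rightarrow> ('d edge \<Rightarrow> real \<Rightarrow> complex) \<Rightarrow> bool" where
  "delta_domain a \<alpha> \<psi> \<psi>' \<psi>'' \<longleftrightarrow>
     (\<forall>e. edge_H2 (a (snd e)) (\<psi> e) (\<psi>' e) (\<psi>'' e)) \<and>
     graph_L2 a \<psi> \<and> graph_L2 a \<psi>'' \<and>
     (\<forall>v j k. \<psi> (v, j) 0 = \<psi> (v, k) 0 \<and> \<psi> (v(j := v j - 1), j) (a j) = \<psi> (v, k) 0) \<and>
     (\<forall>v k. (\<Sum>j\<in>UNIV. \<psi>' (v, j) 0 - \<psi>' (v(j := v j - 1), j) (a j))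
              = complex_of_real \<alpha> * \<psi> (v, k) 0)"

text \<open>(Real) spectrum of the self-adjoint operator H: E is in the spectrum iff
  H - E is not a bijection from the domain onto L^2(Gamma) (H - E bijective is
  equivalent to E in the resolvent set since H is closed).\<close>
definition delta_lattice_spectrum :: "('d::finite \<Rightarrow> real) \<Rightarrow> real \<Rightarrow> real set" where
  "delta_lattice_spectrum a \<alpha> = {E. \<not> (
     (\<forall>\<psi> \<psi>' \<psi>''. delta_domain a \<alpha> \<psi> \<psi>' \<psi>'' \<and>
        (\<forall>e. AE x in lborel. x \<in> {0..a (snd e)} \<longrightarrow> - \<psi>'' e x - of_real E * \<psi> e x = 0)
        \<longrightarrow> (\<forall>e. \<forall>x\<in>{0..a (snd e)}. \<psi> e x = 0)) \<and>
     (\<forall>f. graph_L2 a f \<longrightarrow> (\<exists>\<psi> \<psi>' \<psi>''. delta_domain a \<alpha> \<psi> \<psi>' \<psi>'' \<and>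
        (\<forall>e. AE x in lborel. x \<in> {0..a (snd e)} \<longrightarrow> - \<psi>'' e x - of_real E * \<psi> e x = f e x))))}"

definition spectral_gap :: "real set \<Rightarrow> real \<Rightarrow> real \<Rightarrow> bool" where
  "spectral_gap S E1 E2 \<longleftrightarrow> E1 < E2 \<and> E1 \<in> S \<and> E2 \<in> S \<and> {E1<..<E2} \<inter> S = {}"

end

theory Submission
  imports Defs
begin

text \<open>On an edge of length \<open>l\<close> the equation \<open>- f'' = E f\<close> is solved by its boundary values as long as
  \<open>S\<^sub>E l \<noteq> 0\<close>, where \<open>S\<^sub>E\<close> and \<open>C\<^sub>E\<close> are the fundamental solutions. Away from these Dirichlet energies
  \<open>H - E\<close> therefore reduces to the difference operator
  \<open>\<Sum>j. (\<phi>(v + e\<^sub>j) + \<phi>(v - e\<^sub>j) - 2 C\<^sub>E(a\<^sub>j) \<phi>(v)) / S\<^sub>E(a\<^sub>j) - \<alpha> \<phi>(v)\<close> on the vertices. If its diagonal dominates,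
  a Neumann series inverts it; otherwise, and also at the Dirichlet energies, there is a Bloch
  solution \<open>w\<close>, and \<open>H - E\<close> is not onto: for a solution \<open>\<psi>\<close> of \<open>(H - E) \<psi> = \<gamma> cnj w\<close> with a suitable
  square-summable weight \<open>\<gamma>\<close>, bilinear pairing with \<open>w\<close> cut off to a box of side \<open>N\<close> leaves only boundary edges,
  of which there are too few as \<open>N\<close> grows.

  Hence for \<open>\<alpha> < 0\<close> and \<open>E = k\<^sup>2 > 0\<close> not Dirichlet, \<open>E\<close> is in the spectrum iff \<open>\<bar>\<alpha>\<bar> / 2 \<le> \<Phi> k\<close>, where
  \<open>\<Phi> k = k \<Sum>j. tan (\<pi>/2 (\<lceil>k a\<^sub>j/\<pi>\<rceil> - k a\<^sub>j/\<pi>))\<close>. Between consecutive Dirichlet points \<open>\<Phi>\<close> decreases strictly,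
  is continuous from the left, and it jumps up to infinity to the right of each of them; below the
  first one its decreasing continuation to \<open>E \<le> 0\<close> plays the same role. So the upper endpoint of
  a gap is a Dirichlet energy, and there is a gap below such an energy exactly if \<open>\<Phi>\<close> is smaller than \<open>\<bar>\<alpha>\<bar> / 2\<close> there.\<close>

section \<open>Integration by parts\<close>

text \<open>The spectrum is defined by bijectivity alone, and approximate eigenfunctions contradict
  surjectivity only by way of the bounded inverse theorem. Non-surjectivity is therefore shown by a
  single right-hand side that has no preimage. It has to be square-summable and still pair with the
  cut-off Bloch solution more strongly than the boundary of a box can compensate. The pairing is
  bilinear and the right-hand side conjugated, so that the main term is the integral of
  \<open>|w|^2\<close> against the cutoff and has a definite sign.

  On an edge, \<open>\<psi>'\<close> is known only as an indefinite integral of the merely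
  square-integrable \<open>\<psi>''\<close>, and the equation holds only almost everywhere. Facts
  about solutions on an edge are therefore extracted from Green's identity with smooth test
  functions.

  For \<alpha> < 0 the vertex operator yields two inequalities, one for each extreme value of its
  symbol. For E > 0 one of them is automatic, which is why the single function \<open>\<Phi>\<close>
  decides; for E \<le> 0 both matter, but both quantities are monotone in E.\<close>

lemma has_integral_between:
  fixes p P :: "real \<Rightarrow> complex"
  assumes P: "\<And>x. x \<in> {0..l} \<Longrightarrow> (p has_integral (P x - P 0)) {0..x}"
    and "0 \<le> x" "x \<le> y" "y \<le> l"
  shows "(p has_integral (P y - P x)) {x..y}"
proof -
  have y: "(p has_integral (P y - P 0)) {0..y}" and x: "(p has_integral (P x - P 0)) {0..x}"
    using assms by auto
  have "p integrable_on {x..y}"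
    by (rule integrable_on_subinterval[OF has_integral_integrable[OF y]]) (use assms in auto)
  then obtain i where i: "(p has_integral i) {x..y}" by blast
  have "P y - P 0 = P x - P 0 + i"
    using has_integral_unique[OF y has_integral_combine[OF assms(2,3) x i]] .
  then show ?thesis using i by simp
qed

lemma indefinite_integral_continuous_on:
  fixes p P :: "real \<Rightarrow> complex"
  assumes P: "\<And>x. x \<in> {0..l} \<Longrightarrow> (p has_integral (P x - P 0)) {0..x}"
  shows "continuous_on {0..l} P"
proof (cases "0 \<le> l")
  case True
  have "continuous_on {0..l} (\<lambda>x. P 0 + integral {0..x} p)"
    using has_integral_integrable[OF P[of l]] True
    by (intro continuous_intros indefinite_integral_continuous_1) auto
  moreover have "P x = P 0 + integral {0..x} p" if "x \<in> {0..l}" for x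
    using integral_unique[OF P[OF that]] by simp
  ultimately show ?thesis by (metis (no_types, lifting) continuous_on_cong)
qed auto

lemma continuous_mult_absolutely_integrable:
  fixes u p :: "real \<Rightarrow> complex"
  assumes "continuous_on {a..b} u" "p absolutely_integrable_on {a..b}"
  shows "(\<lambda>x. u x * p x) absolutely_integrable_on {a..b}"
  by (rule absolutely_integrable_bounded_measurable_product[OF bilinear_times])
     (use assms in \<open>auto intro!: continuous_imp_measurable_on_sets_lebesgue compact_imp_bounded
        compact_continuous_image\<close>)

lemma vector_derivative_continuous_on:
  fixes u :: "real \<Rightarrow> complex"
  assumes "\<And>x. x \<in> S \<Longrightarrow> (u has_vector_derivative u' x) (at x within S)"
  shows "continuous_on S u"
  using assms has_vector_derivative_continuous continuous_on_eq_continuous_within by blast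

text \<open>The difference \<open>D\<close> of both sides has \<open>D y - D x = O(\<bar>y - x\<bar> \<bar>Q y - Q x\<bar>)\<close> with \<open>Q\<close> the
  continuous indefinite integral of \<open>\<bar>p\<bar>\<close>, so \<open>D' = 0\<close> everywhere although \<open>P\<close> is differentiable
  only almost everywhere.\<close>
lemma integration_by_parts_indefinite_integral:
  fixes P p u u' :: "real \<Rightarrow> complex"
  assumes l: "0 \<le> l" and p: "p absolutely_integrable_on {0..l}"
    and P: "\<And>x. x \<in> {0..l} \<Longrightarrow> (p has_integral (P x - P 0)) {0..x}"
    and u: "\<And>x. x \<in> {0..l} \<Longrightarrow> (u has_vector_derivative u' x) (at x within {0..l})"
    and u': "continuous_on {0..l} u'"
  shows "((\<lambda>x. u' x * P x + u x * p x) has_integral (u l * P l - u 0 * P 0)) {0..l}"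
proof -
  define g where "g = (\<lambda>x. u' x * P x + u x * p x)"
  define Q where "Q x = integral {0..x} (\<lambda>t. norm (p t))" for x
  define D where "D x = u x * P x - integral {0..x} g" for x
  have cP: "continuous_on {0..l} P" by (rule indefinite_integral_continuous_on[OF P])
  have cu: "continuous_on {0..l} u" by (rule vector_derivative_continuous_on[OF u])
  have g: "g integrable_on {0..l}"
    unfolding g_def
    by (intro integrable_add integrable_continuous_interval continuous_intros u' cP
        set_lebesgue_integral_eq_integral(1) continuous_mult_absolutely_integrable cu p)
  have gh: "(g has_integral (integral {0..x} g - integral {0..0} g)) {0..x}" if "x \<in> {0..l}" for x
    using integrable_integral[OF integrable_on_subinterval[OF g, of 0 x]] that by auto
  have np: "(\<lambda>t. norm (p t)) integrable_on {0..l}" using p absolutely_integrable_on_def by blast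
  have cQ: "continuous_on {0..l} Q"
    unfolding Q_def by (rule indefinite_integral_continuous_1[OF np])
  have Qxy: "((\<lambda>t. norm (p t)) has_integral (Q y - Q x)) {x..y}" if "0 \<le> x" "x \<le> y" "y \<le> l" for x y
  proof -
    have "integral {0..x} (\<lambda>t. norm (p t)) + integral {x..y} (\<lambda>t. norm (p t)) = integral {0..y} (\<lambda>t. norm (p t))"
      by (rule Henstock_Kurzweil_Integration.integral_combine) (use that in \<open>auto intro!: integrable_on_subinterval[OF np]\<close>)
    moreover have "(\<lambda>t. norm (p t)) integrable_on {x..y}"
      by (rule integrable_on_subinterval[OF np]) (use that in auto)
    ultimately show ?thesis unfolding Q_def
      using integrable_integral[of "\<lambda>t. norm (p t)" "{x..y}"] by (metis add_diff_cancel_left')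
  qed
  have "bounded (u' ` {0..l})" by (intro compact_imp_bounded compact_continuous_image u') auto
  then obtain M where M: "M > 0" "\<And>x. x \<in> {0..l} \<Longrightarrow> norm (u' x) \<le> M"
    by (auto simp: bounded_pos)
  have uxy: "(u' has_integral (u y - u x)) {x..y}" if "0 \<le> x" "x \<le> y" "y \<le> l" for x y
    by (rule fundamental_theorem_of_calculus)
      (use that in \<open>auto intro: has_vector_derivative_within_subset[OF u]\<close>)
  have ub: "norm (u y - u x) \<le> M * (y - x)" if "0 \<le> x" "x \<le> y" "y \<le> l" for x y
  proof -
    have "norm (u' t) \<le> M" if "t \<in> {x..y} - {}" for t using M(2)[of t] that \<open>0 \<le> x\<close> \<open>y \<le> l\<close> by simp
    from has_integral_bound_real[OF less_imp_le[OF M(1)] finite.emptyI uxy[OF that] this] that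
    show ?thesis by simp
  qed
  have Pxy: "(p has_integral (P y - P x)) {x..y}" if "0 \<le> x" "x \<le> y" "y \<le> l" for x y
    by (rule has_integral_between[OF P that])
  have Pb: "norm (P y - P x) \<le> Q y - Q x" if "0 \<le> x" "x \<le> y" "y \<le> l" for x y
    using integral_norm_bound_integral[OF has_integral_integrable[OF Pxy[OF that]]
      has_integral_integrable[OF Qxy[OF that]]] integral_unique[OF Pxy[OF that]] integral_unique[OF Qxy[OF that]]
    by auto
  have Db: "norm (D y - D x) \<le> 2 * M * (y - x) * (Q y - Q x)" if xy: "0 \<le> x" "x \<le> y" "y \<le> l" for x y
  proof -
    \<comment> \<open>Freezing \<open>u\<close> at \<open>y\<close> and \<open>P\<close> at
      \<open>x\<close> turns the increment of their product into an exact integral. Each term of the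
      remainder against \<open>g\<close> carries one small increment, and integration over
      \<open>{x..y}\<close> supplies the second.\<close>
    have "((\<lambda>t. u y * p t + u' t * P x - g t) has_integral
        (u y * (P y - P x) + (u y - u x) * P x - (integral {0..y} g - integral {0..x} g))) {x..y}"
      by (intro has_integral_diff has_integral_add has_integral_mult_right has_integral_mult_left
          Pxy[OF xy] uxy[OF xy] has_integral_between[OF gh xy])
    moreover have "u y * (P y - P x) + (u y - u x) * P x - (integral {0..y} g - integral {0..x} g) = D y - D x"
      by (simp add: D_def algebra_simps)
    ultimately have 1: "((\<lambda>t. u y * p t + u' t * P x - g t) has_integral (D y - D x)) {x..y}" by simp
    have 2: "((\<lambda>t. M * (y - x) * norm (p t) + M * (Q y - Q x)) has_integral
        (M * (y - x) * (Q y - Q x) + (y - x) *\<^sub>R (M * (Q y - Q x)))) {x..y}"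
      using has_integral_const_real[of "M * (Q y - Q x)" x y] xy(2)
      by (intro has_integral_add has_integral_mult_right Qxy xy) auto
    have "norm (u y * p t + u' t * P x - g t) \<le> M * (y - x) * norm (p t) + M * (Q y - Q x)"
      if t: "t \<in> {x..y}" for t
    proof -
      have "u y * p t + u' t * P x - g t = (u y - u t) * p t - u' t * (P t - P x)"
        by (simp add: g_def algebra_simps)
      also have "norm \<dots> \<le> norm (u y - u t) * norm (p t) + norm (u' t) * norm (P t - P x)"
        by (metis norm_mult norm_triangle_ineq4)
      also have "\<dots> \<le> M * (y - x) * norm (p t) + M * (Q y - Q x)"
      proof (intro add_mono mult_mono order_refl)
        show "norm (u y - u t) \<le> M * (y - x)"
          by (rule order_trans[OF ub mult_left_mono]) (use t xy M(1) in auto)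
        have "Q t \<le> Q y" using has_integral_nonneg[OF Qxy[of t y]] t xy by auto
        then show "norm (P t - P x) \<le> Q y - Q x" using Pb[of x t] t xy by auto
      qed (use M t xy in auto)
      finally show ?thesis .
    qed
    then have "norm (integral {x..y} (\<lambda>t. u y * p t + u' t * P x - g t)) \<le>
        integral {x..y} (\<lambda>t. M * (y - x) * norm (p t) + M * (Q y - Q x))"
      by (intro integral_norm_bound_integral has_integral_integrable[OF 1] has_integral_integrable[OF 2])
    then have "norm (D y - D x) \<le> M * (y - x) * (Q y - Q x) + (y - x) *\<^sub>R (M * (Q y - Q x))"
      unfolding integral_unique[OF 1] integral_unique[OF 2] .
    then show ?thesis by (simp add: algebra_simps)
  qed
  have Db': "norm (D y - D x) \<le> 2 * M * norm (y - x) * norm (Q y - Q x)"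
    if "x \<in> {0..l}" "y \<in> {0..l}" for x y
  proof (cases "x \<le> y")
    case True
    from Db[of x y] True that have "norm (D y - D x) \<le> 2 * M * (y - x) * (Q y - Q x)" by auto
    also have "\<dots> \<le> 2 * M * norm (y - x) * norm (Q y - Q x)"
      using mult_left_mono[of "Q y - Q x" "norm (Q y - Q x)" "2 * M * (y - x)"] M True by auto
    finally show ?thesis .
  next
    case False
    then have "norm (D x - D y) \<le> 2 * M * (x - y) * (Q x - Q y)" using Db[of y x] that by auto
    also have "\<dots> \<le> 2 * M * norm (y - x) * norm (Q y - Q x)"
      using mult_left_mono[of "Q x - Q y" "norm (Q y - Q x)" "2 * M * (x - y)"] M False by auto
    finally show ?thesis by (simp add: norm_minus_commute)
  qed
  have "(D has_vector_derivative 0) (at x within {0..l})" if x: "x \<in> {0..l}" for x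
    unfolding has_vector_derivative_def has_derivative_within_alt
  proof (intro conjI allI impI)
    fix e :: real assume e: "e > 0"
    then have "e / (2 * M) > 0" using M by simp
    then obtain d where d: "d > 0" "\<And>y. y \<in> {0..l} \<Longrightarrow> dist y x < d \<Longrightarrow> dist (Q y) (Q x) < e / (2 * M)"
      using cQ x unfolding continuous_on_iff by metis
    have "norm (D y - D x - (y - x) *\<^sub>R 0) \<le> e * norm (y - x)" if y: "y \<in> {0..l}" "norm (y - x) < d" for y
    proof -
      have "norm (Q y - Q x) \<le> e / (2 * M)" using d(2)[of y] y by (auto simp: dist_norm)
      then have "2 * M * norm (y - x) * norm (Q y - Q x) \<le> 2 * M * norm (y - x) * (e / (2 * M))"
        using M by (intro mult_left_mono) auto
      then show ?thesis using Db'[OF x y(1)] M(1) by (simp add: mult.commute)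
    qed
    then show "\<exists>d>0. \<forall>y\<in>{0..l}. norm (y - x) < d \<longrightarrow> norm (D y - D x - (y - x) *\<^sub>R 0) \<le> e * norm (y - x)"
      using d(1) by blast
  qed auto
  then obtain c where "\<And>x. x \<in> {0..l} \<Longrightarrow> D x = c"
    using has_vector_derivative_zero_constant[of "{0..l}" D] by auto
  then have "D l = D 0" using l by auto
  then have "integral {0..l} g = u l * P l - u 0 * P 0" by (simp add: D_def algebra_simps)
  then show ?thesis using integrable_integral[OF g] unfolding g_def by simp
qed

section \<open>Functions on an edge\<close>

definition edge_nsq :: "real \<Rightarrow> (real \<Rightarrow> complex) \<Rightarrow> real" where
  "edge_nsq l f = (LINT x:{0..l}|lborel. (cmod (f x))\<^sup>2)"

lemma edge_nsq_nonneg: "0 \<le> edge_nsq l f"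
  unfolding edge_nsq_def set_lebesgue_integral_def by simp

text \<open>On a bounded interval, |f| \<le> 1 + |f|^2 puts L^2 inside L^1. Integrability then
  passes from \<open>lborel\<close> to its completion, where \<open>absolutely_integrable_on\<close>
  lives.\<close>

lemma edge_L2_absolutely_integrable:
  assumes "edge_L2 l f" shows "f absolutely_integrable_on {0..l}"
proof -
  have m: "set_borel_measurable lborel {0..l} f" and i: "set_integrable lborel {0..l} (\<lambda>x. (cmod (f x))\<^sup>2)"
    using assms unfolding edge_L2_def by auto
  have "set_integrable lborel {0..l} (\<lambda>x. 1 + (cmod (f x))\<^sup>2)"
    by (intro set_integral_add i borel_integrable_atLeastAtMost') auto
  moreover have "norm (f x) \<le> norm (1 + (cmod (f x))\<^sup>2)" for x
  proof -
    have "0 \<le> (cmod (f x) - 1)\<^sup>2" by simp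
    then have "2 * cmod (f x) \<le> 1 + (cmod (f x))\<^sup>2" by (simp add: power2_diff)
    moreover have "cmod (f x) \<le> 2 * cmod (f x)" by simp
    ultimately show ?thesis by (smt (verit) real_norm_def)
  qed
  ultimately have "set_integrable lborel {0..l} f"
    by (intro set_integrable_bound[OF _ m]) auto
  then show ?thesis
    using m unfolding set_integrable_def set_borel_measurable_def by (simp add: integrable_completion)
qed

lemma edge_L2_nsq_has_integral:
  assumes "edge_L2 l f" shows "((\<lambda>x. (cmod (f x))\<^sup>2) has_integral edge_nsq l f) {0..l}"
  using assms set_borel_integral_eq_integral[of "{0..l}" "\<lambda>x. (cmod (f x))\<^sup>2"]
  unfolding edge_L2_def edge_nsq_def by (simp add: has_integral_integral)

lemma edge_L2_continuous:
  assumes "continuous_on {0..l} f" shows "edge_L2 l f"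
  unfolding edge_L2_def set_borel_measurable_def
  using assms borel_measurable_continuous_on_indicator[of "{0..l}" f]
  by (auto intro!: borel_integrable_atLeastAtMost' continuous_intros)

lemma edge_L2_add:
  assumes f: "edge_L2 l f" and g: "edge_L2 l g"
  shows "edge_L2 l (\<lambda>x. f x + g x)" and "edge_nsq l (\<lambda>x. f x + g x) \<le> 2 * edge_nsq l f + 2 * edge_nsq l g"
proof -
  have m: "set_borel_measurable lborel {0..l} (\<lambda>x. f x + g x)"
    using f g unfolding edge_L2_def set_borel_measurable_def by (auto simp: scaleR_add_right)
  have le: "(cmod (f x + g x))\<^sup>2 \<le> 2 * (cmod (f x))\<^sup>2 + 2 * (cmod (g x))\<^sup>2" for x
  proof -
    have "(cmod (f x + g x))\<^sup>2 \<le> (cmod (f x) + cmod (g x))\<^sup>2"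
      by (intro power_mono norm_triangle_ineq) auto
    also have "\<dots> \<le> 2 * (cmod (f x))\<^sup>2 + 2 * (cmod (g x))\<^sup>2"
      using zero_le_power2[of "cmod (f x) - cmod (g x)"] by (simp add: power2_diff power2_sum)
    finally show ?thesis .
  qed
  have i: "set_integrable lborel {0..l} (\<lambda>x. 2 * (cmod (f x))\<^sup>2 + 2 * (cmod (g x))\<^sup>2)"
    using f g unfolding edge_L2_def by (intro set_integral_add) auto
  \<comment> \<open>Measurability is known only for the product with the indicator, so the square is
    taken after that product.\<close>
  have "(\<lambda>x. (cmod (indicator {0..l} x *\<^sub>R (f x + g x)))\<^sup>2) \<in> borel_measurable lborel"
    using m unfolding set_borel_measurable_def by measurable
  also have "(\<lambda>x. (cmod (indicator {0..l} x *\<^sub>R (f x + g x)))\<^sup>2) = (\<lambda>x. indicator {0..l} x *\<^sub>R (cmod (f x + g x))\<^sup>2)"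
    by (auto simp: indicator_def)
  finally have "set_borel_measurable lborel {0..l} (\<lambda>x. (cmod (f x + g x))\<^sup>2)"
    unfolding set_borel_measurable_def .
  then have j: "set_integrable lborel {0..l} (\<lambda>x. (cmod (f x + g x))\<^sup>2)"
    by (rule set_integrable_bound[OF i]) (use le in auto)
  then show "edge_L2 l (\<lambda>x. f x + g x)" using m unfolding edge_L2_def by simp
  have "edge_nsq l (\<lambda>x. f x + g x) \<le> (LINT x:{0..l}|lborel. 2 * (cmod (f x))\<^sup>2 + 2 * (cmod (g x))\<^sup>2)"
    unfolding edge_nsq_def by (rule set_integral_mono[OF j i le])
  also have "\<dots> = 2 * edge_nsq l f + 2 * edge_nsq l g"
    using f g unfolding edge_L2_def edge_nsq_def by (subst set_integral_add) auto
  finally show "edge_nsq l (\<lambda>x. f x + g x) \<le> 2 * edge_nsq l f + 2 * edge_nsq l g" .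
qed

lemma edge_L2_cmult:
  assumes f: "edge_L2 l f"
  shows "edge_L2 l (\<lambda>x. c * f x)" and "edge_nsq l (\<lambda>x. c * f x) = (cmod c)\<^sup>2 * edge_nsq l f"
proof -
  have "(\<lambda>x. c * (indicator {0..l} x *\<^sub>R f x)) \<in> borel_measurable lborel"
    using f unfolding edge_L2_def set_borel_measurable_def by (intro borel_measurable_times) auto
  then show "edge_L2 l (\<lambda>x. c * f x)"
    using f unfolding edge_L2_def set_borel_measurable_def
    by (cases "c = 0") (auto simp: norm_mult power_mult_distrib intro: set_integrable_mult_right, simp add: set_integrable_def)
  show "edge_nsq l (\<lambda>x. c * f x) = (cmod c)\<^sup>2 * edge_nsq l f"
    by (simp add: edge_nsq_def norm_mult power_mult_distrib)
qed

text \<open>Cauchy--Schwarz against the constant 1, read off from \<open>\<integral> (\<bar>f\<bar> - t)\<^sup>2 \<ge> 0\<close> at the mean value \<open>t\<close>.\<close>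
lemma edge_L1_le_nsq:
  assumes f: "edge_L2 l f" and l: "0 < l"
  shows "(integral {0..l} (\<lambda>x. cmod (f x)))\<^sup>2 \<le> l * edge_nsq l f"
proof -
  define I where "I = integral {0..l} (\<lambda>x. cmod (f x))"
  define t where "t = I / l"
  have "((\<lambda>x. cmod (f x)) has_integral I) {0..l}"
    using edge_L2_absolutely_integrable[OF f] unfolding absolutely_integrable_on_def I_def by blast
  then have "((\<lambda>x. (cmod (f x))\<^sup>2 - 2 * t * cmod (f x) + t\<^sup>2) has_integral
      (edge_nsq l f - 2 * t * I + (l - 0) *\<^sub>R t\<^sup>2)) {0..l}"
    using l has_integral_const_real[of "t\<^sup>2" 0 l]
    by (intro has_integral_add has_integral_diff has_integral_mult_right edge_L2_nsq_has_integral f) auto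
  moreover have "(cmod (f x))\<^sup>2 - 2 * t * cmod (f x) + t\<^sup>2 = (cmod (f x) - t)\<^sup>2" for x
    by (simp add: power2_diff)
  ultimately have "0 \<le> edge_nsq l f - 2 * t * I + l * t\<^sup>2"
    using has_integral_nonneg[of "\<lambda>x. (cmod (f x) - t)\<^sup>2" _ "{0..l}"] by simp
  then show ?thesis unfolding I_def[symmetric] t_def using l by (simp add: field_simps power2_eq_square)
qed

lemma edge_L2_integral_bound:
  assumes f: "edge_L2 l f" and l: "0 < l" and k: "continuous_on {0..l} k"
    and K: "\<And>x. x \<in> {0..l} \<Longrightarrow> cmod (k x) \<le> K" and h: "((\<lambda>x. k x * f x) has_integral I) {0..l}"
  shows "cmod I \<le> K * sqrt (l * edge_nsq l f)"
proof -
  have nf: "(\<lambda>x. cmod (f x)) integrable_on {0..l}"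
    using edge_L2_absolutely_integrable[OF f] unfolding absolutely_integrable_on_def by blast
  have K0: "0 \<le> K" using order_trans[OF norm_ge_zero K[of 0]] l by simp
  have "norm (integral {0..l} (\<lambda>x. k x * f x)) \<le> integral {0..l} (\<lambda>x. K * cmod (f x))"
    by (rule integral_norm_bound_integral)
       (use h K nf in \<open>auto simp: norm_mult intro!: mult_right_mono integrable_on_mult_right\<close>)
  also have "\<dots> = K * integral {0..l} (\<lambda>x. cmod (f x))" by simp
  also have "\<dots> \<le> K * sqrt (l * edge_nsq l f)"
    using edge_L1_le_nsq[OF f l] K0 by (intro mult_left_mono real_le_rsqrt) auto
  finally show ?thesis using integral_unique[OF h] by simp
qed

text \<open>Allows Green's identity on \<open>{0..x}\<close>, whose boundary terms give access to
  the values at an interior point \<open>x\<close>.\<close>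

lemma edge_H2_restrict:
  assumes "edge_H2 l f f' f''" "x \<le> l" shows "edge_H2 x f f' f''"
proof -
  have *: "set_borel_measurable lborel {0..x} f''" if "set_borel_measurable lborel {0..l} f''"
  proof -
    have "(\<lambda>y. indicator {0..x} y *\<^sub>R (indicator {0..l} y *\<^sub>R f'' y)) \<in> borel_measurable lborel"
      using that unfolding set_borel_measurable_def by measurable
    moreover have "(\<lambda>y. indicat_real {0..x} y *\<^sub>R (indicat_real {0..l} y *\<^sub>R f'' y)) = (\<lambda>y. indicat_real {0..x} y *\<^sub>R f'' y)"
      using assms(2) by (auto intro!: ext simp: indicator_def)
    ultimately show ?thesis unfolding set_borel_measurable_def by (simp only:)
  qed
  have "set_integrable lborel {0..l} g \<Longrightarrow> set_integrable lborel {0..x} g" for g :: "real \<Rightarrow> real"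
    by (rule set_integrable_subset) (use assms in auto)
  then show ?thesis using assms * unfolding edge_H2_def edge_L2_def by auto
qed

lemma edge_H2_continuous:
  assumes "edge_H2 l f f' f''" shows "continuous_on {0..l} f" "continuous_on {0..l} f'"
  by (rule indefinite_integral_continuous_on; use assms edge_H2_def in auto)+

text \<open>Integrate \<open>u' f\<close> and \<open>u f'\<close> by parts and subtract: the terms
  \<open>u' f'\<close> cancel. All pointwise differentiability is on the side of \<open>u\<close>;
  \<open>f\<close> and \<open>f'\<close> enter as indefinite integrals.\<close>

lemma edge_H2_green:
  assumes H: "edge_H2 l f f' f''" and l: "0 \<le> l"
    and u: "\<And>x. x \<in> {0..l} \<Longrightarrow> (u has_vector_derivative u' x) (at x within {0..l})"
    and u': "\<And>x. x \<in> {0..l} \<Longrightarrow> (u' has_vector_derivative u'' x) (at x within {0..l})"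
    and u'': "continuous_on {0..l} u''"
  shows "((\<lambda>x. f'' x * u x - f x * u'' x) has_integral
           ((f' l * u l - f l * u' l) - (f' 0 * u 0 - f 0 * u' 0))) {0..l}"
proof -
  have 1: "((\<lambda>x. u'' x * f x + u' x * f' x) has_integral (u' l * f l - u' 0 * f 0)) {0..l}"
    by (rule integration_by_parts_indefinite_integral[OF l _ _ u' u''])
       (use H edge_H2_def edge_H2_continuous(2)[OF H] in \<open>auto intro: absolutely_integrable_continuous_real\<close>)
  have 2: "((\<lambda>x. u' x * f' x + u x * f'' x) has_integral (u l * f' l - u 0 * f' 0)) {0..l}"
    by (rule integration_by_parts_indefinite_integral[OF l _ _ u vector_derivative_continuous_on[OF u']])
       (use H edge_H2_def edge_L2_absolutely_integrable in auto)
  show ?thesis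
    using has_integral_diff[OF 2 1] by (simp add: algebra_simps)
qed

text \<open>Bridge between the edge equations, which hold almost everywhere for
  \<open>lborel\<close>, and the gauge integral, which ignores negligible sets.\<close>

lemma AE_lborel_imp_negligible:
  assumes "AE x in lborel. P x" obtains N where "negligible N" "\<And>x. x \<notin> N \<Longrightarrow> P x"
proof -
  have "AE x in lebesgue. P x" using assms by (rule AE_completion)
  then show ?thesis using that unfolding eventually_ae_filter negligible_iff_null_sets by auto
qed

lemma has_integral_AE_cong:
  fixes f g :: "real \<Rightarrow> complex"
  assumes "AE x in lborel. x \<in> S \<longrightarrow> f x = g x" "(f has_integral I) S"
  shows "(g has_integral I) S"
proof -
  obtain N where "negligible N" "\<And>x. x \<notin> N \<Longrightarrow> x \<in> S \<longrightarrow> f x = g x"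
    using AE_lborel_imp_negligible[OF assms(1)] by blast
  then show ?thesis using has_integral_spike[of N S g f I] assms(2) by auto
qed

section \<open>Lattice boxes and boundary sums\<close>

lemma summable_on_edges:
  fixes g :: "('d::finite) edge \<Rightarrow> real"
  assumes "\<And>j. (\<lambda>v. g (v, j)) summable_on UNIV" shows "g summable_on UNIV"
proof -
  have "g summable_on (UNIV \<times> J)" for J :: "'d set"
  proof (induction J rule: finite_induct[OF finite])
    case (2 j J)
    have "g summable_on (\<lambda>v. (v, j)) ` UNIV"
      using assms[of j] by (subst summable_on_reindex) (auto simp: inj_on_def o_def)
    then have "g summable_on ((\<lambda>v. (v, j)) ` UNIV \<union> UNIV \<times> J)"
      using 2 by (intro summable_on_Un_disjoint) auto
    moreover have "(\<lambda>v. (v, j)) ` UNIV \<union> UNIV \<times> J = UNIV \<times> insert j J" by auto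
    ultimately show ?case by metis
  qed auto
  from this[of UNIV] show ?thesis by simp
qed

text \<open>The square of the weight is the sum over n of (1/2)^n times the uniform distribution on
  \<open>B n\<close>. Its total mass is at most 2, and on \<open>B n\<close> it is at least its n-th
  term.\<close>

lemma exists_l2_weight:
  fixes B :: "nat \<Rightarrow> 'v set"
  assumes B: "\<And>n. finite (B n)"
  shows "\<exists>\<gamma> :: 'v \<Rightarrow> real. (\<forall>v. 0 \<le> \<gamma> v) \<and> (\<lambda>v. (\<gamma> v)\<^sup>2) summable_on UNIV \<and>
    (\<forall>n. \<forall>v\<in>B n. sqrt ((1/2)^n / card (B n)) \<le> \<gamma> v)"
proof -
  define h where "h n v = (if v \<in> B n then (1/2)^n / real (card (B n)) else 0)" for n v
  have h0: "0 \<le> h n v" for n v by (simp add: h_def)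
  have hle: "h n v \<le> (1/2)^n" for n v
  proof (cases "v \<in> B n")
    case True
    then have "1 \<le> card (B n)" using B[of n] card_gt_0_iff[of "B n"] by (auto simp: Suc_le_eq)
    then show ?thesis using True by (simp add: h_def divide_le_eq)
  qed (simp add: h_def)
  have geo: "summable (\<lambda>n. (1/2)^n :: real)" by (rule summable_geometric) simp
  have sh: "summable (\<lambda>n. h n v)" for v
    by (rule summable_comparison_test'[OF geo]) (use h0 hle in auto)
  define g where "g v = (\<Sum>n. h n v)" for v
  have g0: "0 \<le> g v" for v unfolding g_def by (rule suminf_nonneg[OF sh h0])
  have hF: "sum (h n) F \<le> (1/2)^n" if "finite F" for n F
  proof -
    have "sum (h n) F = sum (h n) (F \<inter> B n)"
      using that by (intro sum.mono_neutral_right) (auto simp: h_def)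
    also have "\<dots> \<le> sum (h n) (B n)" using B h0 by (intro sum_mono2) auto
    also have "\<dots> = real (card (B n)) * ((1/2)^n / real (card (B n)))" by (simp add: h_def)
    also have "\<dots> \<le> (1/2)^n" by (cases "card (B n) = 0") auto
    finally show ?thesis .
  qed
  have "sum g F \<le> 2" if F: "finite F" for F
  proof -
    have "sum g F = (\<Sum>n. sum (h n) F)" unfolding g_def using sh by (subst suminf_sum) auto
    also have "\<dots> \<le> (\<Sum>n. (1/2)^n)" using hF[OF F] sh geo by (intro suminf_le summable_sum) auto
    also have "\<dots> = 2" by (subst suminf_geometric) auto
    finally show ?thesis .
  qed
  then have gs: "g summable_on UNIV"
    by (intro nonneg_bdd_above_summable_on) (use g0 in \<open>auto intro!: bdd_aboveI2\<close>)
  show ?thesis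
  proof (intro exI[of _ "\<lambda>v. sqrt (g v)"] conjI allI ballI)
    show "0 \<le> sqrt (g v)" for v using g0 by simp
    show "(\<lambda>v. (sqrt (g v))\<^sup>2) summable_on UNIV" using gs g0 by simp
    fix n v assume "v \<in> B n"
    then have "(1/2)^n / card (B n) = h n v" by (simp add: h_def)
    also have "\<dots> \<le> g v"
      unfolding g_def using sum_le_suminf[OF sh, of "{n}"] h0 by auto
    finally show "sqrt ((1/2)^n / card (B n)) \<le> sqrt (g v)" by simp
  qed
qed

definition box_set :: "nat \<Rightarrow> ('d::finite \<Rightarrow> int) set" where
  "box_set N = {v. \<forall>j. v j \<in> {0..<int N}}"

lemma finite_box_set: "finite (box_set N :: ('d::finite \<Rightarrow> int) set)"
  and card_box_set: "card (box_set N :: ('d::finite \<Rightarrow> int) set) = N ^ CARD('d)"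
proof -
  have eq: "(box_set N :: ('d \<Rightarrow> int) set) = PiE UNIV (\<lambda>_. {0..<int N})"
    by (auto simp: box_set_def PiE_def)
  show "finite (box_set N :: ('d \<Rightarrow> int) set)" unfolding eq by (intro finite_PiE) auto
  show "card (box_set N :: ('d \<Rightarrow> int) set) = N ^ CARD('d)" unfolding eq by (subst card_PiE) auto
qed

lemma card_box_face:
  fixes j :: "'d::finite"
  assumes "c \<in> {0..<int N}"
  shows "card {v \<in> box_set N. v j = c} = N ^ (CARD('d) - 1)"
proof -
  have "{v \<in> box_set N. v j = c} = PiE UNIV (\<lambda>i. if i = j then {c} else {0..<int N})"
    using assms by (auto simp: box_set_def PiE_def Pi_def split: if_splits)
  then have "card {v \<in> box_set N. v j = c} = (\<Prod>i\<in>UNIV. if i = j then 1 else N)"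
    by (simp add: card_PiE if_distrib cong: if_cong)
  also have "\<dots> = (\<Prod>i\<in>UNIV - {j}. N)"
    by (subst prod.remove[of _ j]) (auto intro!: prod.cong)
  also have "\<dots> = N ^ (CARD('d) - 1)" by simp
  finally show ?thesis .
qed

definition edge_boundary :: "('d \<Rightarrow> int) set \<Rightarrow> 'd edge set" where
  "edge_boundary B = {(v, j). (v \<in> B) \<noteq> (v(j := v j + 1) \<in> B)}"

text \<open>The edges on which a cutoff to \<open>B\<close> does not vanish identically; it is
  nonconstant only on those in \<open>edge_boundary B\<close>.\<close>

definition edge_star :: "('d \<Rightarrow> int) set \<Rightarrow> 'd edge set" where
  "edge_star B = {(v, j). v \<in> B \<or> v(j := v j + 1) \<in> B}"

lemma finite_edge_star:
  assumes "finite B" shows "finite (edge_star B :: 'd::finite edge set)"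
proof -
  have "edge_star B \<subseteq> B \<times> UNIV \<union> (\<lambda>(v, j). (v(j := v j - 1), j)) ` (B \<times> UNIV)"
  proof
    fix e :: "'d edge" assume e: "e \<in> edge_star B"
    obtain v j where [simp]: "e = (v, j)" by force
    show "e \<in> B \<times> UNIV \<union> (\<lambda>(v, j). (v(j := v j - 1), j)) ` (B \<times> UNIV)"
    proof (cases "v \<in> B")
      case False
      then have "(v(j := v j + 1), j) \<in> B \<times> UNIV" using e by (simp add: edge_star_def)
      then have "(\<lambda>(v, j). (v(j := v j - 1), j)) (v(j := v j + 1), j)
          \<in> (\<lambda>(v, j). (v(j := v j - 1), j)) ` (B \<times> UNIV)" by (rule imageI)
      then show ?thesis by simp
    qed simp
  qed
  then show ?thesis by (rule finite_subset) (use assms in auto)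
qed

text \<open>A boundary edge in direction j either leaves through the upper face and starts on it, or
  enters through the lower face and starts one step below it. This leaves two faces per
  direction.\<close>

lemma card_edge_boundary_box:
  assumes "0 < N"
  shows "card (edge_boundary (box_set N) :: 'd::finite edge set) \<le> 2 * CARD('d) * N ^ (CARD('d) - 1)"
proof -
  define U where "U j = {v \<in> box_set N. v j = int N - 1}" for j :: 'd
  define L where "L j = {v \<in> box_set N. v j = 0}" for j :: 'd
  have fin: "finite (U j)" "finite (L j)" for j by (auto simp: U_def L_def finite_box_set)
  have card: "card (U j) = N ^ (CARD('d) - 1)" "card (L j) = N ^ (CARD('d) - 1)" for j
    unfolding U_def L_def by (rule card_box_face; use assms in simp)+
  define S where "S j = (\<lambda>v. (v, j)) ` U j \<union> (\<lambda>v. (v(j := v j - 1), j)) ` L j" for j :: 'd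
  have "edge_boundary (box_set N) \<subseteq> (\<Union>j. S j)"
  proof
    fix e :: "'d edge" assume e: "e \<in> edge_boundary (box_set N)"
    obtain v j where [simp]: "e = (v, j)" by force
    show "e \<in> (\<Union>j. S j)"
    proof (cases "v \<in> box_set N")
      case True
      then have "v(j := v j + 1) \<notin> box_set N" using e by (auto simp: edge_boundary_def)
      then obtain i where i: "(v(j := v j + 1)) i \<notin> {0..<int N}" unfolding box_set_def by blast
      have v: "v i \<in> {0..<int N}" "v j \<in> {0..<int N}" using True by (auto simp: box_set_def)
      then have "v j = int N - 1" using i by (cases "i = j") auto
      then have "v \<in> U j" using True by (simp add: U_def)
      then show ?thesis unfolding S_def by auto
    next
      case False
      let ?w = "v(j := v j + 1)"
      have w: "?w \<in> box_set N" using False e by (auto simp: edge_boundary_def)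
      have "?w j = 0"
      proof (rule ccontr)
        assume "?w j \<noteq> 0"
        then have "v i \<in> {0..<int N}" for i
          using spec[OF w[unfolded box_set_def mem_Collect_eq], of i] \<open>?w j \<noteq> 0\<close> by (cases "i = j") auto
        then show False using False by (simp add: box_set_def)
      qed
      then have "?w \<in> L j" using w by (simp add: L_def)
      moreover have "e = (?w(j := ?w j - 1), j)" by simp
      ultimately show ?thesis unfolding S_def by blast
    qed
  qed
  then have "card (edge_boundary (box_set N) :: 'd edge set) \<le> card (\<Union>j. S j)"
    by (intro card_mono) (auto simp: S_def fin)
  also have "\<dots> \<le> (\<Sum>j\<in>UNIV. card (S j))" by (rule card_UN_le) simp
  also have "\<dots> \<le> (\<Sum>j\<in>(UNIV :: 'd set). 2 * N ^ (CARD('d) - 1))"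
  proof (rule sum_mono)
    fix j
    have "card (S j) \<le> card (U j) + card (L j)"
      unfolding S_def by (rule order_trans[OF card_Un_le add_mono[OF card_image_le card_image_le]]) (auto simp: fin)
    then show "card (S j) \<le> 2 * N ^ (CARD('d) - 1)" by (simp add: card)
  qed
  finally show ?thesis by (simp add: mult_ac)
qed

text \<open>Rearranges the boundary terms of the edges into vertex sums.\<close>
lemma edge_star_boundary_sum:
  fixes t0 t1 :: "'d::finite edge \<Rightarrow> complex"
  assumes B: "finite B"
    and t0: "\<And>v j. v \<notin> B \<Longrightarrow> t0 (v, j) = 0" and t1: "\<And>v j. v(j := v j + 1) \<notin> B \<Longrightarrow> t1 (v, j) = 0"
    and v: "\<And>v. v \<in> B \<Longrightarrow> (\<Sum>j\<in>UNIV. t0 (v, j) - t1 (v(j := v j - 1), j)) = 0"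
  shows "(\<Sum>e\<in>edge_star B. t1 e - t0 e) = 0"
proof -
  have "sum t0 (edge_star B) = sum t0 (B \<times> UNIV)"
  proof (rule sum.mono_neutral_right[OF finite_edge_star[OF B]])
    show "\<forall>e\<in>edge_star B - B \<times> UNIV. t0 e = 0" 
    proof
      fix e :: "'d edge" assume e: "e \<in> edge_star B - B \<times> UNIV"
      then have "fst e \<notin> B" by (cases e) auto
      from t0[OF this, of "snd e"] show "t0 e = 0" by simp
    qed
  qed (auto simp: edge_star_def)
  moreover have "sum t1 (edge_star B) = (\<Sum>e\<in>{(v, j). v(j := v j + 1) \<in> B}. t1 e)"
  proof (rule sum.mono_neutral_right[OF finite_edge_star[OF B]])
    show "\<forall>e\<in>edge_star B - {(v, j). v(j := v j + 1) \<in> B}. t1 e = 0" 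
    proof
      fix e :: "'d edge" assume e: "e \<in> edge_star B - {(v, j). v(j := v j + 1) \<in> B}"
      then have "(fst e)(snd e := fst e (snd e) + 1) \<notin> B" by (cases e) auto
      from t1[OF this] show "t1 e = 0" by simp
    qed
  qed (auto simp: edge_star_def)
  \<comment> \<open>An edge whose end lies in \<open>B\<close> is named by that end, as the edge
    entering it in direction j.\<close>
  moreover have "(\<Sum>e\<in>{(v, j). v(j := v j + 1) \<in> B}. t1 e) = (\<Sum>(v, j)\<in>B \<times> UNIV. t1 (v(j := v j - 1), j))"
    by (rule sum.reindex_bij_witness[where i = "\<lambda>(v, j). (v(j := v j - 1), j)" and j = "\<lambda>(v, j). (v(j := v j + 1), j)"]) auto
  moreover have "(\<Sum>(v, j)\<in>B \<times> UNIV. t0 (v, j)) - (\<Sum>(v, j)\<in>B \<times> UNIV. t1 (v(j := v j - 1), j)) = 0"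
  proof -
    have "(\<Sum>(v, j)\<in>B \<times> UNIV. t0 (v, j)) - (\<Sum>(v, j)\<in>B \<times> UNIV. t1 (v(j := v j - 1), j))
        = (\<Sum>v\<in>B. \<Sum>j\<in>UNIV. t0 (v, j) - t1 (v(j := v j - 1), j))"
      by (simp add: sum.cartesian_product sum_subtractf split_def)
    also have "\<dots> = 0" using v by simp
    finally show ?thesis .
  qed
  ultimately show ?thesis by (simp add: sum_subtractf)
qed

section \<open>Bloch solutions\<close>

lemma graph_L2_iff:
  "graph_L2 a f \<longleftrightarrow> (\<forall>e. edge_L2 (a (snd e)) (f e)) \<and> (\<lambda>e. edge_nsq (a (snd e)) (f e)) summable_on UNIV"
  unfolding graph_L2_def edge_nsq_def ..

lemma uniform_bound_finite:
  fixes R :: "'d::finite \<Rightarrow> real \<Rightarrow> complex"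
  assumes "\<And>j. continuous_on {0..a j} (R j)"
  obtains K where "0 \<le> K" "\<And>j x. x \<in> {0..a j} \<Longrightarrow> cmod (R j x) \<le> K"
proof -
  have "\<exists>K>0. \<forall>x\<in>{0..a j}. cmod (R j x) \<le> K" for j
    using compact_imp_bounded[OF compact_continuous_image[OF assms compact_Icc]] by (auto simp: bounded_pos)
  then obtain k where k: "\<And>j. 0 < k j" "\<And>j x. x \<in> {0..a j} \<Longrightarrow> cmod (R j x) \<le> k j" by metis
  \<comment> \<open>There are finitely many directions, so the sum of their bounds serves for
    all.\<close>
  have "k j \<le> sum k UNIV" for j using k(1) by (intro member_le_sum) (auto intro: less_imp_le)
  then show ?thesis using that[of "sum k UNIV"] k by (metis less_imp_le order_trans sum_nonneg)
qed

text \<open>On the edge \<open>(v, j)\<close> the generalized eigenfunction is \<open>W j\<close>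
  times the phase of \<open>v\<close>; \<theta> is the quasimomentum and \<open>c\<close> the value
  at the origin. In \<open>vertex\<close> the edges entering the origin start at its predecessors
  and so carry the factor \<open>cis (- \<theta> j)\<close>. The point \<open>x0\<close> certifies
  that the function is not zero; it stays away from the right end of the edge, where a cutoff
  descending along the edge vanishes.\<close>

locale bloch =
  fixes a :: "'d::finite \<Rightarrow> real" and \<alpha> E :: real and W W' :: "'d \<Rightarrow> real \<Rightarrow> complex"
    and \<theta> :: "'d \<Rightarrow> real" and c :: complex and j0 :: 'd and x0 :: real
  assumes a: "\<And>j. 0 < a j"
    and W: "\<And>j x. (W j has_vector_derivative W' j x) (at x)"
    and W': "\<And>j x. (W' j has_vector_derivative - of_real E * W j x) (at x)"
    and W_0: "\<And>j. W j 0 = c" and W_a: "\<And>j. W j (a j) = cis (\<theta> j) * c"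
    and vertex: "(\<Sum>j\<in>UNIV. W' j 0 - cis (- \<theta> j) * W' j (a j)) = of_real \<alpha> * c"
    and x0: "x0 \<in> {0..<a j0}" "W j0 x0 \<noteq> 0"
begin

lemma a_neq_0 [simp]: "a j \<noteq> 0" using a[of j] by simp

definition phase :: "('d \<Rightarrow> int) \<Rightarrow> complex" where
  "phase v = cis (\<Sum>j\<in>UNIV. \<theta> j * of_int (v j))"

lemma norm_phase: "cmod (phase v) = 1" by (simp add: phase_def)

lemma phase_pred: "phase (v(j := v j - 1)) = phase v * cis (- \<theta> j)"
proof -
  have "(\<Sum>i\<in>UNIV. \<theta> i * of_int ((v(j := v j - 1)) i)) = (\<Sum>i\<in>UNIV. \<theta> i * of_int (v i) - (if i = j then \<theta> j else 0))"
    by (intro sum.cong) (auto simp: algebra_simps)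
  also have "\<dots> = (\<Sum>i\<in>UNIV. \<theta> i * of_int (v i)) + - \<theta> j" by (simp add: sum_subtractf)
  finally show ?thesis unfolding phase_def by (simp add: cis_mult)
qed

section \<open>Cutoff Bloch functions\<close>

definition cut :: "('d \<Rightarrow> int) set \<Rightarrow> ('d \<Rightarrow> int) \<Rightarrow> real" where
  "cut B v = (if v \<in> B then 1 else 0)"

definition jump :: "('d \<Rightarrow> int) set \<Rightarrow> 'd edge \<Rightarrow> real" where
  "jump B = (\<lambda>(v, j). cut B v - cut B (v(j := v j + 1)))"

text \<open>The profile interpolating the cutoff along an edge has zero slope at both ends, so that
  multiplication by it preserves the vertex conditions.\<close>
definition profile :: "('d \<Rightarrow> int) set \<Rightarrow> 'd edge \<Rightarrow> real \<Rightarrow> real" where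
  "profile B = (\<lambda>(v, j) x. cut B (v(j := v j + 1)) + jump B (v, j) * ((1 + cos (pi * x / a j)) / 2))"

definition test :: "('d \<Rightarrow> int) set \<Rightarrow> 'd edge \<Rightarrow> real \<Rightarrow> complex" where
  "test B = (\<lambda>(v, j) x. phase v * W j x * of_real (profile B (v, j) x))"

definition slope :: "'d \<Rightarrow> real \<Rightarrow> real" where
  "slope j x = - (pi / a j) * sin (pi * x / a j) / 2"

definition curv :: "'d \<Rightarrow> real \<Rightarrow> real" where
  "curv j x = - (pi / a j)\<^sup>2 * cos (pi * x / a j) / 2"

definition test' :: "('d \<Rightarrow> int) set \<Rightarrow> 'd edge \<Rightarrow> real \<Rightarrow> complex" where
  "test' B = (\<lambda>(v, j) x. phase v * (W' j x * of_real (profile B (v, j) x) + W j x * of_real (jump B (v, j) * slope j x)))"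

text \<open>The commutator of the second derivative with the cutoff, per unit of jump: 2 W' q' + W
  q'' for q(x) = (1 + cos (pi x / a j)) / 2, with q' = \<open>slope j\<close> and q'' =
  \<open>curv j\<close>.\<close>

definition defect :: "'d \<Rightarrow> real \<Rightarrow> complex" where
  "defect j x = 2 * W' j x * of_real (slope j x) + W j x * of_real (curv j x)"

lemma test_derivative: "(test B e has_vector_derivative test' B e x) (at x)"
proof (cases e)
  case (Pair v j)
  have "(profile B (v, j) has_real_derivative jump B (v, j) * slope j x) (at x)"
    unfolding profile_def slope_def by (auto intro!: derivative_eq_intros simp: algebra_simps)
  from has_vector_derivative_mult[OF W[of j x] has_vector_derivative_of_real[OF this]]
  have "((\<lambda>x. phase v * (W j x * of_real (profile B (v, j) x))) has_vector_derivative
      phase v * (W j x * of_real (jump B (v, j) * slope j x) + W' j x * of_real (profile B (v, j) x))) (at x)"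
    by (intro has_vector_derivative_mult_right)
  then show ?thesis unfolding Pair test_def test'_def by (simp add: mult.assoc add.commute)
qed

lemma test'_derivative:
  "(test' B e has_vector_derivative
     (- of_real E * test B e x + phase (fst e) * of_real (jump B e) * defect (snd e) x)) (at x)"
proof (cases e)
  case (Pair v j)
  have "(profile B (v, j) has_real_derivative jump B (v, j) * slope j x) (at x)"
    unfolding profile_def slope_def by (auto intro!: derivative_eq_intros simp: algebra_simps)
  note 1 = has_vector_derivative_mult[OF W'[of j x] has_vector_derivative_of_real[OF this]]
  have "((\<lambda>x. jump B (v, j) * slope j x) has_real_derivative jump B (v, j) * curv j x) (at x)"
    unfolding slope_def curv_def using a[of j]
    by (auto intro!: derivative_eq_intros simp: power2_eq_square algebra_simps)
  note 2 = has_vector_derivative_mult[OF W[of j x] has_vector_derivative_of_real[OF this]]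
  from has_vector_derivative_mult_right[OF has_vector_derivative_add[OF 1 2], of "phase v"]
  show ?thesis unfolding Pair test_def test'_def defect_def fst_conv snd_conv prod.case
    by (rule has_vector_derivative_eq_rhs) (simp add: algebra_simps)
qed

lemma continuous_W: "continuous_on S (W j)" "continuous_on S (W' j)"
  using W W' by (auto intro!: continuous_at_imp_continuous_on has_vector_derivative_continuous)

lemma continuous_defect: "continuous_on S (defect j)"
  unfolding defect_def slope_def curv_def by (intro continuous_intros continuous_W) auto

lemma continuous_profile: "continuous_on S (profile B e)"
  unfolding profile_def split_def by (intro continuous_intros) auto

lemma profile_bounds:
  shows "0 \<le> profile B e x" and "fst e \<in> B \<Longrightarrow> (1 + cos (pi * x / a (snd e))) / 2 \<le> profile B e x"
proof -
  obtain v j where e: "e = (v, j)" by force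
  have "0 \<le> 1 + cos (pi * x / a j)" "cos (pi * x / a j) \<le> 1"
    using cos_ge_minus_one[of "pi * x / a j"] cos_le_one[of "pi * x / a j"] by linarith+
  then show "0 \<le> profile B e x" and "fst e \<in> B \<Longrightarrow> (1 + cos (pi * x / a (snd e))) / 2 \<le> profile B e x"
    unfolding e profile_def jump_def cut_def by (auto simp: field_simps)
qed

section \<open>Lower bound for the mass of the cutoff solution\<close>

definition mass :: "('d \<Rightarrow> int) set \<Rightarrow> 'd edge \<Rightarrow> real" where
  "mass B e = integral {0..a (snd e)} (\<lambda>x. (cmod (W (snd e) x))\<^sup>2 * profile B e x)"

text \<open>The mass that every edge in direction \<open>j0\<close> starting in \<open>B\<close>
  carries at least, whether or not its other end is in \<open>B\<close>; hence it is independent of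
  the vertex and of the box.\<close>

definition mass0 :: real where
  "mass0 = integral {0..a j0} (\<lambda>x. (cmod (W j0 x))\<^sup>2 * ((1 + cos (pi * x / a j0)) / 2))"

lemma mass_has_integral:
  "((\<lambda>x. (cmod (W (snd e) x))\<^sup>2 * profile B e x) has_integral mass B e) {0..a (snd e)}"
  unfolding mass_def
  by (intro integrable_integral integrable_continuous_interval continuous_intros continuous_W continuous_profile)

lemma mass0_has_integral:
  "((\<lambda>x. (cmod (W j0 x))\<^sup>2 * ((1 + cos (pi * x / a j0)) / 2)) has_integral mass0) {0..a j0}"
  unfolding mass0_def
  by (intro integrable_integral integrable_continuous_interval continuous_intros continuous_W)
     (use a[of j0] in auto)

lemma mass_nonneg: "0 \<le> mass B e"
  by (rule has_integral_nonneg[OF mass_has_integral]) (simp add: profile_bounds)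

lemma mass_ge:
  assumes "v \<in> B" shows "mass0 \<le> mass B (v, j0)"
proof (rule has_integral_le[OF mass0_has_integral mass_has_integral[of "(v, j0)" B, unfolded snd_conv]])
  fix x
  have "(1 + cos (pi * x / a j0)) / 2 \<le> profile B (v, j0) x"
    using profile_bounds(2)[of "(v, j0)" B x] assms by simp
  then show "(cmod (W j0 x))\<^sup>2 * ((1 + cos (pi * x / a j0)) / 2) \<le> (cmod (W j0 x))\<^sup>2 * profile B (v, j0) x"
    by (rule mult_left_mono) simp
qed

text \<open>A continuous nonnegative integrand with integral 0 vanishes everywhere. At
  \<open>x0\<close> both factors are nonzero, since \<open>x0 < a j0\<close> keeps the cosine above
  -1.\<close>

lemma mass0_pos: "0 < mass0"
proof -
  have nn: "0 \<le> (cmod (W j0 x))\<^sup>2 * ((1 + cos (pi * x / a j0)) / 2)" for x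
  proof -
    have "0 \<le> 1 + cos (pi * x / a j0)" using cos_ge_minus_one[of "pi * x / a j0"] by linarith
    then show ?thesis by simp
  qed
  have "mass0 \<noteq> 0"
  proof
    assume "mass0 = 0"
    then have "integral {0..a j0} (\<lambda>x. (cmod (W j0 x))\<^sup>2 * ((1 + cos (pi * x / a j0)) / 2)) = 0"
      by (simp add: mass0_def)
    then have "\<forall>x\<in>{0..a j0}. (cmod (W j0 x))\<^sup>2 * ((1 + cos (pi * x / a j0)) / 2) = 0"
      using a[of j0] nn
      by (subst (asm) integral_eq_0_iff) (auto intro!: continuous_intros continuous_W)
    then have "cos (pi * x0 / a j0) = -1" using x0 by auto
    moreover have "cos pi < cos (pi * x0 / a j0)"
      using x0 a[of j0] by (intro cos_monotone_0_pi) (auto simp: field_simps)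
    ultimately show False by simp
  qed
  moreover have "0 \<le> mass0" by (rule has_integral_nonneg[OF mass0_has_integral nn])
  ultimately show ?thesis by simp
qed

text \<open>Green's identity with the cut-off solution as test function. The conjugate in the
  right-hand side makes its product with the test function the real quantity \<open>g\<close> |W|^2
  times the profile; what remains besides boundary terms is the commutator.\<close>

lemma edge_pairing:
  fixes g :: real
  assumes H: "edge_H2 (a (snd e)) \<psi> \<psi>' \<psi>''"
    and f: "AE x in lborel. x \<in> {0..a (snd e)} \<longrightarrow>
              - \<psi>'' x - of_real E * \<psi> x = of_real g * cnj (phase (fst e) * W (snd e) x)"
  shows "((\<lambda>x. (phase (fst e) * of_real (jump B e) * defect (snd e) x) * \<psi> x) has_integral
     (- of_real (g * mass B e) - ((\<psi>' (a (snd e)) * test B e (a (snd e)) - \<psi> (a (snd e)) * test' B e (a (snd e)))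
                - (\<psi>' 0 * test B e 0 - \<psi> 0 * test' B e 0)))) {0..a (snd e)}"
proof -
  let ?l = "a (snd e)"
  let ?D = "\<lambda>x. phase (fst e) * of_real (jump B e) * defect (snd e) x"
  have ct: "continuous_on {0..?l} (test B e)"
    by (intro continuous_at_imp_continuous_on ballI has_vector_derivative_continuous[OF test_derivative])
  have 1: "((\<lambda>x. \<psi>'' x * test B e x - \<psi> x * (- of_real E * test B e x + ?D x)) has_integral
      ((\<psi>' ?l * test B e ?l - \<psi> ?l * test' B e ?l) - (\<psi>' 0 * test B e 0 - \<psi> 0 * test' B e 0))) {0..?l}"
  proof (rule edge_H2_green[OF H])
    show "0 \<le> ?l" using a[of "snd e"] by simp
    show "continuous_on {0..?l} (\<lambda>x. - of_real E * test B e x + ?D x)"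
      by (intro continuous_intros ct continuous_defect)
  qed (rule has_vector_derivative_at_within[OF test_derivative] has_vector_derivative_at_within[OF test'_derivative])+
  have 2: "((\<lambda>x. complex_of_real (g * ((cmod (W (snd e) x))\<^sup>2 * profile B e x))) has_integral of_real (g * mass B e)) {0..?l}"
    by (intro has_integral_of_real has_integral_mult_right mass_has_integral)
  have "AE x in lborel. x \<in> {0..?l} \<longrightarrow>
      - of_real (g * ((cmod (W (snd e) x))\<^sup>2 * profile B e x)) - (\<psi>'' x * test B e x - \<psi> x * (- of_real E * test B e x + ?D x))
      = ?D x * \<psi> x"
    using f
  proof eventually_elim
    case (elim x)
    show ?case
    proof
      assume "x \<in> {0..?l}"
      have "\<psi>'' x = - of_real E * \<psi> x - (- \<psi>'' x - of_real E * \<psi> x)" by simp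
      also have "- \<psi>'' x - of_real E * \<psi> x = of_real g * cnj (phase (fst e) * W (snd e) x)"
        using elim \<open>x \<in> {0..?l}\<close> by blast
      finally have el: "\<psi>'' x = - of_real E * \<psi> x - of_real g * cnj (phase (fst e) * W (snd e) x)" .
      have t: "test B e x = phase (fst e) * W (snd e) x * of_real (profile B e x)"
        by (simp add: test_def split_def)
      have "cnj (phase (fst e) * W (snd e) x) * (phase (fst e) * W (snd e) x) = of_real ((cmod (W (snd e) x))\<^sup>2)"
        using complex_norm_square[of "phase (fst e) * W (snd e) x"] norm_phase
        by (simp add: norm_mult mult.commute)
      then have "cnj (phase (fst e) * W (snd e) x) * test B e x = of_real ((cmod (W (snd e) x))\<^sup>2 * profile B e x)"
        unfolding t by (simp add: mult.assoc[symmetric])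
      then have eq: "of_real (g * ((cmod (W (snd e) x))\<^sup>2 * profile B e x)) = of_real g * cnj (phase (fst e) * W (snd e) x) * test B e x"
        by (simp add: mult.assoc)
      then show "- of_real (g * ((cmod (W (snd e) x))\<^sup>2 * profile B e x)) - (\<psi>'' x * test B e x - \<psi> x * (- of_real E * test B e x + ?D x))
          = ?D x * \<psi> x"
        unfolding el eq by (simp add: algebra_simps)
    qed
  qed
  from has_integral_AE_cong[OF this has_integral_diff[OF has_integral_neg[OF 2] 1]] show ?thesis by simp
qed

text \<open>Summing the edge identities over \<open>edge_star B\<close>, the boundary terms cancel
  and the commutator survives on boundary edges only, where Cauchy-Schwarz applies. On the other
  side all masses are nonnegative, and keeping just the edges in direction \<open>j0\<close> that
  start in \<open>B\<close> gives the lower bound.\<close>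

lemma pairing_bound:
  fixes \<gamma> :: "('d \<Rightarrow> int) \<Rightarrow> real"
  assumes K0: "0 \<le> K0" "\<And>j x. x \<in> {0..a j} \<Longrightarrow> cmod (defect j x) \<le> K0"
    and \<gamma>: "\<And>v. 0 \<le> \<gamma> v" and B: "finite B" and dom: "delta_domain a \<alpha> \<psi> \<psi>' \<psi>''"
    and eq: "\<And>e. AE x in lborel. x \<in> {0..a (snd e)} \<longrightarrow>
         - \<psi>'' e x - of_real E * \<psi> e x = of_real (\<gamma> (fst e)) * cnj (phase (fst e) * W (snd e) x)"
  shows "mass0 * (\<Sum>v\<in>B. \<gamma> v) \<le> K0 * sqrt (sum a UNIV) *
           (sqrt (card (edge_boundary B)) * sqrt (\<Sum>\<^sub>\<infinity>e. edge_nsq (a (snd e)) (\<psi> e)))"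
proof -
  define K where "K = K0 * sqrt (sum a UNIV)"
  have a_le: "a j \<le> sum a UNIV" for j using a by (intro member_le_sum) (auto intro: less_imp_le)
  have "0 \<le> K" unfolding K_def using K0(1) a by (intro mult_nonneg_nonneg real_sqrt_ge_zero sum_nonneg) (auto intro: less_imp_le)
    define N where "N e = edge_nsq (a (snd e)) (\<psi> e)" for e
    have N: "N summable_on UNIV" "\<And>e. 0 \<le> N e"
      and L2: "\<And>e. edge_L2 (a (snd e)) (\<psi> e)"
      using dom unfolding delta_domain_def graph_L2_iff N_def by (auto simp: edge_nsq_nonneg)
    have H2: "\<And>e. edge_H2 (a (snd e)) (\<psi> e) (\<psi>' e) (\<psi>'' e)" using dom unfolding delta_domain_def by blast
    define t1 where "t1 e = \<psi>' e (a (snd e)) * test B e (a (snd e)) - \<psi> e (a (snd e)) * test' B e (a (snd e))" for e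
    define t0 where "t0 e = \<psi>' e 0 * test B e 0 - \<psi> e 0 * test' B e 0" for e
    define D where "D e = - of_real (\<gamma> (fst e) * mass B e) - (t1 e - t0 e)" for e
    have D: "((\<lambda>x. (phase (fst e) * of_real (jump B e) * defect (snd e) x) * \<psi> e x) has_integral D e) {0..a (snd e)}" for e
      unfolding D_def t1_def t0_def by (rule edge_pairing[OF H2 eq])
    have D0: "D e = 0" if "e \<notin> edge_boundary B" for e
    proof -
      have "jump B e = 0" using that by (cases e) (simp add: edge_boundary_def jump_def cut_def)
      then show ?thesis using has_integral_unique[OF D[of e], of 0] by simp
    qed
    have DK: "cmod (D e) \<le> K * sqrt (N e)" for e
    proof -
      have "cmod (D e) \<le> K0 * sqrt (a (snd e) * edge_nsq (a (snd e)) (\<psi> e))"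
      proof (rule edge_L2_integral_bound[OF L2 a _ _ D])
        show "continuous_on {0..a (snd e)} (\<lambda>x. phase (fst e) * of_real (jump B e) * defect (snd e) x)"
          by (intro continuous_intros continuous_defect)
        fix x assume "x \<in> {0..a (snd e)}"
        then have "1 * \<bar>jump B e\<bar> * cmod (defect (snd e) x) \<le> 1 * 1 * K0"
          using K0 by (intro mult_mono) (auto simp: jump_def cut_def split_def)
        then show "cmod (phase (fst e) * of_real (jump B e) * defect (snd e) x) \<le> K0"
          by (simp add: norm_mult norm_phase)
      qed
      also have "\<dots> \<le> K0 * (sqrt (sum a UNIV) * sqrt (N e))"
        unfolding N_def real_sqrt_mult using a_le[of "snd e"] K0(1)
        by (intro mult_left_mono mult_right_mono) (auto simp: edge_nsq_nonneg)
      finally show ?thesis by (simp add: K_def mult.assoc)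
    qed
    \<comment> \<open>At a vertex of \<open>B\<close> both \<psi> and the test function are
      continuous and satisfy the delta condition with the same \<alpha>, so their Wronskians cancel
      there; elsewhere the test function vanishes together with its slope.\<close>
    have star: "(\<Sum>e\<in>edge_star B. t1 e - t0 e) = 0"
    proof (rule edge_star_boundary_sum[OF B])
      fix v assume v: "v \<notin> B" fix j
      have "profile B (v, j) 0 = 0" using v by (simp add: profile_def jump_def cut_def)
      moreover have "slope j 0 = 0" by (simp add: slope_def)
      ultimately show "t0 (v, j) = 0" by (simp add: t0_def test_def test'_def)
    next
      fix v j assume v: "v(j := v j + 1) \<notin> B"
      have "profile B (v, j) (a j) = 0" using v a[of j] by (simp add: profile_def cut_def)
      moreover have "slope j (a j) = 0" using a[of j] by (simp add: slope_def)
      ultimately show "t1 (v, j) = 0" by (simp add: t1_def test_def test'_def)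
    next
      fix v assume v: "v \<in> B"
      \<comment> \<open>An arbitrary direction will do, as continuity makes the values at
        \<open>v\<close> agree.\<close>
      define \<phi> where "\<phi> = \<psi> (v, undefined) 0"
      have cont: "\<psi> (v, j) 0 = \<phi>" "\<psi> (v(j := v j - 1), j) (a j) = \<phi>" for j
        using dom unfolding delta_domain_def \<phi>_def by blast+
      have delta: "(\<Sum>j\<in>UNIV. \<psi>' (v, j) 0 - \<psi>' (v(j := v j - 1), j) (a j)) = of_real \<alpha> * \<phi>"
        using dom unfolding delta_domain_def \<phi>_def by blast
      have t0: "t0 (v, j) = phase v * (\<psi>' (v, j) 0 * c - \<phi> * W' j 0)" for j
      proof -
        have "profile B (v, j) 0 = 1" using v by (simp add: profile_def jump_def cut_def)
        moreover have "slope j 0 = 0" by (simp add: slope_def)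
        ultimately show ?thesis by (simp add: t0_def test_def test'_def cont W_0 algebra_simps)
      qed
      have t1: "t1 (v(j := v j - 1), j) = phase v * (\<psi>' (v(j := v j - 1), j) (a j) * c - \<phi> * (cis (- \<theta> j) * W' j (a j)))" for j
      proof -
        have "profile B (v(j := v j - 1), j) (a j) = 1" using v a[of j] by (simp add: profile_def cut_def)
        moreover have "slope j (a j) = 0" using a[of j] by (simp add: slope_def)
        moreover have "cis (- \<theta> j) * cis (\<theta> j) = 1" by (simp add: cis_mult)
        then have "cis (\<theta> j) * cis (- \<theta> j) = 1" by (simp add: mult.commute)
        ultimately show ?thesis
          by (simp add: t1_def test_def test'_def cont W_a phase_pred algebra_simps)
      qed
      have "(\<Sum>j\<in>UNIV. t0 (v, j) - t1 (v(j := v j - 1), j)) = phase v *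
         ((\<Sum>j\<in>UNIV. \<psi>' (v, j) 0 - \<psi>' (v(j := v j - 1), j) (a j)) * c
          - \<phi> * (\<Sum>j\<in>UNIV. W' j 0 - cis (- \<theta> j) * W' j (a j)))"
        unfolding t0 t1 sum_distrib_left sum_distrib_right sum_subtractf[symmetric]
        by (intro sum.cong) (auto simp: algebra_simps)
      also have "\<dots> = 0" unfolding delta vertex by simp
      finally show "(\<Sum>j\<in>UNIV. t0 (v, j) - t1 (v(j := v j - 1), j)) = 0" .
    qed
    have fin: "finite (edge_star B)" by (rule finite_edge_star[OF B])
    have sub: "edge_boundary B \<subseteq> edge_star B" by (auto simp: edge_boundary_def edge_star_def)
    then have finb: "finite (edge_boundary B)" using fin finite_subset by blast
    have "mass0 * (\<Sum>v\<in>B. \<gamma> v) = (\<Sum>v\<in>B. \<gamma> v * mass0)" by (simp add: sum_distrib_right mult.commute[of mass0])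
    also have "\<dots> \<le> (\<Sum>v\<in>B. \<gamma> v * mass B (v, j0))" using \<gamma> mass_ge by (intro sum_mono mult_left_mono) auto
    also have "\<dots> = (\<Sum>e\<in>(\<lambda>v. (v, j0)) ` B. \<gamma> (fst e) * mass B e)"
      by (subst sum.reindex) (auto simp: inj_on_def)
    also have "\<dots> \<le> (\<Sum>e\<in>edge_star B. \<gamma> (fst e) * mass B e)"
      using fin \<gamma> mass_nonneg by (intro sum_mono2) (auto simp: edge_star_def)
    also have "\<dots> \<le> cmod (of_real (\<Sum>e\<in>edge_star B. \<gamma> (fst e) * mass B e))" by (simp del: of_real_sum)
    also have "of_real (\<Sum>e\<in>edge_star B. \<gamma> (fst e) * mass B e) = - (\<Sum>e\<in>edge_star B. D e)"
      using star unfolding D_def by (simp add: sum_subtractf sum_negf)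
    also have "(\<Sum>e\<in>edge_star B. D e) = (\<Sum>e\<in>edge_boundary B. D e)"
      using fin sub D0 by (intro sum.mono_neutral_right) auto
    also have "cmod (- (\<Sum>e\<in>edge_boundary B. D e)) \<le> (\<Sum>e\<in>edge_boundary B. K * sqrt (N e))"
      unfolding norm_minus_cancel by (rule order_trans[OF norm_sum sum_mono[OF DK]])
    also have "\<dots> = K * (\<Sum>e\<in>edge_boundary B. sqrt (N e))" by (simp add: sum_distrib_left)
    also have "\<dots> \<le> K * (sqrt (card (edge_boundary B)) * sqrt (\<Sum>\<^sub>\<infinity>e. N e))"
    proof (rule mult_left_mono[OF _ \<open>0 \<le> K\<close>])
      \<comment> \<open>Cauchy-Schwarz over the boundary edges is where their number enters, under a
        square root.\<close>
      have "(\<Sum>e\<in>edge_boundary B. sqrt (N e))\<^sup>2 \<le> (\<Sum>e\<in>edge_boundary B. (sqrt (N e))\<^sup>2) * card (edge_boundary B)"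
        by (rule sum_squared_le_sum_of_squares)
      also have "(\<Sum>e\<in>edge_boundary B. (sqrt (N e))\<^sup>2) = (\<Sum>e\<in>edge_boundary B. N e)" using N by simp
      also have "\<dots> \<le> (\<Sum>\<^sub>\<infinity>e. N e)" using N finb by (intro finite_sum_le_infsum) auto
      finally have "(\<Sum>e\<in>edge_boundary B. sqrt (N e))\<^sup>2 \<le> card (edge_boundary B) * (\<Sum>\<^sub>\<infinity>e. N e)"
        by (simp add: mult.commute mult_right_mono)
      then show "(\<Sum>e\<in>edge_boundary B. sqrt (N e)) \<le> sqrt (card (edge_boundary B)) * sqrt (\<Sum>\<^sub>\<infinity>e. N e)"
        unfolding real_sqrt_mult[symmetric] by (rule real_le_rsqrt)
    qed
    finally show ?thesis unfolding N_def K_def .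
qed

theorem mem_spectrum: "E \<in> delta_lattice_spectrum a \<alpha>"
proof -
  obtain K0 where K0: "0 \<le> K0" "\<And>j x. x \<in> {0..a j} \<Longrightarrow> cmod (defect j x) \<le> K0"
    using uniform_bound_finite[of a defect] continuous_defect by metis
  define K where "K = K0 * sqrt (sum a UNIV)"
  have K: "0 \<le> K" unfolding K_def using K0(1) a
    by (intro mult_nonneg_nonneg real_sqrt_ge_zero sum_nonneg) (auto intro: less_imp_le)
  \<comment> \<open>The side N = 4^n has to beat the factor (1/2)^n of the weight: after squaring,
    the pairing is of order N^d / 2^n = N^(d-1) 2^n, while the boundary contributes only
    N^(d-1).\<close>
  define B where "B n = (box_set (4 ^ n) :: ('d \<Rightarrow> int) set)" for n
  have finB: "finite (B n)" for n unfolding B_def by (rule finite_box_set)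
  obtain \<gamma> where \<gamma>: "\<And>v. 0 \<le> \<gamma> v" "(\<lambda>v. (\<gamma> v)\<^sup>2) summable_on UNIV"
    "\<And>n v. v \<in> B n \<Longrightarrow> sqrt ((1/2)^n / card (B n)) \<le> \<gamma> v"
    using exists_l2_weight[of B, OF finB] by blast
  define f where "f = (\<lambda>(e :: 'd edge) x. of_real (\<gamma> (fst e)) * cnj (phase (fst e) * W (snd e) x))"
  have nsq_f: "edge_nsq l (f (v, j)) = (\<gamma> v)\<^sup>2 * edge_nsq l (W j)" for l v j
    unfolding edge_nsq_def f_def by (simp add: norm_mult norm_phase power_mult_distrib)
  have f: "graph_L2 a f"
    unfolding graph_L2_iff
  proof (intro conjI allI summable_on_edges)
    show "edge_L2 (a (snd e)) (f e)" for e
      unfolding f_def by (intro edge_L2_continuous continuous_intros continuous_W)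
    show "(\<lambda>v. edge_nsq (a (snd (v, j))) (f (v, j))) summable_on UNIV" for j
      unfolding nsq_f snd_conv by (intro summable_on_cmult_left \<gamma>)
  qed
  have "\<not> (\<exists>\<psi> \<psi>' \<psi>''. delta_domain a \<alpha> \<psi> \<psi>' \<psi>'' \<and>
        (\<forall>e. AE x in lborel. x \<in> {0..a (snd e)} \<longrightarrow> - \<psi>'' e x - of_real E * \<psi> e x = f e x))"
  proof
    assume "\<exists>\<psi> \<psi>' \<psi>''. delta_domain a \<alpha> \<psi> \<psi>' \<psi>'' \<and>
        (\<forall>e. AE x in lborel. x \<in> {0..a (snd e)} \<longrightarrow> - \<psi>'' e x - of_real E * \<psi> e x = f e x)"
    then obtain \<psi> \<psi>' \<psi>'' where \<psi>: "delta_domain a \<alpha> \<psi> \<psi>' \<psi>''"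
      "\<And>e. AE x in lborel. x \<in> {0..a (snd e)} \<longrightarrow> - \<psi>'' e x - of_real E * \<psi> e x = f e x" by blast
    define S where "S = (\<Sum>\<^sub>\<infinity>e. edge_nsq (a (snd e)) (\<psi> e))"
    define d where "d = CARD('d)"
    have d: "0 < d" by (simp add: d_def)
    have S: "0 \<le> S" unfolding S_def by (intro infsum_nonneg edge_nsq_nonneg)
    have "mass0\<^sup>2 * 2 ^ n \<le> K\<^sup>2 * (2 * real d) * S" for n
    proof -
      define N where "N = (4::real) ^ n"
      have N: "N > 0" by (simp add: N_def)
      have cB: "real (card (B n)) = N ^ d" by (simp add: B_def card_box_set d_def N_def power_mult[symmetric] mult.commute)
      have "card (edge_boundary (B n)) \<le> 2 * d * (4 ^ n) ^ (d - 1)"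
        unfolding B_def d_def by (rule card_edge_boundary_box) simp
      then have "real (card (edge_boundary (B n))) \<le> real (2 * d * (4 ^ n) ^ (d - 1))"
        by (simp only: of_nat_le_iff)
      then have cE: "real (card (edge_boundary (B n))) \<le> 2 * real d * N ^ (d - 1)" by (simp add: N_def)
      have "N ^ d * sqrt ((1/2)^n / N ^ d) \<le> (\<Sum>v\<in>B n. \<gamma> v)"
        using sum_mono[of "B n" "\<lambda>_. sqrt ((1/2)^n / card (B n))" \<gamma>, OF \<gamma>(3)] cB by simp
      then have "mass0 * (N ^ d * sqrt ((1/2)^n / N ^ d)) \<le> mass0 * (\<Sum>v\<in>B n. \<gamma> v)"
        using mass0_pos by (intro mult_left_mono) auto
      also have "\<dots> \<le> K * (sqrt (card (edge_boundary (B n))) * sqrt S)"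
        unfolding S_def K_def by (rule pairing_bound[OF K0 \<gamma>(1) finB \<psi>(1)]) (use \<psi>(2) in \<open>auto simp: f_def\<close>)
      also have "\<dots> \<le> K * (sqrt (2 * real d * N ^ (d - 1)) * sqrt S)"
        using cE S K by (intro mult_left_mono mult_right_mono) auto
      finally have "(mass0 * (N ^ d * sqrt ((1/2)^n / N ^ d)))\<^sup>2 \<le> (K * (sqrt (2 * real d * N ^ (d - 1)) * sqrt S))\<^sup>2"
        using mass0_pos N by (intro power_mono) auto
      then have "mass0\<^sup>2 * ((N ^ d)\<^sup>2 * ((1/2)^n / N ^ d)) \<le> K\<^sup>2 * (2 * real d * N ^ (d - 1) * S)"
        using N S by (simp add: power_mult_distrib)
      moreover have "(N ^ d)\<^sup>2 * ((1/2)^n / N ^ d) = N ^ (d - 1) * 2 ^ n"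
      proof -
        have "N ^ d = N ^ (d - 1) * N" using d by (metis Suc_pred' power_Suc2)
        moreover have "N * (1/2)^n = 2 ^ n" unfolding N_def power_mult_distrib[symmetric] by simp
        moreover have "(N ^ d)\<^sup>2 * ((1/2)^n / N ^ d) = N ^ d * (1/2)^n" using N by (simp add: power2_eq_square)
        ultimately show ?thesis by (metis mult.assoc)
      qed
      ultimately have "mass0\<^sup>2 * (N ^ (d - 1) * 2 ^ n) \<le> K\<^sup>2 * (2 * real d * N ^ (d - 1) * S)"
        by (simp only:)
      then have "N ^ (d - 1) * (mass0\<^sup>2 * 2 ^ n) \<le> N ^ (d - 1) * (K\<^sup>2 * (2 * real d) * S)"
        by (simp only: mult_ac)
      then show ?thesis by (rule mult_left_le_imp_le) (simp add: N)
    qed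
    moreover obtain n where "K\<^sup>2 * (2 * real d) * S / mass0\<^sup>2 < 2 ^ n"
      using real_arch_pow[of 2 "K\<^sup>2 * (2 * real d) * S / mass0\<^sup>2"] by auto
    moreover have "mass0\<^sup>2 > 0" using mass0_pos by simp
    ultimately show False by (metis mult.commute not_less pos_divide_less_eq)
  qed
  then show ?thesis using f unfolding delta_lattice_spectrum_def by blast
qed

end

section \<open>Fundamental solutions\<close>

text \<open>The solutions of \<open>- f'' = E f\<close> with \<open>f 0 = 1, f' 0 = 0\<close> and \<open>f 0 = 0, f' 0 = 1\<close>.\<close>
definition fundC :: "real \<Rightarrow> real \<Rightarrow> real" where
  "fundC E x = (if 0 < E then cos (sqrt E * x) else if E = 0 then 1 else cosh (sqrt (- E) * x))"

definition fundS :: "real \<Rightarrow> real \<Rightarrow> real" where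
  "fundS E x = (if 0 < E then sin (sqrt E * x) / sqrt E else if E = 0 then x else sinh (sqrt (- E) * x) / sqrt (- E))"

lemma fund_0 [simp]: "fundC E 0 = 1" "fundS E 0 = 0"
  by (auto simp: fundC_def fundS_def)

lemma fundC_derivative: "(fundC E has_real_derivative - E * fundS E x) (at x within S)"
proof -
  consider "0 < E" | "E = 0" | "E < 0" by linarith
  then show ?thesis
  proof cases
    case 1
    have "((\<lambda>x. cos (sqrt E * x)) has_real_derivative - (sqrt E * sin (sqrt E * x))) (at x within S)"
      by (auto intro!: derivative_eq_intros)
    moreover have "sqrt E * sin (sqrt E * x) = E * (sin (sqrt E * x) / sqrt E)"
      using 1 by (simp add: field_simps)
    moreover have "fundC E = (\<lambda>x. cos (sqrt E * x))" using 1 by (auto simp: fundC_def)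
    ultimately show ?thesis using 1 by (simp add: fundS_def)
  next
    case 2
    then have "fundC E = (\<lambda>x. 1)" by (auto simp: fundC_def)
    then show ?thesis using 2 by simp
  next
    case 3
    have "((\<lambda>x. cosh (sqrt (- E) * x)) has_real_derivative sqrt (- E) * sinh (sqrt (- E) * x)) (at x within S)"
      by (auto intro!: derivative_eq_intros)
    moreover have "sqrt (- E) * sinh (sqrt (- E) * x) = - E * (sinh (sqrt (- E) * x) / sqrt (- E))"
    proof -
      have "sqrt (- E) * sqrt (- E) = - E" using 3 by simp
      then have "- E / sqrt (- E) = sqrt (- E)" using 3 by (metis nonzero_mult_div_cancel_left real_sqrt_eq_zero_cancel_iff neg_equal_0_iff_equal less_irrefl)
      then show ?thesis by (metis times_divide_eq_left times_divide_eq_right)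
    qed
    moreover have "fundC E = (\<lambda>x. cosh (sqrt (- E) * x))" using 3 by (auto simp: fundC_def)
    ultimately show ?thesis using 3 by (simp add: fundS_def)
  qed
qed

lemma fundS_derivative: "(fundS E has_real_derivative fundC E x) (at x within S)"
proof -
  consider "0 < E" | "E = 0" | "E < 0" by linarith
  then show ?thesis
  proof cases
    case 1
    have "((\<lambda>x. sin (k * x) / k) has_real_derivative cos (k * x)) (at x within S)" if "k \<noteq> 0" for k
      using that by (auto intro!: derivative_eq_intros)
    from this[of "sqrt E"] have "((\<lambda>x. sin (sqrt E * x) / sqrt E) has_real_derivative cos (sqrt E * x)) (at x within S)"
      using 1 by simp
    moreover have "fundS E = (\<lambda>x. sin (sqrt E * x) / sqrt E)" using 1 by (auto simp: fundS_def)
    ultimately show ?thesis using 1 by (simp add: fundC_def)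
  next
    case 2
    then have "fundS E = (\<lambda>x. x)" by (auto simp: fundS_def)
    then show ?thesis using 2 by (simp add: fundC_def)
  next
    case 3
    have "((\<lambda>x. sinh (k * x) / k) has_real_derivative cosh (k * x)) (at x within S)" if "k \<noteq> 0" for k
      using that by (auto intro!: derivative_eq_intros)
    from this[of "sqrt (- E)"] have "((\<lambda>x. sinh (sqrt (- E) * x) / sqrt (- E)) has_real_derivative cosh (sqrt (- E) * x)) (at x within S)"
      using 3 by simp
    moreover have "fundS E = (\<lambda>x. sinh (sqrt (- E) * x) / sqrt (- E))" using 3 by (auto simp: fundS_def)
    ultimately show ?thesis using 3 by (simp add: fundC_def)
  qed
qed

lemma fund_wronskian: "(fundC E x)\<^sup>2 + E * (fundS E x)\<^sup>2 = 1"
proof -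
  consider "0 < E" | "E = 0" | "E < 0" by linarith
  then show ?thesis
    by cases (auto simp: fundC_def fundS_def power_divide cosh_square_eq)
qed

lemma fundC_vector_derivative:
  "((\<lambda>x. complex_of_real (fundC E x)) has_vector_derivative - of_real E * of_real (fundS E x)) (at x within S)"
  using has_vector_derivative_of_real[OF fundC_derivative] by simp

lemma fundS_vector_derivative:
  "((\<lambda>x. complex_of_real (fundS E x)) has_vector_derivative of_real (fundC E x)) (at x within S)"
  by (rule has_vector_derivative_of_real[OF fundS_derivative])

lemma continuous_fund: "continuous_on S (fundC E)" "continuous_on S (fundS E)"
  by (auto intro!: DERIV_continuous_on fundC_derivative fundS_derivative)

text \<open>The Bloch solution is sin(k x) on the edges in direction \<open>l\<close> and 0 on all
  others. It vanishes at the vertices, so the delta condition reads that the outgoing derivatives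
  sum to 0, and the phase m pi per step matches the slopes of consecutive edges. At
  \<open>a l / (2 m)\<close> the sine has its first maximum.\<close>

lemma dirichlet_mem_spectrum:
  fixes a :: "'d::finite \<Rightarrow> real"
  assumes a: "\<And>j. 0 < a j" and m: "1 \<le> m"
  shows "(real m * pi / a l)\<^sup>2 \<in> delta_lattice_spectrum a \<alpha>"
proof -
  define k where "k = real m * pi / a l"
  have k: "k * a l = real m * pi" using a[of l] by (simp add: k_def)
  interpret bloch a \<alpha> "k\<^sup>2" "\<lambda>j x. if j = l then of_real (sin (k * x)) else 0"
    "\<lambda>j x. if j = l then of_real (k * cos (k * x)) else 0" "\<lambda>j. if j = l then real m * pi else 0" 0 l "a l / (2 * real m)"
  proof
    show "((\<lambda>x. if j = l then complex_of_real (sin (k * x)) else 0) has_vector_derivative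
        (if j = l then of_real (k * cos (k * x)) else 0)) (at x)" for j x
    proof (cases "j = l")
      case True
      have "((\<lambda>x. sin (k * x)) has_real_derivative k * cos (k * x)) (at x)"
        by (auto intro!: derivative_eq_intros)
      from has_vector_derivative_of_real[OF this] show ?thesis using True by simp
    qed simp
    show "((\<lambda>x. if j = l then complex_of_real (k * cos (k * x)) else 0) has_vector_derivative
        - complex_of_real (k\<^sup>2) * (if j = l then of_real (sin (k * x)) else 0)) (at x)" for j x
    proof (cases "j = l")
      case True
      have "((\<lambda>x. k * cos (k * x)) has_real_derivative - (k\<^sup>2) * sin (k * x)) (at x)"
        by (auto intro!: derivative_eq_intros simp: power2_eq_square)
      from has_vector_derivative_of_real[OF this] show ?thesis using True by simp
    qed simp
    show "(if j = l then complex_of_real (sin (k * a j)) else 0) = cis (if j = l then real m * pi else 0) * 0" for j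
      using k by auto
    have "cis (- (real m * pi)) * cos (real m * pi) = 1"
      by (auto simp: complex_eq_iff cos_npi power_mult_distrib[symmetric])
    then have "(if j = l then complex_of_real (k * cos (k * 0)) else 0) -
        cis (- (if j = l then real m * pi else 0)) * (if j = l then of_real (k * cos (k * a j)) else 0) = 0" for j
      using k by (auto simp: algebra_simps)
    then show "(\<Sum>j\<in>UNIV. (if j = l then complex_of_real (k * cos (k * 0)) else 0) -
        cis (- (if j = l then real m * pi else 0)) * (if j = l then of_real (k * cos (k * a j)) else 0)) = of_real \<alpha> * 0"
      by simp
    show "a l / (2 * real m) \<in> {0..<a l}" using a[of l] m by (auto simp: field_simps)
    have "k * (a l / (2 * real m)) = pi / 2" using k m by (simp add: field_simps)
    then show "(if l = l then complex_of_real (sin (k * (a l / (2 * real m)))) else 0) \<noteq> 0"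
      by (simp only: sin_pi_half if_True) simp
  qed (use a in auto)
  show ?thesis using mem_spectrum unfolding k_def .
qed

text \<open>A Bloch solution with value 1 at the origin exists iff some \<theta> satisfies the sum
  over j of 2 cos(\<theta> j) / S_j = b. Taking all cosines equal to a common t up to the sign of
  S_j, the left side is t s, so t = b / s; the hypothesis is exactly |t| \<le> 1.\<close>

lemma nonresonant_mem_spectrum:
  fixes a :: "'d::finite \<Rightarrow> real"
  assumes a: "\<And>j. 0 < a j" and S: "\<And>j. fundS E (a j) \<noteq> 0"
    and le: "\<bar>\<alpha> + (\<Sum>j\<in>UNIV. 2 * fundC E (a j) / fundS E (a j))\<bar> \<le> (\<Sum>j\<in>UNIV. 2 / \<bar>fundS E (a j)\<bar>)"
  shows "E \<in> delta_lattice_spectrum a \<alpha>"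
proof -
  define b where "b = \<alpha> + (\<Sum>j\<in>UNIV. 2 * fundC E (a j) / fundS E (a j))"
  define s where "s = (\<Sum>j\<in>UNIV. 2 / \<bar>fundS E (a j)\<bar>)"
  define t where "t = b / s"
  have s: "0 < s" unfolding s_def using S by (intro sum_pos) auto
  have t: "\<bar>t\<bar> \<le> 1" using le s unfolding t_def b_def[symmetric] s_def[symmetric] by (simp add: abs_divide)
  define \<theta> where "\<theta> j = arccos (sgn (fundS E (a j)) * t)" for j
  have "\<bar>sgn (fundS E (a j)) * t\<bar> \<le> 1" for j using t S[of j] by (simp add: abs_mult abs_sgn_eq)
  then have cos\<theta>: "cos (\<theta> j) = sgn (fundS E (a j)) * t" for j
    unfolding \<theta>_def by (intro cos_arccos_abs)
  \<comment> \<open>The initial slope forced by the value \<open>cis (\<theta> j)\<close> at the far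
    end.\<close>
  define \<beta> where "\<beta> j = (cis (\<theta> j) - of_real (fundC E (a j))) / of_real (fundS E (a j))" for j
  interpret bloch a \<alpha> E "\<lambda>j x. of_real (fundC E x) + \<beta> j * of_real (fundS E x)"
    "\<lambda>j x. - of_real E * of_real (fundS E x) + \<beta> j * of_real (fundC E x)" \<theta> 1 undefined 0
  proof
    show "((\<lambda>x. complex_of_real (fundC E x) + \<beta> j * of_real (fundS E x)) has_vector_derivative
        - of_real E * of_real (fundS E x) + \<beta> j * of_real (fundC E x)) (at x)" for j x
      by (intro has_vector_derivative_add has_vector_derivative_mult_right fundC_vector_derivative fundS_vector_derivative)
    show "((\<lambda>x. - of_real E * complex_of_real (fundS E x) + \<beta> j * of_real (fundC E x)) has_vector_derivative
        - of_real E * (of_real (fundC E x) + \<beta> j * of_real (fundS E x))) (at x)" for j x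
      by (rule has_vector_derivative_eq_rhs[OF has_vector_derivative_add[OF has_vector_derivative_mult_right[OF fundS_vector_derivative]
            has_vector_derivative_mult_right[OF fundC_vector_derivative]]]) (simp add: algebra_simps)
    show "complex_of_real (fundC E (a j)) + \<beta> j * of_real (fundS E (a j)) = cis (\<theta> j) * 1" for j
      using S[of j] by (simp add: \<beta>_def)
    \<comment> \<open>Each direction contributes 2 (cos(\<theta> j) - C_j) / S_j to the vertex sum,
      once the Wronskian identity has absorbed the factor E.\<close>
    have vj: "- of_real E * of_real (fundS E 0) + \<beta> j * of_real (fundC E 0) -
        cis (- \<theta> j) * (- of_real E * of_real (fundS E (a j)) + \<beta> j * of_real (fundC E (a j)))
      = complex_of_real (t * (2 / \<bar>fundS E (a j)\<bar>) - 2 * fundC E (a j) / fundS E (a j))" (is "?L = _") for j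
    proof -
      let ?C = "complex_of_real (fundC E (a j))" and ?S = "complex_of_real (fundS E (a j))"
      have W: "?C\<^sup>2 + of_real E * ?S\<^sup>2 = 1"
        using arg_cong[OF fund_wronskian[of E "a j"], of complex_of_real] by simp
      have z: "cis (- \<theta> j) * cis (\<theta> j) = 1" by (simp add: cis_mult)
      have zz: "cis (\<theta> j) + cis (- \<theta> j) = 2 * of_real (cos (\<theta> j))" by (simp add: complex_eq_iff)
      have S': "?S \<noteq> 0" using S by simp
      have "?L * ?S = cis (\<theta> j) - ?C - cis (- \<theta> j) * (- of_real E * ?S\<^sup>2 + (cis (\<theta> j) - ?C) * ?C)"
        using S' by (simp add: \<beta>_def field_simps power2_eq_square)
      also have "\<dots> = cis (\<theta> j) - ?C - (cis (- \<theta> j) * cis (\<theta> j)) * ?C + cis (- \<theta> j) * (?C\<^sup>2 + of_real E * ?S\<^sup>2)"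
        by (simp add: algebra_simps power2_eq_square)
      also have "\<dots> = (cis (\<theta> j) + cis (- \<theta> j)) - 2 * ?C" unfolding W z by simp
      also have "\<dots> = of_real (2 * (sgn (fundS E (a j)) * t) - 2 * fundC E (a j))" unfolding zz cos\<theta> by simp
      finally have "?L = of_real (2 * (sgn (fundS E (a j)) * t) - 2 * fundC E (a j)) / ?S"
        using S' by (simp add: field_simps)
      also have "\<dots> = of_real ((2 * (sgn (fundS E (a j)) * t) - 2 * fundC E (a j)) / fundS E (a j))" by simp
      also have "(2 * (sgn (fundS E (a j)) * t) - 2 * fundC E (a j)) / fundS E (a j)
          = t * (2 / \<bar>fundS E (a j)\<bar>) - 2 * fundC E (a j) / fundS E (a j)"
        using S[of j] by (auto simp: sgn_if abs_if field_simps)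
      finally show ?thesis .
    qed
    have "(\<Sum>j\<in>UNIV. t * (2 / \<bar>fundS E (a j)\<bar>) - 2 * fundC E (a j) / fundS E (a j)) = t * s - (b - \<alpha>)"
      by (simp add: sum_subtractf sum_distrib_left s_def b_def)
    also have "\<dots> = \<alpha>" using s by (simp add: t_def)
    finally show "(\<Sum>j\<in>UNIV. - of_real E * of_real (fundS E 0) + \<beta> j * of_real (fundC E 0) -
        cis (- \<theta> j) * (- of_real E * of_real (fundS E (a j)) + \<beta> j * of_real (fundC E (a j)))) = complex_of_real \<alpha> * 1"
      unfolding vj of_real_sum[symmetric] by simp
  qed (use a in auto)
  show ?thesis by (rule mem_spectrum)
qed

section \<open>Square-summable functions on the vertices\<close>

text \<open>A bound over all finite subsets survives pointwise limits and makes sense before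
  summability is known.\<close>

definition l2_bounded :: "real \<Rightarrow> ('v \<Rightarrow> 'b::real_normed_vector) \<Rightarrow> bool" where
  "l2_bounded M h \<longleftrightarrow> 0 \<le> M \<and> (\<forall>F. finite F \<longrightarrow> L2_set (\<lambda>v. norm (h v)) F \<le> M)"

lemma l2_boundedD: "l2_bounded M h \<Longrightarrow> finite F \<Longrightarrow> L2_set (\<lambda>v. norm (h v)) F \<le> M"
  by (simp add: l2_bounded_def)

lemma l2_bounded_summable:
  assumes "l2_bounded M h" shows "(\<lambda>v. (norm (h v))\<^sup>2) summable_on UNIV"
proof (rule nonneg_bdd_above_summable_on)
  show "bdd_above (sum (\<lambda>v. (norm (h v))\<^sup>2) ` {F. F \<subseteq> UNIV \<and> finite F})"
  proof (rule bdd_aboveI2)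
    fix F :: "'a set" assume "F \<in> {F. F \<subseteq> UNIV \<and> finite F}"
    then have "sqrt (\<Sum>v\<in>F. (norm (h v))\<^sup>2) \<le> M"
      using l2_boundedD[OF assms, of F] by (simp add: L2_set_def)
    then show "(\<Sum>v\<in>F. (norm (h v))\<^sup>2) \<le> M\<^sup>2" by (rule sqrt_le_D)
  qed
qed simp

lemma summable_l2_bounded:
  assumes "(\<lambda>v. (norm (h v))\<^sup>2) summable_on UNIV"
  shows "l2_bounded (sqrt (\<Sum>\<^sub>\<infinity>v. (norm (h v))\<^sup>2)) h"
  unfolding l2_bounded_def L2_set_def
  using finite_sum_le_infsum[OF assms] by (auto intro!: infsum_nonneg)

lemma l2_bounded_norm_le: "l2_bounded M h \<Longrightarrow> norm (h v) \<le> M"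
  using l2_boundedD[of M h "{v}"] by simp

lemma l2_bounded_mono:
  assumes h: "l2_bounded M h" and K: "0 \<le> K" and le: "\<And>v. norm (g v) \<le> K * norm (h v)"
  shows "l2_bounded (K * M) g"
  unfolding l2_bounded_def
proof (intro conjI allI impI)
  show "0 \<le> K * M" using h K by (simp add: l2_bounded_def)
  fix F :: "'a set" assume "finite F"
  then have "K * L2_set (\<lambda>v. norm (h v)) F \<le> K * M" using l2_boundedD[OF h] K by (intro mult_left_mono) auto
  moreover have "L2_set (\<lambda>v. norm (g v)) F \<le> K * L2_set (\<lambda>v. norm (h v)) F"
    unfolding L2_set_right_distrib[OF K] by (intro L2_set_mono le) auto
  ultimately show "L2_set (\<lambda>v. norm (g v)) F \<le> K * M" by linarith
qed

lemma l2_bounded_add: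
  assumes "l2_bounded M h" "l2_bounded N g" shows "l2_bounded (M + N) (\<lambda>v. h v + g v)"
  unfolding l2_bounded_def
proof (intro conjI allI impI)
  show "0 \<le> M + N" using assms by (simp add: l2_bounded_def)
  fix F :: "'a set" assume F: "finite F"
  have "L2_set (\<lambda>v. norm (h v + g v)) F \<le> L2_set (\<lambda>v. norm (h v) + norm (g v)) F"
    by (intro L2_set_mono norm_triangle_ineq) auto
  also have "\<dots> \<le> L2_set (\<lambda>v. norm (h v)) F + L2_set (\<lambda>v. norm (g v)) F" by (rule L2_set_triangle_ineq)
  also have "\<dots> \<le> M + N" using l2_boundedD[OF assms(1) F] l2_boundedD[OF assms(2) F] by simp
  finally show "L2_set (\<lambda>v. norm (h v + g v)) F \<le> M + N" .
qed

lemma l2_bounded_zero: "l2_bounded 0 (\<lambda>v. 0)"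
  by (simp add: l2_bounded_def L2_set_def)

lemma l2_bounded_sum:
  assumes "\<And>i. i \<in> I \<Longrightarrow> l2_bounded (M i) (h i)"
  shows "l2_bounded (sum M I) (\<lambda>v. \<Sum>i\<in>I. h i v)"
  using assms
proof (induction I rule: infinite_finite_induct)
  case (insert i I)
  then show ?case by (simp add: l2_bounded_add)
qed (auto simp: l2_bounded_zero)

lemma l2_bounded_comp_inj:
  fixes \<pi> :: "'u \<Rightarrow> 'v"
  assumes h: "l2_bounded M h" and "inj \<pi>" shows "l2_bounded M (\<lambda>v. h (\<pi> v))"
  unfolding l2_bounded_def
proof (intro conjI allI impI)
  show "0 \<le> M" using h by (simp add: l2_bounded_def)
  fix F :: "'u set" assume F: "finite F"
  have "L2_set (\<lambda>v. norm (h (\<pi> v))) F = L2_set (\<lambda>v. norm (h v)) (\<pi> ` F)"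
    unfolding L2_set_def using assms(2) by (subst sum.reindex) (auto intro: inj_on_subset)
  then show "L2_set (\<lambda>v. norm (h (\<pi> v))) F \<le> M" using l2_boundedD[OF h, of "\<pi> ` F"] F by simp
qed

lemma inj_vertex_shift: "inj (\<lambda>v :: 'd \<Rightarrow> int. v(j := v j + c))"
proof (rule injI)
  fix v w :: "'d \<Rightarrow> int" assume eq: "v(j := v j + c) = w(j := w j + c)"
  show "v = w"
  proof
    fix i show "v i = w i" using fun_cong[OF eq, of i] by (cases "i = j") auto
  qed
qed

lemma inj_vertex_pred: "inj (\<lambda>v :: 'd \<Rightarrow> int. v(j := v j - 1))"
  using inj_vertex_shift[of j "- 1"] by simp

section \<open>The hopping operator and the inversion of the vertex equation\<close>

definition hop :: "('d::finite \<Rightarrow> real) \<Rightarrow> (('d \<Rightarrow> int) \<Rightarrow> complex) \<Rightarrow> ('d \<Rightarrow> int) \<Rightarrow> complex" where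
  "hop c h v = (\<Sum>j\<in>UNIV. of_real (c j) * (h (v(j := v j + 1)) + h (v(j := v j - 1))))"

text \<open>Each direction involves two shifts, and every shift preserves the norm because it is
  injective on vertices.\<close>

lemma l2_bounded_hop:
  assumes h: "l2_bounded M h" shows "l2_bounded (2 * (\<Sum>j\<in>UNIV. \<bar>c j\<bar>) * M) (hop c h)"
proof -
  have "l2_bounded (\<Sum>j\<in>UNIV. \<bar>c j\<bar> * (M + M)) (hop c h)"
    unfolding hop_def
    by (intro l2_bounded_sum l2_bounded_mono[OF l2_bounded_add[OF l2_bounded_comp_inj[OF h inj_vertex_shift] l2_bounded_comp_inj[OF h inj_vertex_pred]]])
       (auto simp: norm_mult)
  moreover have "(\<Sum>j\<in>UNIV. \<bar>c j\<bar> * (M + M)) = 2 * (\<Sum>j\<in>UNIV. \<bar>c j\<bar>) * M"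
    by (simp add: sum_distrib_left sum_distrib_right mult_ac)
  ultimately show ?thesis by simp
qed

text \<open>Neumann series.\<close>
lemma hop_solve:
  fixes c :: "'d::finite \<Rightarrow> real" and g :: "('d \<Rightarrow> int) \<Rightarrow> complex"
  assumes c: "2 * (\<Sum>j\<in>UNIV. \<bar>c j\<bar>) < \<bar>b\<bar>" and g: "l2_bounded G g"
  shows "\<exists>\<phi> M. l2_bounded M \<phi> \<and> (\<forall>v. hop c \<phi> v - of_real b * \<phi> v = g v)"
proof -
  define q where "q = 2 * (\<Sum>j\<in>UNIV. \<bar>c j\<bar>) / \<bar>b\<bar>"
  have c0: "0 \<le> (\<Sum>j\<in>UNIV. \<bar>c j\<bar>)" by (intro sum_nonneg) auto
  then have "0 < \<bar>b\<bar>" using c by linarith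
  then have b: "b \<noteq> 0" by simp
  have q: "0 \<le> q" "q < 1" using c0 c b unfolding q_def by (auto simp: divide_less_eq)
  define G' where "G' = G / \<bar>b\<bar>"
  \<comment> \<open>The n-th term is (hop / b)^n applied to -g / b; the sum inverts 1 - hop /
    b.\<close>
  define \<delta> where "\<delta> = rec_nat (\<lambda>v. - g v / of_real b) (\<lambda>_ h v. hop c h v / of_real b)"
  have \<delta>0: "\<delta> 0 v = - g v / of_real b" and \<delta>S: "\<delta> (Suc n) v = hop c (\<delta> n) v / of_real b" for n v
    by (simp_all add: \<delta>_def)
  have \<delta>: "l2_bounded (q ^ n * G') (\<delta> n)" for n
  proof (induction n)
    case 0
    have "l2_bounded (1 / \<bar>b\<bar> * G) (\<delta> 0)"
      by (rule l2_bounded_mono[OF g]) (auto simp: \<delta>0 norm_divide)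
    then show ?case by (simp add: G'_def)
  next
    case (Suc n)
    have "l2_bounded (1 / \<bar>b\<bar> * (2 * (\<Sum>j\<in>UNIV. \<bar>c j\<bar>) * (q ^ n * G'))) (\<delta> (Suc n))"
      by (rule l2_bounded_mono[OF l2_bounded_hop[OF Suc, of c]]) (auto simp: \<delta>S norm_divide)
    moreover have "1 / \<bar>b\<bar> * (2 * (\<Sum>j\<in>UNIV. \<bar>c j\<bar>) * (q ^ n * G')) = q ^ Suc n * G'"
      unfolding power_Suc by (subst (2) q_def) simp
    ultimately show ?case by simp
  qed
  have geo: "(\<lambda>n. q ^ n * G') sums (1 / (1 - q) * G')"
    using q by (intro sums_mult2 geometric_sums) auto
  define \<phi> where "\<phi> v = (\<Sum>n. \<delta> n v)" for v
  have sm: "(\<lambda>n. \<delta> n v) sums \<phi> v" for v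
    unfolding \<phi>_def
    by (intro summable_sums summable_comparison_test'[OF sums_summable[OF geo]] l2_bounded_norm_le[OF \<delta>])
  have G0: "0 \<le> G'" using g by (simp add: l2_bounded_def G'_def)
  have "l2_bounded (1 / (1 - q) * G') \<phi>"
    unfolding l2_bounded_def
  proof (intro conjI allI impI)
    show "0 \<le> 1 / (1 - q) * G'" using q G0 by simp
    fix F :: "('d \<Rightarrow> int) set" assume F: "finite F"
    \<comment> \<open>On a finite set the norm depends on finitely many values, so the bound for the
      partial sums passes to the pointwise limit.\<close>
    have "(\<lambda>n. L2_set (\<lambda>v. norm (\<Sum>i<n. \<delta> i v)) F) \<longlonglongrightarrow> L2_set (\<lambda>v. norm (\<phi> v)) F"
      unfolding L2_set_def using sm unfolding sums_def by (intro tendsto_intros)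
    moreover have "L2_set (\<lambda>v. norm (\<Sum>i<n. \<delta> i v)) F \<le> 1 / (1 - q) * G'" for n
    proof -
      have "L2_set (\<lambda>v. norm (\<Sum>i<n. \<delta> i v)) F \<le> (\<Sum>i<n. q ^ i * G')"
        by (rule l2_boundedD[OF l2_bounded_sum[OF \<delta>] F])
      also have "\<dots> \<le> 1 / (1 - q) * G'"
        using sum_le_suminf[OF sums_summable[OF geo], of "{..<n}"] sums_unique[OF geo] q G0 by auto
      finally show ?thesis .
    qed
    ultimately show "L2_set (\<lambda>v. norm (\<phi> v)) F \<le> 1 / (1 - q) * G'" by (blast intro: LIMSEQ_le_const2)
  qed
  moreover have "hop c \<phi> v - of_real b * \<phi> v = g v" for v
  proof -
    have "(\<lambda>n. hop c (\<delta> n) v / of_real b) sums (hop c \<phi> v / of_real b)"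
      unfolding hop_def by (intro sums_divide sums_sum sums_mult sums_add sm)
    then have "(\<lambda>n. \<delta> (Suc n) v) sums (hop c \<phi> v / of_real b)" by (simp add: \<delta>S)
    then have "(\<lambda>n. \<delta> n v) sums (hop c \<phi> v / of_real b + \<delta> 0 v)" by (rule sums_Suc)
    then have "\<phi> v = hop c \<phi> v / of_real b - g v / of_real b" using sums_unique2[OF sm] by (simp add: \<delta>0)
    then show ?thesis using b by (simp add: field_simps)
  qed
  ultimately show ?thesis by blast
qed

text \<open>Iterating \<phi> = hop \<phi> / b contracts the sup bound by q < 1. Working in the sup
  norm means that the vertex values of an eigenfunction only have to be shown bounded.\<close>

lemma hop_unique:
  fixes c :: "'d::finite \<Rightarrow> real"
  assumes c: "2 * (\<Sum>j\<in>UNIV. \<bar>c j\<bar>) < \<bar>b\<bar>" and M: "\<And>v. cmod (\<phi> v) \<le> M"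
    and eq: "\<And>v. hop c \<phi> v - of_real b * \<phi> v = 0"
  shows "\<phi> v = 0"
proof -
  define q where "q = 2 * (\<Sum>j\<in>UNIV. \<bar>c j\<bar>) / \<bar>b\<bar>"
  have c0: "0 \<le> (\<Sum>j\<in>UNIV. \<bar>c j\<bar>)" by (intro sum_nonneg) auto
  then have "0 < \<bar>b\<bar>" using c by linarith
  then have b: "b \<noteq> 0" by simp
  have q: "0 \<le> q" "q < 1" using c0 c b unfolding q_def by (auto simp: divide_less_eq)
  have le: "cmod (\<phi> v) \<le> q ^ n * M" for n v
  proof (induction n arbitrary: v)
    case (Suc n)
    have "of_real b * \<phi> v = hop c \<phi> v" using eq[of v] by simp
    then have "\<bar>b\<bar> * cmod (\<phi> v) = cmod (hop c \<phi> v)" by (metis norm_mult norm_of_real real_norm_def)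
    also have "\<dots> \<le> (\<Sum>j\<in>UNIV. \<bar>c j\<bar> * (q ^ n * M + q ^ n * M))"
      unfolding hop_def
    proof (rule order_trans[OF norm_sum sum_mono])
      fix j
      have "cmod (\<phi> (v(j := v j + 1)) + \<phi> (v(j := v j - 1))) \<le> q ^ n * M + q ^ n * M"
        by (rule order_trans[OF norm_triangle_ineq add_mono[OF Suc Suc]])
      then show "cmod (of_real (c j) * (\<phi> (v(j := v j + 1)) + \<phi> (v(j := v j - 1)))) \<le> \<bar>c j\<bar> * (q ^ n * M + q ^ n * M)"
        by (simp add: norm_mult mult_left_mono)
    qed
    also have "\<dots> = \<bar>b\<bar> * (q ^ Suc n * M)"
    proof -
      have "(\<Sum>j\<in>UNIV. \<bar>c j\<bar> * (q ^ n * M + q ^ n * M)) = (2 * (\<Sum>j\<in>UNIV. \<bar>c j\<bar>)) * (q ^ n * M)"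
        unfolding sum_distrib_right[symmetric] by simp
      also have "2 * (\<Sum>j\<in>UNIV. \<bar>c j\<bar>) = \<bar>b\<bar> * q" using b by (simp add: q_def)
      finally show ?thesis by simp
    qed
    finally show ?case using b by simp
  qed (simp add: M)
  have "(\<lambda>n. q ^ n * M) \<longlonglongrightarrow> 0 * M" using q by (intro tendsto_intros LIMSEQ_realpow_zero)
  then have "cmod (\<phi> v) \<le> 0 * M" by (rule LIMSEQ_le_const) (use le in blast)
  then show ?thesis by simp
qed

section \<open>Edge equations\<close>

lemma edge_nsq_le_bound:
  assumes "0 \<le> l" "continuous_on {0..l} f" "\<And>x. x \<in> {0..l} \<Longrightarrow> cmod (f x) \<le> M"
  shows "edge_nsq l f \<le> l * M\<^sup>2"
proof -
  have "((\<lambda>x. M\<^sup>2) has_integral (l - 0) *\<^sub>R M\<^sup>2) {0..l}"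
    using has_integral_const_real[of "M\<^sup>2" 0 l] assms(1) by simp
  then have "((\<lambda>x. M\<^sup>2) has_integral l * M\<^sup>2) {0..l}" by simp
  then show ?thesis
    by (rule has_integral_le[OF edge_L2_nsq_has_integral[OF edge_L2_continuous[OF assms(2)]]])
       (simp add: assms(3) power_mono)
qed

lemma fund_shifted_derivative:
  "((\<lambda>y. complex_of_real (fundS E (x - y))) has_vector_derivative - of_real (fundC E (x - y))) (at y within S)"
  "((\<lambda>y. complex_of_real (fundC E (x - y))) has_vector_derivative of_real E * of_real (fundS E (x - y))) (at y within S)"
proof -
  have "((\<lambda>y. fundS E (x - y)) has_real_derivative fundC E (x - y) * (0 - 1)) (at y within S)"
    by (rule DERIV_chain2[OF fundS_derivative]) (auto intro!: derivative_eq_intros)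
  from has_vector_derivative_of_real[OF this]
  show "((\<lambda>y. complex_of_real (fundS E (x - y))) has_vector_derivative - of_real (fundC E (x - y))) (at y within S)" by simp
  have "((\<lambda>y. fundC E (x - y)) has_real_derivative - E * fundS E (x - y) * (0 - 1)) (at y within S)"
    by (rule DERIV_chain2[OF fundC_derivative]) (auto intro!: derivative_eq_intros)
  from has_vector_derivative_of_real[OF this]
  show "((\<lambda>y. complex_of_real (fundC E (x - y))) has_vector_derivative of_real E * of_real (fundS E (x - y))) (at y within S)" by simp
qed

text \<open>Green's identity on \<open>{0..x}\<close> against the solutions S_E(x - y) and C_E(x -
  y) in y: the integrand vanishes almost everywhere, and the boundary data at y = x pick out \<psi>
  x and \<psi>' x respectively.\<close>

lemma edge_eigenfunction:
  assumes H: "edge_H2 l \<psi> \<psi>' \<psi>''" and ae: "AE x in lborel. x \<in> {0..l} \<longrightarrow> - \<psi>'' x - of_real E * \<psi> x = 0"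
    and x: "x \<in> {0..l}"
  shows "\<psi> x = \<psi> 0 * of_real (fundC E x) + \<psi>' 0 * of_real (fundS E x)"
    and "\<psi>' x = - of_real E * \<psi> 0 * of_real (fundS E x) + \<psi>' 0 * of_real (fundC E x)"
proof -
  have H: "edge_H2 x \<psi> \<psi>' \<psi>''" using edge_H2_restrict[OF H] x by simp
  have zero: "(\<psi>' x * u x - \<psi> x * u' x) - (\<psi>' 0 * u 0 - \<psi> 0 * u' 0) = 0"
    if u: "\<And>y. (u has_vector_derivative u' y) (at y within {0..x})"
      "\<And>y. (u' has_vector_derivative - of_real E * u y) (at y within {0..x})" for u u'
  proof -
    have cu: "continuous_on {0..x} u" by (rule vector_derivative_continuous_on[OF u(1)])
    have "((\<lambda>y. \<psi>'' y * u y - \<psi> y * (- of_real E * u y)) has_integral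
        ((\<psi>' x * u x - \<psi> x * u' x) - (\<psi>' 0 * u 0 - \<psi> 0 * u' 0))) {0..x}"
      by (rule edge_H2_green[OF H _ u]) (use x in \<open>auto intro!: continuous_intros cu\<close>)
    moreover have "AE y in lborel. y \<in> {0..x} \<longrightarrow> \<psi>'' y * u y - \<psi> y * (- of_real E * u y) = 0"
      using ae
    proof eventually_elim
      case (elim y)
      show ?case
      proof
        assume "y \<in> {0..x}"
        then have "- \<psi>'' y - of_real E * \<psi> y = 0" using elim x by auto
        moreover have "\<psi>'' y + of_real E * \<psi> y = - (- \<psi>'' y - of_real E * \<psi> y)" by simp
        ultimately have "\<psi>'' y + of_real E * \<psi> y = 0" by simp
        then have "(\<psi>'' y + of_real E * \<psi> y) * u y = 0" by simp
        then show "\<psi>'' y * u y - \<psi> y * (- of_real E * u y) = 0" by (simp add: algebra_simps)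
      qed
    qed
    ultimately have "((\<lambda>y. 0) has_integral ((\<psi>' x * u x - \<psi> x * u' x) - (\<psi>' 0 * u 0 - \<psi> 0 * u' 0))) {0..x}"
      by (rule has_integral_AE_cong[rotated])
    then show ?thesis using has_integral_unique has_integral_0 by blast
  qed
  have "(\<psi>' x * of_real (fundS E (x - x)) - \<psi> x * - of_real (fundC E (x - x)))
      - (\<psi>' 0 * of_real (fundS E (x - 0)) - \<psi> 0 * - of_real (fundC E (x - 0))) = 0"
  proof (rule zero)
    fix y
    show "((\<lambda>y. complex_of_real (fundS E (x - y))) has_vector_derivative - of_real (fundC E (x - y))) (at y within {0..x})"
      by (rule fund_shifted_derivative)
    show "((\<lambda>y. - complex_of_real (fundC E (x - y))) has_vector_derivative - of_real E * of_real (fundS E (x - y))) (at y within {0..x})"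
      using has_vector_derivative_minus[OF fund_shifted_derivative(2)] by simp
  qed
  then show "\<psi> x = \<psi> 0 * of_real (fundC E x) + \<psi>' 0 * of_real (fundS E x)" by (simp add: algebra_simps)
  have "(\<psi>' x * of_real (fundC E (x - x)) - \<psi> x * (of_real E * of_real (fundS E (x - x))))
      - (\<psi>' 0 * of_real (fundC E (x - 0)) - \<psi> 0 * (of_real E * of_real (fundS E (x - 0)))) = 0"
  proof (rule zero)
    fix y
    show "((\<lambda>y. complex_of_real (fundC E (x - y))) has_vector_derivative of_real E * of_real (fundS E (x - y))) (at y within {0..x})"
      by (rule fund_shifted_derivative)
    show "((\<lambda>y. of_real E * complex_of_real (fundS E (x - y))) has_vector_derivative - of_real E * of_real (fundC E (x - y))) (at y within {0..x})"
      using has_vector_derivative_mult_right[OF fund_shifted_derivative(1), of "of_real E"] by simp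
  qed
  then show "\<psi>' x = - of_real E * \<psi> 0 * of_real (fundS E x) + \<psi>' 0 * of_real (fundC E x)" by (simp add: algebra_simps)
qed

text \<open>Pairing with \<open>\<eta> x = x (1 - x / l)\<^sup>2\<close>, which has \<open>\<eta>' 0 = 1\<close> and vanishing other boundary data.\<close>
lemma edge_eigenfunction_trace:
  assumes l: "0 < l"
  shows "\<exists>K. \<forall>\<psi> \<psi>' \<psi>''. edge_H2 l \<psi> \<psi>' \<psi>'' \<longrightarrow> edge_L2 l \<psi> \<longrightarrow>
    (AE x in lborel. x \<in> {0..l} \<longrightarrow> - \<psi>'' x - of_real E * \<psi> x = 0) \<longrightarrow> cmod (\<psi> 0) \<le> K * sqrt (l * edge_nsq l \<psi>)"
proof -
  define u u' u'' where "u x = x * (1 - x / l)\<^sup>2" and "u' x = (1 - x / l)\<^sup>2 - 2 * x / l * (1 - x / l)"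
    and "u'' x = - 4 / l * (1 - x / l) + 2 * x / l\<^sup>2" for x :: real
  \<comment> \<open>The factor of \<psi> in Green's integrand after \<psi>'' has been replaced by -E
    \<psi>.\<close>
  define k where "k x = - (of_real E * complex_of_real (u x) + of_real (u'' x))" for x
  have ck: "continuous_on {0..l} k"
    unfolding k_def u_def u''_def by (intro continuous_intros) (use l in auto)
  obtain K where K: "\<And>x. x \<in> {0..l} \<Longrightarrow> cmod (k x) \<le> K"
    using uniform_bound_finite[of "\<lambda>_::unit. l" "\<lambda>_. k", OF ck] by metis
  have d1: "((\<lambda>x. complex_of_real (u x)) has_vector_derivative of_real (u' x)) (at x within {0..l})" for x
  proof (rule has_vector_derivative_of_real)
    show "(u has_real_derivative u' x) (at x within {0..l})"
      unfolding u_def u'_def using l by (auto intro!: derivative_eq_intros simp: field_simps power2_eq_square)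
  qed
  have d2: "((\<lambda>x. complex_of_real (u' x)) has_vector_derivative of_real (u'' x)) (at x within {0..l})" for x
  proof (rule has_vector_derivative_of_real)
    show "(u' has_real_derivative u'' x) (at x within {0..l})"
      unfolding u'_def u''_def using l by (auto intro!: derivative_eq_intros simp: field_simps power2_eq_square)
  qed
  have "cmod (\<psi> 0) \<le> K * sqrt (l * edge_nsq l \<psi>)"
    if H: "edge_H2 l \<psi> \<psi>' \<psi>''" and L: "edge_L2 l \<psi>"
      and ae: "AE x in lborel. x \<in> {0..l} \<longrightarrow> - \<psi>'' x - of_real E * \<psi> x = 0" for \<psi> \<psi>' \<psi>''
  proof (rule edge_L2_integral_bound[OF L l ck K])
    have 1: "((\<lambda>x. \<psi>'' x * of_real (u x) - \<psi> x * of_real (u'' x)) has_integral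
        ((\<psi>' l * of_real (u l) - \<psi> l * of_real (u' l)) - (\<psi>' 0 * of_real (u 0) - \<psi> 0 * of_real (u' 0)))) {0..l}"
      by (rule edge_H2_green[OF H _ d1 d2]) (use l in \<open>auto intro!: continuous_intros simp: u''_def\<close>)
    have 2: "(\<psi>' l * of_real (u l) - \<psi> l * of_real (u' l)) - (\<psi>' 0 * of_real (u 0) - \<psi> 0 * of_real (u' 0)) = \<psi> 0"
      using l by (simp add: u_def u'_def)
    have 3: "AE x in lborel. x \<in> {0..l} \<longrightarrow> \<psi>'' x * of_real (u x) - \<psi> x * of_real (u'' x) = k x * \<psi> x"
      using ae
    proof eventually_elim
      case (elim x)
      show ?case
      proof
        assume "x \<in> {0..l}"
        then have "- \<psi>'' x - of_real E * \<psi> x = 0" using elim by auto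
        moreover have "\<psi>'' x = - (- \<psi>'' x - of_real E * \<psi> x) - of_real E * \<psi> x" by simp
        ultimately have "\<psi>'' x = - of_real E * \<psi> x" by simp
        then show "\<psi>'' x * of_real (u x) - \<psi> x * of_real (u'' x) = k x * \<psi> x" by (simp add: k_def algebra_simps)
      qed
    qed
    show "((\<lambda>x. k x * \<psi> x) has_integral \<psi> 0) {0..l}"
      by (rule has_integral_AE_cong[OF 3 1[unfolded 2]])
  qed
  then show ?thesis by blast
qed

text \<open>Variation of parameters: the solution of \<open>- f'' - E f = g\<close> with vanishing data at 0.\<close>
definition partsol :: "real \<Rightarrow> (real \<Rightarrow> complex) \<Rightarrow> real \<Rightarrow> complex" where
  "partsol E g x = of_real (fundC E x) * integral {0..x} (\<lambda>t. of_real (fundS E t) * g t)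
     - of_real (fundS E x) * integral {0..x} (\<lambda>t. of_real (fundC E t) * g t)"

definition partsol' :: "real \<Rightarrow> (real \<Rightarrow> complex) \<Rightarrow> real \<Rightarrow> complex" where
  "partsol' E g x = - of_real E * of_real (fundS E x) * integral {0..x} (\<lambda>t. of_real (fundS E t) * g t)
     - of_real (fundC E x) * integral {0..x} (\<lambda>t. of_real (fundC E t) * g t)"

lemma partsol_0 [simp]: "partsol E g 0 = 0" "partsol' E g 0 = 0"
  by (simp_all add: partsol_def partsol'_def)

text \<open>The two indefinite integrals are differentiable only almost everywhere, so the product
  rule is replaced by integration by parts for the four products with C and S. In the first claim
  the terms in C S g cancel; in the second the Wronskian identity collects the rest into -g.\<close>

lemma partsol_has_integral:
  assumes g: "edge_L2 l g" and x: "x \<in> {0..l}"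
  shows "(partsol' E g has_integral partsol E g x) {0..x}"
    and "((\<lambda>t. - of_real E * partsol E g t - g t) has_integral partsol' E g x) {0..x}"
proof -
  let ?C = "\<lambda>x. complex_of_real (fundC E x)" and ?S = "\<lambda>x. complex_of_real (fundS E x)"
  define P where "P x = integral {0..x} (\<lambda>t. ?C t * g t)" for x
  define Q where "Q x = integral {0..x} (\<lambda>t. ?S t * g t)" for x
  have gx: "g absolutely_integrable_on {0..x}"
    by (rule set_integrable_subset[OF edge_L2_absolutely_integrable[OF g]]) (use x in auto)
  have aC: "(\<lambda>t. ?C t * g t) absolutely_integrable_on {0..x}"
    by (intro continuous_mult_absolutely_integrable gx continuous_intros continuous_fund)
  have aS: "(\<lambda>t. ?S t * g t) absolutely_integrable_on {0..x}"
    by (intro continuous_mult_absolutely_integrable gx continuous_intros continuous_fund)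
  have hP: "((\<lambda>t. ?C t * g t) has_integral (P y - P 0)) {0..y}" if "y \<in> {0..x}" for y
    using integrable_integral[OF integrable_on_subinterval[OF set_lebesgue_integral_eq_integral(1)[OF aC], of 0 y]] that
    by (simp add: P_def)
  have hQ: "((\<lambda>t. ?S t * g t) has_integral (Q y - Q 0)) {0..y}" if "y \<in> {0..x}" for y
    using integrable_integral[OF integrable_on_subinterval[OF set_lebesgue_integral_eq_integral(1)[OF aS], of 0 y]] that
    by (simp add: Q_def)
  have x0: "0 \<le> x" and PQ0: "P 0 = 0" "Q 0 = 0" using x by (auto simp: P_def Q_def)
  have cC: "continuous_on {0..x} ?C" and cS: "continuous_on {0..x} (\<lambda>x. - of_real E * ?S x)"
    by (intro continuous_intros continuous_fund)+
  have CP: "((\<lambda>t. (- of_real E * ?S t) * P t + ?C t * (?C t * g t)) has_integral (?C x * P x)) {0..x}"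
    using integration_by_parts_indefinite_integral[OF x0 aC hP fundC_vector_derivative cS] PQ0 by simp
  have CQ: "((\<lambda>t. (- of_real E * ?S t) * Q t + ?C t * (?S t * g t)) has_integral (?C x * Q x)) {0..x}"
    using integration_by_parts_indefinite_integral[OF x0 aS hQ fundC_vector_derivative cS] PQ0 by simp
  have SP: "((\<lambda>t. ?C t * P t + ?S t * (?C t * g t)) has_integral (?S x * P x)) {0..x}"
    using integration_by_parts_indefinite_integral[OF x0 aC hP fundS_vector_derivative cC] PQ0 by simp
  have SQ: "((\<lambda>t. ?C t * Q t + ?S t * (?S t * g t)) has_integral (?S x * Q x)) {0..x}"
    using integration_by_parts_indefinite_integral[OF x0 aS hQ fundS_vector_derivative cC] PQ0 by simp
  have ps: "partsol E g t = ?C t * Q t - ?S t * P t" "partsol' E g t = - of_real E * ?S t * Q t - ?C t * P t" for t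
    by (simp_all add: partsol_def partsol'_def P_def Q_def)
  show "(partsol' E g has_integral partsol E g x) {0..x}"
    unfolding ps(1) by (rule has_integral_eq[OF _ has_integral_diff[OF CQ SP]]) (simp add: ps algebra_simps)
  have "?C t * ?C t + of_real E * (?S t * ?S t) = 1" for t
    using arg_cong[OF fund_wronskian[of E t], of complex_of_real] by (simp add: power2_eq_square)
  then have W: "g t * (?C t * ?C t) + g t * (of_real E * (?S t * ?S t)) = g t" for t
    by (metis distrib_left mult_1_right)
  have W': "g t * (?C t * ?C t) = g t - g t * (of_real E * (?S t * ?S t))" for t
    using W[of t] by (simp add: eq_diff_eq)
  have "((\<lambda>t. - of_real E * (?C t * Q t + ?S t * (?S t * g t)) - ((- of_real E * ?S t) * P t + ?C t * (?C t * g t)))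
      has_integral (- of_real E * (?S x * Q x) - ?C x * P x)) {0..x}"
    by (intro has_integral_diff has_integral_mult_right SQ CP)
  then show "((\<lambda>t. - of_real E * partsol E g t - g t) has_integral partsol' E g x) {0..x}"
    unfolding ps
  proof (rule has_integral_eq[rotated, THEN has_integral_eq_rhs])
    fix t
    show "- of_real E * (?C t * Q t + ?S t * (?S t * g t)) - ((- of_real E * ?S t) * P t + ?C t * (?C t * g t))
      = - of_real E * (?C t * Q t - ?S t * P t) - g t"
      using W'[of t] by (simp add: algebra_simps)
  qed (simp add: mult.assoc)
qed

lemma partsol_continuous:
  assumes "edge_L2 l g" shows "continuous_on {0..l} (partsol E g)" "continuous_on {0..l} (partsol' E g)"
proof -
  show "continuous_on {0..l} (partsol E g)"
    by (rule indefinite_integral_continuous_on) (use partsol_has_integral(1)[OF assms] in simp)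
  show "continuous_on {0..l} (partsol' E g)"
    by (rule indefinite_integral_continuous_on[where p = "\<lambda>t. - of_real E * partsol E g t - g t"])
       (use partsol_has_integral(2)[OF assms] in simp)
qed

text \<open>The constant is independent of \<open>g\<close>: the end values of the particular
  solutions on all edges thus inherit square-summability from the right-hand side.\<close>

lemma partsol_bound:
  assumes l: "0 < l"
  shows "\<exists>K\<ge>0. \<forall>g x. edge_L2 l g \<longrightarrow> x \<in> {0..l} \<longrightarrow>
    cmod (partsol E g x) \<le> K * sqrt (edge_nsq l g) \<and> cmod (partsol' E g x) \<le> K * sqrt (edge_nsq l g)"
proof -
  obtain M where M: "0 \<le> M" "\<And>x. x \<in> {0..l} \<Longrightarrow> \<bar>fundC E x\<bar> \<le> M" "\<And>x. x \<in> {0..l} \<Longrightarrow> \<bar>fundS E x\<bar> \<le> M"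
  proof -
    have "bounded (fundC E ` {0..l})" "bounded (fundS E ` {0..l})"
      by (intro compact_imp_bounded compact_continuous_image continuous_fund compact_Icc)+
    then obtain b c where "b > 0" "\<forall>x\<in>{0..l}. \<bar>fundC E x\<bar> \<le> b" "c > 0" "\<forall>x\<in>{0..l}. \<bar>fundS E x\<bar> \<le> c"
      unfolding bounded_pos by auto
    then show ?thesis using that[of "max b c"] by (auto simp: le_max_iff_disj)
  qed
  define R where "R = M * sqrt l"
  have R: "0 \<le> R" using M l by (simp add: R_def)
  have I: "cmod (integral {0..x} (\<lambda>t. of_real (h t) * g t)) \<le> R * sqrt (edge_nsq l g)"
    if g: "edge_L2 l g" and x: "x \<in> {0..l}" and h: "continuous_on {0..l} h" "\<And>x. x \<in> {0..l} \<Longrightarrow> \<bar>h x\<bar> \<le> M"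
    for h :: "real \<Rightarrow> real" and g x
  proof -
    have i: "(\<lambda>t. of_real (h t) * g t) absolutely_integrable_on {0..l}"
      by (intro continuous_mult_absolutely_integrable edge_L2_absolutely_integrable[OF g] continuous_intros h)
    have ng: "(\<lambda>t. cmod (g t)) integrable_on {0..l}"
      using edge_L2_absolutely_integrable[OF g] unfolding absolutely_integrable_on_def by blast
    have ix: "(\<lambda>t. of_real (h t) * g t) integrable_on {0..x}"
      by (rule integrable_on_subinterval[OF set_lebesgue_integral_eq_integral(1)[OF i]]) (use x in auto)
    have ngx: "(\<lambda>t. M * cmod (g t)) integrable_on {0..x}"
      by (rule integrable_on_mult_right, rule integrable_on_subinterval[OF ng]) (use x in auto)
    have "cmod (integral {0..x} (\<lambda>t. of_real (h t) * g t)) \<le> integral {0..x} (\<lambda>t. M * cmod (g t))"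
      by (rule integral_norm_bound_integral[OF ix ngx]) (use x h(2) in \<open>auto simp: norm_mult intro!: mult_right_mono\<close>)
    also have "\<dots> \<le> integral {0..l} (\<lambda>t. M * cmod (g t))"
      by (rule integral_subset_le[OF _ ngx integrable_on_mult_right[OF ng]]) (use x M in auto)
    also have "\<dots> = M * integral {0..l} (\<lambda>t. cmod (g t))" by simp
    also have "\<dots> \<le> M * sqrt (l * edge_nsq l g)"
      using edge_L1_le_nsq[OF g l] M by (intro mult_left_mono real_le_rsqrt) auto
    finally show ?thesis by (simp add: R_def real_sqrt_mult mult.assoc)
  qed
  \<comment> \<open>Covers both 2 M R, for the value, and (|E| + 1) M R, for the derivative.\<close>
  define K where "K = (M * R + M * R) * (1 + \<bar>E\<bar>)"
  have mr: "0 \<le> M * R" using M R by simp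
  have K: "0 \<le> K" "M * R + M * R \<le> K" "\<bar>E\<bar> * (M * R) + M * R \<le> K"
    using mr mult_nonneg_nonneg[OF abs_ge_zero[of E] mr] unfolding K_def by (auto simp: algebra_simps)
  show ?thesis
  proof (intro exI[of _ K] conjI allI impI K(1))
    fix g x assume g: "edge_L2 l g" and x: "x \<in> {0..l}"
    let ?n = "sqrt (edge_nsq l g)"
    have n: "0 \<le> ?n" by (simp add: edge_nsq_nonneg)
    let ?P = "integral {0..x} (\<lambda>t. of_real (fundC E t) * g t)" and ?Q = "integral {0..x} (\<lambda>t. of_real (fundS E t) * g t)"
    have P: "cmod ?P \<le> R * ?n" and Q: "cmod ?Q \<le> R * ?n"
      by (rule I[OF g x continuous_fund(1) M(2)] I[OF g x continuous_fund(2) M(3)]; simp)+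
    have b: "cmod (of_real (fundC E x) * ?P) \<le> M * (R * ?n)" "cmod (of_real (fundC E x) * ?Q) \<le> M * (R * ?n)"
      "cmod (of_real (fundS E x) * ?P) \<le> M * (R * ?n)" "cmod (of_real (fundS E x) * ?Q) \<le> M * (R * ?n)"
      unfolding norm_mult norm_of_real using M x P Q by (auto intro!: mult_mono)
    have "cmod (partsol E g x) \<le> M * (R * ?n) + M * (R * ?n)"
      unfolding partsol_def using norm_triangle_ineq4 b(2,3) by (meson add_mono order_trans)
    also have "\<dots> = (M * R + M * R) * ?n" by (simp add: algebra_simps)
    also have "\<dots> \<le> K * ?n" using K n by (intro mult_right_mono) auto
    finally show "cmod (partsol E g x) \<le> K * ?n" .
    have e: "cmod (- of_real E * of_real (fundS E x) * ?Q) \<le> \<bar>E\<bar> * (M * (R * ?n))"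
      using mult_left_mono[OF b(4), of "\<bar>E\<bar>"] by (simp add: norm_mult mult.assoc)
    have "cmod (partsol' E g x) \<le> \<bar>E\<bar> * (M * (R * ?n)) + M * (R * ?n)"
      unfolding partsol'_def using norm_triangle_ineq4 e b(1) by (meson add_mono order_trans)
    also have "\<dots> = (\<bar>E\<bar> * (M * R) + M * R) * ?n" by (simp add: algebra_simps)
    also have "\<dots> \<le> K * ?n" using K n by (intro mult_right_mono) auto
    finally show "cmod (partsol' E g x) \<le> K * ?n" .
  qed
qed

section \<open>The resolvent at nonresonant energies\<close>

text \<open>With the bound hidden, membership follows by closure rules alone.\<close>

definition is_l2 :: "('v \<Rightarrow> 'b::real_normed_vector) \<Rightarrow> bool" where
  "is_l2 h \<longleftrightarrow> (\<exists>M. l2_bounded M h)"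

lemma is_l2_dominated:
  assumes "is_l2 h" "\<And>v. norm (g v) \<le> K * norm (h v)" shows "is_l2 g"
proof -
  obtain M where "l2_bounded M h" using assms(1) by (auto simp: is_l2_def)
  moreover have "norm (g v) \<le> \<bar>K\<bar> * norm (h v)" for v
    using assms(2)[of v] mult_right_mono[OF abs_ge_self[of K], of "norm (h v)"] by simp
  ultimately show ?thesis using l2_bounded_mono[of M h "\<bar>K\<bar>" g] unfolding is_l2_def by auto
qed

lemma is_l2_add: "is_l2 h \<Longrightarrow> is_l2 g \<Longrightarrow> is_l2 (\<lambda>v. h v + g v)"
  unfolding is_l2_def by (elim exE) (rule exI, rule l2_bounded_add)

lemma is_l2_mult:
  fixes h :: "'v \<Rightarrow> 'b::real_normed_algebra"
  shows "is_l2 h \<Longrightarrow> is_l2 (\<lambda>v. c * h v)"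
  by (erule is_l2_dominated[where K = "norm c"]) (rule norm_mult_ineq)

lemma is_l2_norm: "is_l2 h \<Longrightarrow> is_l2 (\<lambda>v. norm (h v))"
  by (erule is_l2_dominated[where K = 1]) simp

lemma is_l2_sum:
  assumes "\<And>i. is_l2 (h i)" shows "is_l2 (\<lambda>v. \<Sum>i\<in>I. h i v)"
proof -
  obtain M where "\<And>i. l2_bounded (M i) (h i)" using assms unfolding is_l2_def by metis
  then show ?thesis unfolding is_l2_def by (intro exI[of _ "sum M I"] l2_bounded_sum)
qed

lemma is_l2_succ: "is_l2 h \<Longrightarrow> is_l2 (\<lambda>v :: 'd \<Rightarrow> int. h (v(j := v j + 1)))"
  unfolding is_l2_def by (elim exE) (rule exI, erule l2_bounded_comp_inj, rule inj_vertex_shift)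

lemma is_l2_pred: "is_l2 h \<Longrightarrow> is_l2 (\<lambda>v :: 'd \<Rightarrow> int. h (v(j := v j - 1)))"
  unfolding is_l2_def by (elim exE) (rule exI, erule l2_bounded_comp_inj, rule inj_vertex_pred)

lemma graph_L2_edge_norms:
  assumes "graph_L2 a f" shows "is_l2 (\<lambda>v. sqrt (edge_nsq (a j) (f (v, j))))"
proof -
  have "(\<lambda>e. edge_nsq (a (snd e)) (f e)) summable_on ((\<lambda>v. (v, j)) ` UNIV)"
    using assms unfolding graph_L2_iff by (blast intro: summable_on_subset_banach)
  then have "(\<lambda>v. edge_nsq (a j) (f (v, j))) summable_on UNIV"
    by (subst (asm) summable_on_reindex) (auto simp: inj_on_def o_def)
  then have "(\<lambda>v. (norm (sqrt (edge_nsq (a j) (f (v, j)))))\<^sup>2) summable_on UNIV"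
    by (simp add: edge_nsq_nonneg)
  from summable_l2_bounded[OF this] show ?thesis unfolding is_l2_def ..
qed

text \<open>The dominating function is constant along each edge, so square-summability over the
  vertices costs only the factor \<open>a j\<close>.\<close>

lemma graph_L2_dominated:
  fixes a :: "'d::finite \<Rightarrow> real"
  assumes a: "\<And>j. 0 < a j" and c: "\<And>v j. continuous_on {0..a j} (\<psi> (v, j))"
    and h: "\<And>j. is_l2 (h j)" and le: "\<And>v j x. x \<in> {0..a j} \<Longrightarrow> cmod (\<psi> (v, j) x) \<le> h j v"
  shows "graph_L2 a \<psi>"
  unfolding graph_L2_iff
proof (intro conjI allI summable_on_edges)
  show "edge_L2 (a (snd e)) (\<psi> e)" for e using edge_L2_continuous[OF c[of "snd e" "fst e"]] by simp
  fix j
  obtain M where "l2_bounded M (h j)" using h unfolding is_l2_def by blast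
  then have "(\<lambda>v. a j * (norm (h j v))\<^sup>2) summable_on UNIV"
    by (intro summable_on_cmult_right l2_bounded_summable)
  then show "(\<lambda>v. edge_nsq (a (snd (v, j))) (\<psi> (v, j))) summable_on UNIV"
  proof (rule summable_on_comparison_test)
    fix v
    show "edge_nsq (a (snd (v, j))) (\<psi> (v, j)) \<le> a j * (norm (h j v))\<^sup>2"
      using edge_nsq_le_bound[OF less_imp_le[OF a] c le, of j v] by simp
  qed (simp add: edge_nsq_nonneg)
qed

lemma graph_L2_add_cmult:
  assumes f: "graph_L2 a f" and g: "graph_L2 a g"
  shows "graph_L2 a (\<lambda>e x. c * f e x + d * g e x)"
  unfolding graph_L2_iff
proof (intro conjI allI)
  have fe: "edge_L2 (a (snd e)) (f e)" and ge: "edge_L2 (a (snd e)) (g e)" for e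
    using f g unfolding graph_L2_iff by blast+
  note cf = edge_L2_cmult[OF fe, of _ c] and dg = edge_L2_cmult[OF ge, of _ d]
  show "edge_L2 (a (snd e)) (\<lambda>x. c * f e x + d * g e x)" for e
    by (rule edge_L2_add[OF cf(1) dg(1)])
  have "(\<lambda>e. 2 * ((cmod c)\<^sup>2 * edge_nsq (a (snd e)) (f e)) + 2 * ((cmod d)\<^sup>2 * edge_nsq (a (snd e)) (g e))) summable_on UNIV"
    using f g unfolding graph_L2_iff by (intro summable_on_add summable_on_cmult_right) auto
  then show "(\<lambda>e. edge_nsq (a (snd e)) (\<lambda>x. c * f e x + d * g e x)) summable_on UNIV"
  proof (rule summable_on_comparison_test)
    fix e
    show "edge_nsq (a (snd e)) (\<lambda>x. c * f e x + d * g e x)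
       \<le> 2 * ((cmod c)\<^sup>2 * edge_nsq (a (snd e)) (f e)) + 2 * ((cmod d)\<^sup>2 * edge_nsq (a (snd e)) (g e))"
      using edge_L2_add(2)[OF cf(1) dg(1), of e] unfolding cf(2) dg(2) .
  qed (simp add: edge_nsq_nonneg)
qed

text \<open>\<open>gap\<close> is strict diagonal dominance of the vertex operator, and the exact
  negation of the condition under which a Bloch solution was constructed.\<close>

locale nonresonant =
  fixes a :: "'d::finite \<Rightarrow> real" and \<alpha> E :: real
  assumes a: "\<And>j. 0 < a j" and S0: "\<And>j. fundS E (a j) \<noteq> 0"
    and gap: "(\<Sum>j\<in>UNIV. 2 / \<bar>fundS E (a j)\<bar>) < \<bar>\<alpha> + (\<Sum>j\<in>UNIV. 2 * fundC E (a j) / fundS E (a j))\<bar>"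
begin

definition "cc j = 1 / fundS E (a j)"
definition "bb = \<alpha> + (\<Sum>j\<in>UNIV. 2 * fundC E (a j) / fundS E (a j))"

abbreviation "C j \<equiv> complex_of_real (fundC E (a j))"
abbreviation "S j \<equiv> complex_of_real (fundS E (a j))"

lemma S_neq_0: "S j \<noteq> 0" using S0 by simp

lemma W: "C j * C j + of_real E * (S j * S j) = 1"
  using arg_cong[OF fund_wronskian[of E "a j"], of complex_of_real] by (simp add: power2_eq_square)

lemma small: "2 * (\<Sum>j\<in>UNIV. \<bar>cc j\<bar>) < \<bar>bb\<bar>"
  using gap by (simp add: cc_def bb_def sum_distrib_left abs_divide)

text \<open>The shape that the delta condition takes once the derivatives on the edges are expressed
  through the vertex values.\<close>

lemma hop_eq:
  "hop cc \<phi> v - of_real bb * \<phi> v =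
    (\<Sum>j\<in>UNIV. (\<phi> (v(j := v j + 1)) + \<phi> (v(j := v j - 1)) - 2 * C j * \<phi> v) / S j) - of_real \<alpha> * \<phi> v"
proof -
  have "of_real bb * \<phi> v = of_real \<alpha> * \<phi> v + (\<Sum>j\<in>UNIV. 2 * C j * \<phi> v / S j)"
    by (simp add: bb_def distrib_right sum_distrib_right)
  moreover have "hop cc \<phi> v = (\<Sum>j\<in>UNIV. (\<phi> (v(j := v j + 1)) + \<phi> (v(j := v j - 1))) / S j)"
    by (simp add: hop_def cc_def)
  ultimately show ?thesis by (simp add: sum_subtractf diff_divide_distrib)
qed

text \<open>The edge solutions reduce the delta condition to the homogeneous vertex equation. Its
  solution is bounded by the trace estimate, hence zero, and a solution with zero vertex values
  vanishes on every nonresonant edge.\<close>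

lemma kernel_trivial:
  assumes dom: "delta_domain a \<alpha> \<psi> \<psi>' \<psi>''"
    and ae: "\<And>e. AE x in lborel. x \<in> {0..a (snd e)} \<longrightarrow> - \<psi>'' e x - of_real E * \<psi> e x = 0"
    and x: "x \<in> {0..a (snd e)}"
  shows "\<psi> e x = 0"
proof -
  have H: "edge_H2 (a j) (\<psi> (v, j)) (\<psi>' (v, j)) (\<psi>'' (v, j))" for v j
    using dom unfolding delta_domain_def by (metis snd_conv)
  have G: "graph_L2 a \<psi>" using dom unfolding delta_domain_def by blast
  have aej: "AE x in lborel. x \<in> {0..a j} \<longrightarrow> - \<psi>'' (v, j) x - of_real E * \<psi> (v, j) x = 0" for v j
    using ae[of "(v, j)"] by simp
  define \<phi> where "\<phi> v = \<psi> (v, undefined) 0" for v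
  have cont: "\<psi> (v, j) 0 = \<phi> v" "\<psi> (v(j := v j - 1), j) (a j) = \<phi> v" for v j
    using dom unfolding delta_domain_def \<phi>_def by blast+
  have delta: "(\<Sum>j\<in>UNIV. \<psi>' (v, j) 0 - \<psi>' (v(j := v j - 1), j) (a j)) = of_real \<alpha> * \<phi> v" for v
    using dom unfolding delta_domain_def \<phi>_def by blast
  have end': "\<psi> (v, j) (a j) = \<phi> (v(j := v j + 1))" for v j
    using cont(2)[of "v(j := v j + 1)" j] by simp
  note sol = edge_eigenfunction[OF H aej]
  have in_a: "a j \<in> {0..a j}" for j using a[of j] by simp
  \<comment> \<open>The slope at the start follows from the value at the far end because
    \<open>S j\<close> does not vanish.\<close>
  have d0: "\<psi>' (v, j) 0 = (\<phi> (v(j := v j + 1)) - C j * \<phi> v) / S j" for v j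
    using sol(1)[OF in_a, of v j] S_neq_0[of j] by (simp add: end' cont field_simps)
  have da: "\<psi>' (v, j) (a j) = (C j * \<phi> (v(j := v j + 1)) - \<phi> v) / S j" for v j
  proof -
    have "\<psi>' (v, j) (a j) = - of_real E * \<phi> v * S j + (\<phi> (v(j := v j + 1)) - C j * \<phi> v) / S j * C j"
      using sol(2)[OF in_a, of v j] by (simp add: cont d0)
    also have "\<dots> = (C j * \<phi> (v(j := v j + 1)) - (C j * C j + of_real E * (S j * S j)) * \<phi> v) / S j"
      using S_neq_0[of j] by (simp add: field_simps)
    finally show ?thesis unfolding W by simp
  qed
  have "hop cc \<phi> v - of_real bb * \<phi> v = 0" for v
  proof -
    have "\<psi>' (v, j) 0 - \<psi>' (v(j := v j - 1), j) (a j) =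
        (\<phi> (v(j := v j + 1)) + \<phi> (v(j := v j - 1)) - 2 * C j * \<phi> v) / S j" for j
      unfolding d0 da by (simp add: diff_divide_distrib add_divide_distrib)
    then show ?thesis unfolding hop_eq using delta[of v] by simp
  qed
  \<comment> \<open>Vertex values are controlled through the edge leaving in one fixed
    direction.\<close>
  moreover obtain K where K: "\<And>\<psi> \<psi>' \<psi>''. edge_H2 (a undefined) \<psi> \<psi>' \<psi>'' \<Longrightarrow> edge_L2 (a undefined) \<psi> \<Longrightarrow>
    (AE x in lborel. x \<in> {0..a undefined} \<longrightarrow> - \<psi>'' x - of_real E * \<psi> x = 0) \<Longrightarrow>
      cmod (\<psi> 0) \<le> K * sqrt (a undefined * edge_nsq (a undefined) \<psi>)"
    using edge_eigenfunction_trace[OF a[of undefined], of E] by blast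
  moreover obtain N where N: "l2_bounded N (\<lambda>v. sqrt (edge_nsq (a undefined) (\<psi> (v, undefined))))"
    using graph_L2_edge_norms[OF G] unfolding is_l2_def by blast
  have "cmod (\<phi> v) \<le> \<bar>K\<bar> * (sqrt (a undefined) * N)" for v
  proof -
    have "edge_L2 (a undefined) (\<psi> (v, undefined))" using G unfolding graph_L2_iff by (metis snd_conv)
    from K[OF H this aej] have "cmod (\<phi> v) \<le> K * (sqrt (a undefined) * sqrt (edge_nsq (a undefined) (\<psi> (v, undefined))))"
      by (simp add: \<phi>_def real_sqrt_mult)
    also have "\<dots> \<le> \<bar>K\<bar> * (sqrt (a undefined) * N)"
    proof (rule mult_mono)
      show "sqrt (a undefined) * sqrt (edge_nsq (a undefined) (\<psi> (v, undefined))) \<le> sqrt (a undefined) * N"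
        using l2_bounded_norm_le[OF N, of v] a[of undefined] by (intro mult_left_mono) auto
    qed (use a[of undefined] edge_nsq_nonneg in auto)
    finally show ?thesis .
  qed
  ultimately have \<phi>0: "\<phi> v = 0" for v using hop_unique[OF small] by blast
  obtain v j where e: "e = (v, j)" by force
  show ?thesis using sol(1)[of x j v] x by (simp add: e cont d0 \<phi>0)
qed

text \<open>On each edge the ansatz is \<phi> v C + B S plus the particular solution. Continuity
  determines \<open>B\<close>, and the delta condition becomes an inhomogeneous vertex equation for
  \<phi>.\<close>

lemma resolvent_exists:
  assumes f: "graph_L2 a f"
  shows "\<exists>\<psi> \<psi>' \<psi>''. delta_domain a \<alpha> \<psi> \<psi>' \<psi>'' \<and>
    (\<forall>e. AE x in lborel. x \<in> {0..a (snd e)} \<longrightarrow> - \<psi>'' e x - of_real E * \<psi> e x = f e x)"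
proof -
  have fe: "edge_L2 (a j) (f (v, j))" for v j using f unfolding graph_L2_iff by (metis snd_conv)
  define s where "s j v = sqrt (edge_nsq (a j) (f (v, j)))" for j v
  have s: "is_l2 (s j)" for j unfolding s_def by (rule graph_L2_edge_norms[OF f])
  define p where "p e = partsol E (f e)" for e :: "'d edge"
  define p' where "p' e = partsol' E (f e)" for e :: "'d edge"
  obtain K where K: "\<And>j. 0 \<le> K j" and
    pK: "\<And>v j x. x \<in> {0..a j} \<Longrightarrow> cmod (p (v, j) x) \<le> K j * s j v"
      "\<And>v j x. x \<in> {0..a j} \<Longrightarrow> cmod (p' (v, j) x) \<le> K j * s j v"
  proof -
    have "\<forall>j. \<exists>K\<ge>0. \<forall>g x. edge_L2 (a j) g \<longrightarrow> x \<in> {0..a j} \<longrightarrow>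
       cmod (partsol E g x) \<le> K * sqrt (edge_nsq (a j) g) \<and> cmod (partsol' E g x) \<le> K * sqrt (edge_nsq (a j) g)"
      using partsol_bound[OF a] by blast
    then obtain K where "\<And>j. 0 \<le> K j \<and> (\<forall>g x. edge_L2 (a j) g \<longrightarrow> x \<in> {0..a j} \<longrightarrow>
       cmod (partsol E g x) \<le> K j * sqrt (edge_nsq (a j) g) \<and> cmod (partsol' E g x) \<le> K j * sqrt (edge_nsq (a j) g))"
      by metis
    then show ?thesis using that[of K] fe unfolding p_def p'_def s_def by blast
  qed
  have in_a: "a j \<in> {0..a j}" for j using a[of j] by simp
  have lp: "is_l2 (\<lambda>v. p (v, j) (a j))" "is_l2 (\<lambda>v. p' (v, j) (a j))" for j
    by (rule is_l2_dominated[OF s[of j], of _ "K j"], use pK[OF in_a] s_def edge_nsq_nonneg in \<open>simp\<close>)+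
  \<comment> \<open>What the particular solutions contribute to the delta condition at
    \<open>v\<close>: outgoing edges through the correction of their initial slope, incoming edges
    through that correction and their own final slope.\<close>
  define g where "g v = (\<Sum>j\<in>UNIV. 1 / S j * p (v, j) (a j) + (- C j / S j * p (v(j := v j - 1), j) (a j)
      + p' (v(j := v j - 1), j) (a j)))" for v
  have "is_l2 g"
    unfolding g_def
    by (intro is_l2_sum is_l2_add is_l2_mult lp is_l2_pred[OF lp(1)] is_l2_pred[OF lp(2)])
  then obtain \<phi> where l\<phi>: "is_l2 \<phi>" and \<phi>: "\<And>v. hop cc \<phi> v - of_real bb * \<phi> v = g v"
    using hop_solve[OF small] unfolding is_l2_def by metis
  \<comment> \<open>Initial slope for which the value at the far end is \<phi> at the next
    vertex.\<close>
  define B where "B = (\<lambda>(v, j). 1 / S j * \<phi> (v(j := v j + 1)) + (- C j / S j * \<phi> v + - 1 / S j * p (v, j) (a j)))"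
  define \<psi> where "\<psi> e x = \<phi> (fst e) * of_real (fundC E x) + B e * of_real (fundS E x) + p e x" for e x
  define \<psi>' where "\<psi>' e x = \<phi> (fst e) * (- of_real E * of_real (fundS E x)) + B e * of_real (fundC E x) + p' e x" for e x
  \<comment> \<open>Prescribed by the equation, which therefore holds at every point; the factor -1
    matches the shape of \<open>graph_L2_add_cmult\<close>.\<close>
  define \<psi>'' where "\<psi>'' e x = - of_real E * \<psi> e x + (- 1) * f e x" for e x
  have c\<psi>: "continuous_on {0..a j} (\<psi> (v, j))" for v j
    unfolding \<psi>_def p_def by (intro continuous_intros continuous_fund partsol_continuous fe)
  have psi0: "\<psi> (v, j) 0 = \<phi> v" "\<psi>' (v, j) 0 = B (v, j)" for v j
    by (simp_all add: \<psi>_def \<psi>'_def p_def p'_def)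
  have psia: "\<psi> (v, j) (a j) = \<phi> (v(j := v j + 1))" for v j
    using S_neq_0[of j] by (simp add: \<psi>_def B_def field_simps)
  have psi'a: "\<psi>' (v, j) (a j) = (C j * \<phi> (v(j := v j + 1)) - \<phi> v - C j * p (v, j) (a j)) / S j + p' (v, j) (a j)" for v j
  proof -
    have "\<psi>' (v, j) (a j) - p' (v, j) (a j) = (C j * \<phi> (v(j := v j + 1)) - (C j * C j + of_real E * (S j * S j)) * \<phi> v - C j * p (v, j) (a j)) / S j"
      using S_neq_0[of j] by (simp add: \<psi>'_def B_def field_simps)
    then show ?thesis unfolding W by (simp add: diff_eq_eq)
  qed
  have "delta_domain a \<alpha> \<psi> \<psi>' \<psi>''"
    unfolding delta_domain_def
  proof (intro conjI allI)
    obtain M where M: "\<And>j x. x \<in> {0..a j} \<Longrightarrow> \<bar>fundC E x\<bar> \<le> M" "\<And>j x. x \<in> {0..a j} \<Longrightarrow> \<bar>fundS E x\<bar> \<le> M" "0 \<le> M"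
    proof -
      obtain b where b: "0 \<le> b" "\<And>j x. x \<in> {0..a j} \<Longrightarrow> cmod (of_real (fundC E x)) \<le> b"
        using uniform_bound_finite[of a "\<lambda>j x. of_real (fundC E x)"] continuous_fund(1) continuous_on_of_real by metis
      obtain c where c: "0 \<le> c" "\<And>j x. x \<in> {0..a j} \<Longrightarrow> cmod (of_real (fundS E x)) \<le> c"
        using uniform_bound_finite[of a "\<lambda>j x. of_real (fundS E x)"] continuous_fund(2) continuous_on_of_real by metis
      show ?thesis using that[of "max b c"] b c by (auto simp: le_max_iff_disj)
    qed
    define h where "h j v = M * cmod (\<phi> v) + (M * cmod (B (v, j)) + K j * s j v)" for j v
    show G\<psi>: "graph_L2 a \<psi>"
    proof (rule graph_L2_dominated[of a \<psi> h, OF a c\<psi>])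
      show "is_l2 (h j)" for j
        unfolding h_def B_def prod.case
        by (intro is_l2_add is_l2_mult is_l2_norm l\<phi> s is_l2_succ[OF l\<phi>] lp)
      fix v j x assume x: "x \<in> {0..a j}"
      have "cmod (\<psi> (v, j) x) \<le> cmod (\<phi> v * of_real (fundC E x)) + (cmod (B (v, j) * of_real (fundS E x)) + cmod (p (v, j) x))"
        unfolding \<psi>_def fst_conv add.assoc by (meson add_left_mono norm_triangle_ineq order_trans)
      also have "\<dots> \<le> h j v"
        unfolding h_def norm_mult norm_of_real
        using M(1)[OF x] M(2)[OF x] pK(1)[OF x] by (intro add_mono) (auto simp: mult.commute[of M] intro!: mult_left_mono)
      finally show "cmod (\<psi> (v, j) x) \<le> h j v" .
    qed
    show G\<psi>'': "graph_L2 a \<psi>''"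
      using graph_L2_add_cmult[OF G\<psi> f, of "- of_real E" "- 1"] unfolding \<psi>''_def .
    show "edge_H2 (a (snd e)) (\<psi> e) (\<psi>' e) (\<psi>'' e)" for e
      unfolding edge_H2_def
    proof (intro conjI ballI)
      show "edge_L2 (a (snd e)) (\<psi>'' e)" using G\<psi>'' unfolding graph_L2_iff by blast
      have fe': "edge_L2 (a (snd e)) (f e)" using f unfolding graph_L2_iff by blast
      fix x assume x: "x \<in> {0..a (snd e)}"
      have hC: "((\<lambda>x. - of_real E * complex_of_real (fundS E x)) has_integral (of_real (fundC E x) - of_real (fundC E 0))) {0..x}"
        by (rule fundamental_theorem_of_calculus[OF _ fundC_vector_derivative]) (use x in auto)
      have hS: "((\<lambda>x. complex_of_real (fundC E x)) has_integral (of_real (fundS E x) - of_real (fundS E 0))) {0..x}"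
        by (rule fundamental_theorem_of_calculus[OF _ fundS_vector_derivative]) (use x in auto)
      show "(\<psi>' e has_integral \<psi> e x - \<psi> e 0) {0..x}"
        unfolding \<psi>'_def p'_def
        by (rule has_integral_eq_rhs[OF has_integral_add[OF has_integral_add[OF has_integral_mult_right[OF hC]
                has_integral_mult_right[OF hS]] partsol_has_integral(1)[OF fe' x]]])
           (simp add: \<psi>_def p_def algebra_simps)
      have "((\<lambda>t. \<phi> (fst e) * (- of_real E * of_real (fundC E t)) + B e * (- of_real E * of_real (fundS E t)) + (- of_real E * p e t - f e t))
         has_integral (\<phi> (fst e) * (- of_real E * (of_real (fundS E x) - of_real (fundS E 0))) + B e * (of_real (fundC E x) - of_real (fundC E 0)) + p' e x)) {0..x}"
        unfolding p_def p'_def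
        by (intro has_integral_add has_integral_mult_right hC hS partsol_has_integral(2)[OF fe' x])
      moreover have "\<phi> (fst e) * (- of_real E * (of_real (fundS E x) - of_real (fundS E 0))) + B e * (of_real (fundC E x) - of_real (fundC E 0)) + p' e x
          = \<psi>' e x - \<psi>' e 0"
        by (simp add: \<psi>'_def p'_def algebra_simps)
      moreover have "(\<lambda>t. \<phi> (fst e) * (- of_real E * of_real (fundC E t)) + B e * (- of_real E * of_real (fundS E t)) + (- of_real E * p e t - f e t)) = \<psi>'' e"
        by (rule ext) (simp add: \<psi>''_def \<psi>_def algebra_simps)
      ultimately show "(\<psi>'' e has_integral \<psi>' e x - \<psi>' e 0) {0..x}" by simp
    qed
    fix v and k :: 'd
    show "\<psi> (v, j) 0 = \<psi> (v, k) 0" for j by (simp add: psi0)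
    show "\<psi> (v(j := v j - 1), j) (a j) = \<psi> (v, k) 0" for j by (simp add: psi0 psia)
    have "\<psi>' (v, j) 0 - \<psi>' (v(j := v j - 1), j) (a j) =
        (\<phi> (v(j := v j + 1)) + \<phi> (v(j := v j - 1)) - 2 * C j * \<phi> v) / S j
        - (1 / S j * p (v, j) (a j) + (- C j / S j * p (v(j := v j - 1), j) (a j) + p' (v(j := v j - 1), j) (a j)))" for j
      unfolding psi0 psi'a using S_neq_0[of j] by (simp add: B_def field_simps)
    then have "(\<Sum>j\<in>UNIV. \<psi>' (v, j) 0 - \<psi>' (v(j := v j - 1), j) (a j)) =
        (\<Sum>j\<in>UNIV. (\<phi> (v(j := v j + 1)) + \<phi> (v(j := v j - 1)) - 2 * C j * \<phi> v) / S j) - g v"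
      unfolding g_def by (simp add: sum_subtractf)
    also have "\<dots> = of_real \<alpha> * \<phi> v" using \<phi>[of v] unfolding hop_eq by (simp add: algebra_simps)
    finally show "(\<Sum>j\<in>UNIV. \<psi>' (v, j) 0 - \<psi>' (v(j := v j - 1), j) (a j)) = complex_of_real \<alpha> * \<psi> (v, k) 0"
      unfolding psi0 .
  qed
  moreover have "- \<psi>'' e x - of_real E * \<psi> e x = f e x" for e x by (simp add: \<psi>''_def)
  ultimately show ?thesis by blast
qed

theorem notin_spectrum: "E \<notin> delta_lattice_spectrum a \<alpha>"
proof -
  have "\<forall>\<psi> \<psi>' \<psi>''. delta_domain a \<alpha> \<psi> \<psi>' \<psi>'' \<and>
      (\<forall>e. AE x in lborel. x \<in> {0..a (snd e)} \<longrightarrow> - \<psi>'' e x - of_real E * \<psi> e x = 0)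
      \<longrightarrow> (\<forall>e. \<forall>x\<in>{0..a (snd e)}. \<psi> e x = 0)"
  proof (intro allI impI ballI, elim conjE)
    fix \<psi> \<psi>' \<psi>'' and e :: "'d edge" and x
    assume dom: "delta_domain a \<alpha> \<psi> \<psi>' \<psi>''"
      and ae: "\<forall>e. AE x in lborel. x \<in> {0..a (snd e)} \<longrightarrow> - \<psi>'' e x - of_real E * \<psi> e x = 0"
      and x: "x \<in> {0..a (snd e)}"
    show "\<psi> e x = 0" by (rule kernel_trivial[OF dom spec[OF ae] x])
  qed
  moreover have "\<forall>f. graph_L2 a f \<longrightarrow> (\<exists>\<psi> \<psi>' \<psi>''. delta_domain a \<alpha> \<psi> \<psi>' \<psi>'' \<and>
      (\<forall>e. AE x in lborel. x \<in> {0..a (snd e)} \<longrightarrow> - \<psi>'' e x - of_real E * \<psi> e x = f e x))"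
    by (intro allI impI resolvent_exists)
  ultimately show ?thesis unfolding delta_lattice_spectrum_def mem_Collect_eq not_not by (rule conjI)
qed

end

section \<open>The band function\<close>

lemma fund_double:
  shows "fundC E (2 * x) = 2 * (fundC E x)\<^sup>2 - 1" and "fundS E (2 * x) = 2 * fundS E x * fundC E x"
proof -
  have *: "sqrt E * (2 * x) = 2 * (sqrt E * x)" "sqrt (- E) * (2 * x) = 2 * (sqrt (- E) * x)" by auto
  show "fundC E (2 * x) = 2 * (fundC E x)\<^sup>2 - 1" "fundS E (2 * x) = 2 * fundS E x * fundC E x"
    unfolding fundC_def fundS_def * by (auto simp: cos_double_cos sin_double cosh_double_cosh sinh_double)
qed

lemma fundS_pos:
  assumes "0 < x" "E \<le> 0 \<or> sqrt E * x < pi" shows "0 < fundS E x"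
proof -
  have "0 < E \<Longrightarrow> 0 < sin (sqrt E * x)" using assms by (intro sin_gt_zero) auto
  then show ?thesis using assms(1) by (auto simp: fundS_def)
qed

text \<open>The half-angle formula (cos x + 1) / sin x = cot (x / 2) for all signs of E. The right
  side remains regular at the first Dirichlet energy of an edge of length 2h, where the left one is
  singular.\<close>

lemma fund_half:
  assumes "0 < fundS E (2 * h)"
  shows "fundC E (2 * h) / fundS E (2 * h) + 1 / \<bar>fundS E (2 * h)\<bar> = fundC E h / fundS E h"
proof -
  have nz: "fundS E h \<noteq> 0" "fundC E h \<noteq> 0" using assms by (auto simp: fund_double)
  have "fundC E (2 * h) / fundS E (2 * h) + 1 / \<bar>fundS E (2 * h)\<bar> = (fundC E (2 * h) + 1) / fundS E (2 * h)"
    using assms by (simp add: add_divide_distrib)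
  also have "\<dots> = fundC E h / fundS E h"
    unfolding fund_double using nz by (simp add: field_simps power2_eq_square)
  finally show ?thesis .
qed

text \<open>The Wronskian of the solutions for \<open>E < E'\<close> has derivative \<open>(E' - E) S\<^sub>E S\<^sub>E\<^sub>'\<close>.\<close>
lemma fund_quotient_strict_antimono:
  assumes h: "0 < h" and E: "E < E'" and E': "E' \<le> 0 \<or> sqrt E' * h < pi"
  shows "fundC E' h / fundS E' h < fundC E h / fundS E h"
proof -
  have pos': "0 < fundS E' x" if "0 < x" "x \<le> h" for x
  proof (rule fundS_pos[OF that(1)])
    have "sqrt E' * x \<le> sqrt E' * h" if "0 < E'" using \<open>x \<le> h\<close> that by (intro mult_left_mono) auto
    then show "E' \<le> 0 \<or> sqrt E' * x < pi" using E' by fastforce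
  qed
  have pos: "0 < fundS E x" if "0 < x" "x \<le> h" for x
  proof (rule fundS_pos[OF that(1)])
    have "sqrt E * x \<le> sqrt E' * h" if "0 < E" using \<open>x \<le> h\<close> \<open>0 < x\<close> that E by (intro mult_mono) auto
    then show "E \<le> 0 \<or> sqrt E * x < pi" using E' E by fastforce
  qed
  define D where "D x = fundC E x * fundS E' x - fundC E' x * fundS E x" for x
  have "D 0 < D h"
  proof (rule DERIV_pos_imp_increasing_open[OF h])
    fix x assume x: "0 < x" "x < h"
    have "(D has_real_derivative (E' - E) * (fundS E x * fundS E' x)) (at x)"
      unfolding D_def
      by (rule DERIV_cong[OF DERIV_diff[OF DERIV_mult[OF fundC_derivative fundS_derivative]
            DERIV_mult[OF fundC_derivative fundS_derivative]]]) (simp add: algebra_simps)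
    moreover have "0 < (E' - E) * (fundS E x * fundS E' x)" using x E pos[of x] pos'[of x] by simp
    ultimately show "\<exists>y. (D has_real_derivative y) (at x) \<and> 0 < y" by blast
  next
    show "continuous_on {0..h} D" unfolding D_def by (intro continuous_intros continuous_fund)
  qed
  then have "fundC E' h * fundS E h < fundC E h * fundS E' h" by (simp add: D_def)
  then show ?thesis using pos[of h] pos'[of h] h by (simp add: divide_less_eq less_divide_eq mult.commute pos_divide_less_eq)
qed

section \<open>Continuity in the energy\<close>

lemma isCont_removable:
  fixes f :: "real \<Rightarrow> real"
  assumes f: "(f has_real_derivative 1) (at 0)" "f 0 = 0" "\<And>y. isCont f y"
  shows "isCont (\<lambda>y. if y = 0 then 1 else f y / y) x"
proof (cases "x = 0")
  case True
  have "(\<lambda>y. f y / y) \<midarrow>0\<rightarrow> 1" using f(1,2) by (simp add: DERIV_def)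
  then have "(\<lambda>y. if y = 0 then 1 else f y / y) \<midarrow>0\<rightarrow> 1" by (rule Lim_transform_eventually) (auto simp: eventually_at_filter)
  then show ?thesis using True by (simp add: isCont_def)
next
  case False
  have "isCont (\<lambda>y. f y / y) x" using f(3) False by (intro continuous_intros) auto
  moreover have "\<forall>\<^sub>F y in nhds x. (if y = 0 then 1 else f y / y) = f y / y"
    using t1_space_nhds[OF False] by eventually_elim auto
  ultimately show ?thesis by (subst isCont_cong)
qed

text \<open>Clipping E and -E at 0 merges the three cases into one product in which the inactive
  factor is 1; the quotients sin y / y and sinh y / y extend continuously to 0.\<close>

lemma continuous_fund_energy:
  shows "continuous_on T (\<lambda>E. fundC E x)" and "continuous_on T (\<lambda>E. fundS E x)"
proof -
  have C: "fundC E x = cos (sqrt (max E 0) * x) * cosh (sqrt (max (- E) 0) * x)" for E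
    by (auto simp: fundC_def max_def)
  show "continuous_on T (\<lambda>E. fundC E x)" unfolding C by (intro continuous_intros)
  define s where "s y = (if y = 0 then 1 else sin y / y)" for y :: real
  define t where "t y = (if y = 0 then 1 else sinh y / y)" for y :: real
  have "isCont s y" for y unfolding s_def
    by (rule isCont_removable) (auto intro!: derivative_eq_intros)
  then have s: "continuous_on UNIV s" by (simp add: continuous_on_eq_continuous_at)
  have "isCont t y" for y unfolding t_def
    by (rule isCont_removable) (auto intro!: derivative_eq_intros continuous_intros)
  then have t: "continuous_on UNIV t" by (simp add: continuous_on_eq_continuous_at)
  have S: "fundS E x = x * s (sqrt (max E 0) * x) * t (sqrt (max (- E) 0) * x)" for E
    by (auto simp: fundS_def max_def s_def t_def)
  show "continuous_on T (\<lambda>E. fundS E x)" unfolding S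
    by (intro continuous_intros continuous_on_compose2[OF s] continuous_on_compose2[OF t]) auto
qed

text \<open>Put k a = n pi - 2 t with n the ceiling of k a / pi, so that 0 < t < pi / 2. The sign
  (-1)^n drops out, and the two expressions become k tan t and -k cot t.\<close>

lemma fund_resonance_free:
  assumes k: "0 < k" and a: "0 < a" and nz: "sin (k * a) \<noteq> 0"
  shows "fundC (k\<^sup>2) a / fundS (k\<^sup>2) a + 1 / \<bar>fundS (k\<^sup>2) a\<bar> = k * tan (pi / 2 * (of_int \<lceil>k * a / pi\<rceil> - k * a / pi))"
    and "fundC (k\<^sup>2) a / fundS (k\<^sup>2) a - 1 / \<bar>fundS (k\<^sup>2) a\<bar> \<le> 0"
proof -
  define n where "n = \<lceil>k * a / pi\<rceil>"
  define t where "t = pi / 2 * (of_int n - k * a / pi)"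
  define \<epsilon> :: real where "\<epsilon> = cos (pi * of_int n)"
  have \<epsilon>: "\<epsilon> = 1 \<or> \<epsilon> = - 1" by (auto simp: \<epsilon>_def)
  have ka: "k * a = pi * of_int n - 2 * t" by (simp add: t_def field_simps)
  have s: "sin (k * a) = - \<epsilon> * sin (2 * t)" and c: "cos (k * a) = \<epsilon> * cos (2 * t)"
    unfolding ka \<epsilon>_def sin_diff cos_diff by simp_all
  have "0 \<le> of_int n - k * a / pi" "of_int n - k * a / pi < 1" unfolding n_def by linarith+
  then have "0 \<le> t" "t < pi / 2 * 1" unfolding t_def
    by (intro mult_nonneg_nonneg mult_strict_left_mono; simp)+
  moreover have "t \<noteq> 0" using nz s by auto
  ultimately have t: "0 < t" "t < pi / 2" by auto
  then have s2: "0 < sin (2 * t)" by (intro sin_gt_zero) auto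
  have st: "0 < sin t" "0 < cos t" using t by (auto intro!: sin_gt_zero cos_gt_zero)
  have C: "fundC (k\<^sup>2) a = \<epsilon> * cos (2 * t)" and S: "fundS (k\<^sup>2) a = - \<epsilon> * sin (2 * t) / k"
    using k c s by (auto simp: fundC_def fundS_def)
  have aS: "\<bar>fundS (k\<^sup>2) a\<bar> = sin (2 * t) / k" using \<epsilon> k s2 unfolding S by (auto simp: abs_mult)
  have CS: "fundC (k\<^sup>2) a / fundS (k\<^sup>2) a = - (k * cos (2 * t) / sin (2 * t))"
    using \<epsilon> k s2 unfolding C S by auto
  have "fundC (k\<^sup>2) a / fundS (k\<^sup>2) a + 1 / \<bar>fundS (k\<^sup>2) a\<bar> = k * ((1 - cos (2 * t)) / sin (2 * t))"
    unfolding CS aS by (simp add: diff_divide_distrib algebra_simps)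
  also have "(1 - cos (2 * t)) / sin (2 * t) = tan t"
    using st by (simp add: cos_double_sin sin_double tan_def power2_eq_square)
  finally show "fundC (k\<^sup>2) a / fundS (k\<^sup>2) a + 1 / \<bar>fundS (k\<^sup>2) a\<bar> = k * tan (pi / 2 * (of_int \<lceil>k * a / pi\<rceil> - k * a / pi))"
    unfolding t_def n_def .
  have "fundC (k\<^sup>2) a / fundS (k\<^sup>2) a - 1 / \<bar>fundS (k\<^sup>2) a\<bar> = - (k * (1 + cos (2 * t)) / sin (2 * t))"
    unfolding CS aS by (simp add: add_divide_distrib algebra_simps)
  moreover have "0 \<le> 1 + cos (2 * t)" using cos_ge_minus_one[of "2 * t"] by linarith
  then have "0 \<le> k * (1 + cos (2 * t)) / sin (2 * t)" using k s2 by simp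
  ultimately show "fundC (k\<^sup>2) a / fundS (k\<^sup>2) a - 1 / \<bar>fundS (k\<^sup>2) a\<bar> \<le> 0" by linarith
qed

text \<open>With t the argument of the tangent, the derivative tan t - (x a / 2) / cos^2 t is
  negative iff sin t cos t < x a / 2. For w = pi/2 - t one has sin w cos w < sin w \<le> w, and w
  \<le> x a / 2 because n \<ge> 1.\<close>

lemma branch_strict_antimono:
  fixes n :: int
  assumes n: "1 \<le> n" and a: "0 < a" and k: "of_int n - 1 < k * a / pi" "k < k'" "k' * a / pi \<le> of_int n"
  shows "k' * tan (pi / 2 * (of_int n - k' * a / pi)) < k * tan (pi / 2 * (of_int n - k * a / pi))"
proof (rule DERIV_neg_imp_decreasing[OF k(2)])
  fix x assume x: "k \<le> x" "x \<le> k'"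
  define t where "t = pi / 2 * (of_int n - x * a / pi)"
  have "of_int n - 1 < x * a / pi" "x * a / pi \<le> of_int n"
    using k x a divide_right_mono[of "k * a" "x * a" pi] divide_right_mono[of "x * a" "k' * a" pi] by (auto simp: mult_right_mono)
  then have "0 \<le> t" "t < pi / 2 * 1" unfolding t_def
    by (intro mult_nonneg_nonneg mult_strict_left_mono; simp)+
  then have t: "0 \<le> t" "t < pi / 2" by auto
  then have c: "0 < cos t" by (intro cos_gt_zero_pi) auto
  have xa: "x * a / 2 = pi / 2 * of_int n - t" by (simp add: t_def field_simps)
  have d: "((\<lambda>k. k * tan (pi / 2 * (of_int n - k * a / pi))) has_real_derivative
      (tan t - x * a / 2 / (cos t)\<^sup>2)) (at x)"
    unfolding t_def using c[unfolded t_def]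
    by (auto intro!: derivative_eq_intros simp: field_simps power2_eq_square)
  define w where "w = pi / 2 - t"
  have w: "0 < w" "w \<le> pi / 2" using t by (auto simp: w_def)
  have "cos w < cos 0" using w by (intro cos_monotone_0_pi) auto
  moreover have "0 < sin w" using w by (intro sin_gt_zero) auto
  ultimately have "sin w * cos w < sin w * 1" by (intro mult_strict_left_mono) auto
  also have "\<dots> \<le> w" using sin_x_le_x[of w] w by simp
  also have "w \<le> x * a / 2"
  proof -
    have "pi / 2 * 1 \<le> pi / 2 * of_int n" using n by (intro mult_left_mono) auto
    then show ?thesis unfolding xa w_def by simp
  qed
  also have "sin w * cos w = sin t * cos t" by (simp add: w_def sin_diff cos_diff)
  finally have "sin t * cos t / (cos t)\<^sup>2 < x * a / 2 / (cos t)\<^sup>2" using c by (intro divide_strict_right_mono) auto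
  moreover have "sin t * cos t / (cos t)\<^sup>2 = tan t" using c by (simp add: tan_def power2_eq_square)
  ultimately show "\<exists>y. ((\<lambda>k. k * tan (pi / 2 * (of_int n - k * a / pi))) has_real_derivative y) (at x) \<and> y < 0"
    using d by (intro exI[of _ "tan t - x * a / 2 / (cos t)\<^sup>2"]) auto
qed

text \<open>As k decreases to \<open>k1\<close>, the argument of the tangent increases to pi/2. The
  witness comes from prescribing t with tan t = X and solving k a = n pi - 2 t for k.\<close>

lemma branch_unbounded:
  fixes n :: int
  assumes k1: "0 < k1" "k1 * a = (of_int n - 1) * pi" and a: "0 < a" and k2: "k1 < k2"
  shows "\<exists>k. k1 < k \<and> k < k2 \<and> M < k * tan (pi / 2 * (of_int n - k * a / pi))"
proof -
  define \<delta> where "\<delta> = (k2 - k1) * a / 4"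
  have \<delta>: "0 < \<delta>" using k2 a by (simp add: \<delta>_def)
  \<comment> \<open>The first entry forces k X > M, as k > k1; the second forces t \<ge> pi/2 -
    \<delta>, hence k \<le> (k1 + k2) / 2. The inner \<open>max 0\<close> keeps the argument in the
    range where \<open>arctan\<close> inverts \<open>tan\<close>.\<close>
  define X where "X = max (\<bar>M\<bar> / k1 + 1) (tan (max 0 (pi / 2 - \<delta>)))"
  have X: "\<bar>M\<bar> / k1 < X" by (simp add: X_def less_max_iff_disj)
  then have X0: "0 < X" using k1 by (smt (verit) divide_nonneg_pos abs_ge_zero)
  define t where "t = arctan X"
  have t: "0 < t" "t < pi / 2" "tan t = X" using X0 arctan_ubound by (auto simp: t_def tan_arctan)
  have "pi / 2 - \<delta> \<le> t"
  proof -
    have "0 \<le> max 0 (pi / 2 - \<delta>)" "max 0 (pi / 2 - \<delta>) < pi / 2"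
      using \<delta> pi_half_gt_zero by (simp_all add: max_def)
    then have "arctan (tan (max 0 (pi / 2 - \<delta>))) = max 0 (pi / 2 - \<delta>)"
      using pi_gt_zero by (intro arctan_tan) linarith+
    then show ?thesis using arctan_monotone'[of "tan (max 0 (pi / 2 - \<delta>))" X] by (simp add: t_def X_def)
  qed
  define k where "k = k1 + (pi / 2 - t) * 2 / a"
  have "k1 < k" using t a by (simp add: k_def)
  have "(pi / 2 - t) * 2 / a \<le> \<delta> * 2 / a" using \<open>pi / 2 - \<delta> \<le> t\<close> a by (intro divide_right_mono) auto
  also have "\<dots> = (k2 - k1) / 2" using a by (simp add: \<delta>_def)
  finally have "k \<le> k1 + (k2 - k1) / 2" unfolding k_def by (rule add_left_mono)
  also have "\<dots> < k2" using k2 by (simp add: field_simps)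
  finally have "k < k2" .
  have "k * a = (of_int n - 1) * pi + (pi / 2 - t) * 2"
    using a k1(2) by (simp add: k_def distrib_right)
  then have ka: "k * a = pi * of_int n - 2 * t" by (simp add: algebra_simps)
  have "pi / 2 * (of_int n - k * a / pi) = t" unfolding ka by (simp add: diff_divide_distrib)
  moreover have "M < k * X"
  proof -
    have "\<bar>M\<bar> < k1 * X" using X k1 by (simp add: divide_less_eq mult.commute)
    also have "\<dots> < k * X" using \<open>k1 < k\<close> X0 by simp
    finally show ?thesis by linarith
  qed
  ultimately show ?thesis using \<open>k1 < k\<close> \<open>k < k2\<close> t(3) by auto
qed

section \<open>Spectral gaps\<close>

context
  fixes a :: "'d::finite \<Rightarrow> real" and \<alpha> :: real
  assumes a: "\<And>j. 0 < a j" and \<alpha>: "\<alpha> < 0"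
begin

text \<open>With \<alpha> = -|\<alpha>| the absolute value splits into a lower and an upper
  condition, which are treated separately in what follows.\<close>

lemma nonresonant_mem_spectrum_iff:
  assumes S: "\<And>j. fundS E (a j) \<noteq> 0"
  shows "E \<in> delta_lattice_spectrum a \<alpha> \<longleftrightarrow>
    (\<Sum>j\<in>UNIV. fundC E (a j) / fundS E (a j) - 1 / \<bar>fundS E (a j)\<bar>) \<le> \<bar>\<alpha>\<bar> / 2 \<and>
    \<bar>\<alpha>\<bar> / 2 \<le> (\<Sum>j\<in>UNIV. fundC E (a j) / fundS E (a j) + 1 / \<bar>fundS E (a j)\<bar>)"
proof -
  have "E \<in> delta_lattice_spectrum a \<alpha> \<longleftrightarrow>
    \<bar>\<alpha> + (\<Sum>j\<in>UNIV. 2 * fundC E (a j) / fundS E (a j))\<bar> \<le> (\<Sum>j\<in>UNIV. 2 / \<bar>fundS E (a j)\<bar>)"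
  proof
    assume mem: "E \<in> delta_lattice_spectrum a \<alpha>"
    show "\<bar>\<alpha> + (\<Sum>j\<in>UNIV. 2 * fundC E (a j) / fundS E (a j))\<bar> \<le> (\<Sum>j\<in>UNIV. 2 / \<bar>fundS E (a j)\<bar>)"
    proof (rule ccontr)
      assume "\<not> ?thesis"
      then interpret nonresonant a \<alpha> E using a S by unfold_locales auto
      show False using notin_spectrum mem by simp
    qed
  qed (rule nonresonant_mem_spectrum[OF a S])
  moreover have "(\<Sum>j\<in>UNIV. 2 * fundC E (a j) / fundS E (a j)) = 2 * (\<Sum>j\<in>UNIV. fundC E (a j) / fundS E (a j))"
    "(\<Sum>j\<in>UNIV. 2 / \<bar>fundS E (a j)\<bar>) = 2 * (\<Sum>j\<in>UNIV. 1 / \<bar>fundS E (a j)\<bar>)"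
    by (simp_all add: sum_distrib_left)
  ultimately show ?thesis using \<alpha> by (auto simp: sum.distrib sum_subtractf abs_le_iff)
qed

text \<open>The function \<open>\<Phi>\<close> of the overview.\<close>

definition band_fun :: "real \<Rightarrow> real" where
  "band_fun k = (\<Sum>j\<in>UNIV. k * tan (pi / 2 * (of_int \<lceil>k * a j / pi\<rceil> - k * a j / pi)))"

lemma positive_mem_spectrum_iff:
  assumes k: "0 < k" and nz: "\<And>j. sin (k * a j) \<noteq> 0"
  shows "k\<^sup>2 \<in> delta_lattice_spectrum a \<alpha> \<longleftrightarrow> \<bar>\<alpha>\<bar> / 2 \<le> band_fun k"
proof -
  have S: "fundS (k\<^sup>2) (a j) \<noteq> 0" for j using k nz by (simp add: fundS_def)
  have "(\<Sum>j\<in>UNIV. fundC (k\<^sup>2) (a j) / fundS (k\<^sup>2) (a j) - 1 / \<bar>fundS (k\<^sup>2) (a j)\<bar>) \<le> 0"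
    by (intro sum_nonpos fund_resonance_free(2) k a nz)
  then show ?thesis
    unfolding nonresonant_mem_spectrum_iff[OF S] band_fun_def fund_resonance_free(1)[OF k a nz]
    by linarith
qed

text \<open>\<open>k1\<close> is the largest Dirichlet wave number below \<open>k2\<close>, or 0 if there is none.\<close>
lemma previous_resonance:
  assumes k2: "0 < k2"
  obtains k1 where "0 \<le> k1" "k1 < k2"
    "\<And>k j. k1 < k \<Longrightarrow> k \<le> k2 \<Longrightarrow> \<lceil>k * a j / pi\<rceil> = \<lceil>k2 * a j / pi\<rceil>"
    "\<And>j. 1 \<le> \<lceil>k2 * a j / pi\<rceil>"
    "(\<forall>j. \<lceil>k2 * a j / pi\<rceil> = 1) \<or> (0 < k1 \<and> (\<exists>j. k1 * a j = (of_int \<lceil>k2 * a j / pi\<rceil> - 1) * pi))"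
proof -
  define n where "n j = \<lceil>k2 * a j / pi\<rceil>" for j
  have n1: "1 \<le> n j" for j
  proof -
    have "0 < k2 * a j / pi" using k2 a by simp
    then show ?thesis unfolding n_def by linarith
  qed
  \<comment> \<open>The largest multiple of pi / a j strictly below \<open>k2\<close>: the ceiling
    minus one is right also when \<open>k2\<close> is itself such a multiple.\<close>
  define r where "r j = (of_int (n j) - 1) * pi / a j" for j
  define k1 where "k1 = Max (range r)"
  have r: "0 \<le> r j" for j using n1[of j] a[of j] by (simp add: r_def)
  have r2: "r j < k2" for j
  proof -
    have "of_int (n j) - 1 < k2 * a j / pi" unfolding n_def by linarith
    then show ?thesis using a[of j] by (simp add: r_def field_simps)
  qed
  have rk1: "r j \<le> k1" for j unfolding k1_def by (intro Max_ge) auto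
  have "k1 \<in> range r" unfolding k1_def by (intro Max_in) auto
  then obtain j0 where j0: "k1 = r j0" by auto
  show ?thesis
  proof (rule that[of k1])
    show "0 \<le> k1" "k1 < k2" using r r2 j0 by auto
    show "1 \<le> \<lceil>k2 * a j / pi\<rceil>" for j using n1 unfolding n_def .
    show "\<lceil>k * a j / pi\<rceil> = \<lceil>k2 * a j / pi\<rceil>" if k: "k1 < k" "k \<le> k2" for k j
    proof -
      have "r j < k" using rk1[of j] k by simp
      then have "of_int (n j) - 1 < k * a j / pi" using a[of j] by (simp add: r_def field_simps)
      moreover have "k * a j / pi \<le> k2 * a j / pi" using k a[of j] by (intro divide_right_mono mult_right_mono) auto
      then have "k * a j / pi \<le> of_int (n j)" unfolding n_def by linarith
      ultimately have "\<lceil>k * a j / pi\<rceil> = n j" by (simp add: ceiling_eq_iff)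
      then show ?thesis by (simp add: n_def)
    qed
    have "k1 * a j0 = (of_int \<lceil>k2 * a j0 / pi\<rceil> - 1) * pi" using a[of j0] by (simp add: j0 r_def n_def)
    moreover have "\<lceil>k2 * a j / pi\<rceil> = 1" if "k1 = 0" for j
    proof -
      have "\<not> 1 < n j"
      proof
        assume "1 < n j"
        then have "0 < r j" unfolding r_def using a[of j] by (intro divide_pos_pos mult_pos_pos) auto
        then show False using rk1[of j] that by simp
      qed
      then have "n j = 1" using n1[of j] by linarith
      then show ?thesis unfolding n_def .
    qed
    ultimately show "(\<forall>j. \<lceil>k2 * a j / pi\<rceil> = 1) \<or> (0 < k1 \<and> (\<exists>j. k1 * a j = (of_int \<lceil>k2 * a j / pi\<rceil> - 1) * pi))"
      using \<open>0 \<le> k1\<close> by (cases "k1 = 0") auto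
  qed
qed

text \<open>The ceilings are constant on the block up to and including \<open>k2\<close>, so each
  summand stays on one branch and the comparison reaches a Dirichlet right end.\<close>

lemma band_fun_strict_antimono:
  assumes c: "\<And>k j. k1 < k \<Longrightarrow> k \<le> k2 \<Longrightarrow> \<lceil>k * a j / pi\<rceil> = \<lceil>k2 * a j / pi\<rceil>"
    and n: "\<And>j. 1 \<le> \<lceil>k2 * a j / pi\<rceil>" and k: "k1 < k" "k < k'" "k' \<le> k2"
  shows "band_fun k' < band_fun k"
  unfolding band_fun_def
proof (rule sum_strict_mono)
  fix j
  have 1: "\<lceil>k * a j / pi\<rceil> = \<lceil>k2 * a j / pi\<rceil>" "\<lceil>k' * a j / pi\<rceil> = \<lceil>k2 * a j / pi\<rceil>"
    using c[of k j] c[of k' j] k by auto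
  show "k' * tan (pi / 2 * (of_int \<lceil>k' * a j / pi\<rceil> - k' * a j / pi)) < k * tan (pi / 2 * (of_int \<lceil>k * a j / pi\<rceil> - k * a j / pi))"
    unfolding 1
  proof (rule branch_strict_antimono[OF n a _ k(2)])
    show "of_int \<lceil>k2 * a j / pi\<rceil> - 1 < k * a j / pi" unfolding 1(1)[symmetric] by linarith
    show "k' * a j / pi \<le> of_int \<lceil>k2 * a j / pi\<rceil>" unfolding 1(2)[symmetric] by linarith
  qed
qed auto

text \<open>At a zero of the sine, \<open>k * a j / pi\<close> is its own ceiling, and the ceiling
  at the larger \<open>k2\<close> would exceed it.\<close>

lemma block_nonresonant:
  assumes c: "\<And>k j. k1 < k \<Longrightarrow> k \<le> k2 \<Longrightarrow> \<lceil>k * a j / pi\<rceil> = \<lceil>k2 * a j / pi\<rceil>"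
    and k: "k1 < k" "k < k2"
  shows "sin (k * a j) \<noteq> 0"
proof
  assume "sin (k * a j) = 0"
  then obtain i :: int where i: "k * a j = of_int i * pi" unfolding sin_zero_iff_int2 by blast
  have "\<lceil>k * a j / pi\<rceil> = i" unfolding i by simp
  moreover have "k * a j / pi < k2 * a j / pi" using k a[of j] by (simp add: divide_strict_right_mono)
  then have "of_int i < k2 * a j / pi" unfolding i by simp
  ultimately show False using c[of k j] k by linarith
qed

text \<open>Just below \<open>k2\<close> there is no resonance and \<open>band_fun\<close> is larger
  still, so spectral points accumulate at \<open>k2\<^sup>2\<close> from below. This excludes
  \<open>k2\<^sup>2\<close> as the upper endpoint of a gap.\<close>

lemma spectrum_below_positive:
  assumes k2: "0 < k2" and le: "\<bar>\<alpha>\<bar> / 2 \<le> band_fun k2" and E1: "E1 < k2\<^sup>2"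
  shows "\<exists>E\<in>delta_lattice_spectrum a \<alpha>. E1 < E \<and> E < k2\<^sup>2"
proof -
  obtain k1 where k1: "0 \<le> k1" "k1 < k2"
    and c: "\<And>k j. k1 < k \<Longrightarrow> k \<le> k2 \<Longrightarrow> \<lceil>k * a j / pi\<rceil> = \<lceil>k2 * a j / pi\<rceil>"
    and n: "\<And>j. 1 \<le> \<lceil>k2 * a j / pi\<rceil>"
    using previous_resonance[OF k2] by metis
  have "sqrt (max E1 0) < k2" using E1 k2 by (intro real_less_lsqrt) auto
  then obtain k where k: "max k1 (sqrt (max E1 0)) < k" "k < k2" using k1 dense[of "max k1 (sqrt (max E1 0))" k2] by auto
  then have k': "k1 < k" "sqrt (max E1 0) < k" "0 < k" using k1 by auto
  have "\<bar>\<alpha>\<bar> / 2 \<le> band_fun k" using band_fun_strict_antimono[OF c n k'(1) k(2)] le by linarith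
  then have "k\<^sup>2 \<in> delta_lattice_spectrum a \<alpha>"
    using positive_mem_spectrum_iff[OF k'(3) block_nonresonant[OF c k'(1) k(2)]] by simp
  moreover have "(sqrt (max E1 0))\<^sup>2 < k\<^sup>2" using k'(2) by (intro power_strict_mono) auto
  then have "E1 < k\<^sup>2" by simp
  moreover have "k\<^sup>2 < k2\<^sup>2" using k k' by (intro power_strict_mono) auto
  ultimately show ?thesis by blast
qed

text \<open>For E = k^2 this is the sum of k cot (k a_j / 2), which is \<open>band_fun\<close> on
  the first block; in this form it continues to E \<le> 0.\<close>

definition low_fun :: "real \<Rightarrow> real" where
  "low_fun E = (\<Sum>j\<in>UNIV. fundC E (a j / 2) / fundS E (a j / 2))"

lemma low_mem_spectrum_iff:
  assumes S: "\<And>j. 0 < fundS E (a j)"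
  shows "E \<in> delta_lattice_spectrum a \<alpha> \<longleftrightarrow>
    (\<Sum>j\<in>UNIV. fundC E (a j) / fundS E (a j) - 1 / \<bar>fundS E (a j)\<bar>) \<le> \<bar>\<alpha>\<bar> / 2 \<and> \<bar>\<alpha>\<bar> / 2 \<le> low_fun E"
proof -
  have "fundC E (a j) / fundS E (a j) + 1 / \<bar>fundS E (a j)\<bar> = fundC E (a j / 2) / fundS E (a j / 2)" for j
    using fund_half[of E "a j / 2"] S[of j] by simp
  then show ?thesis using nonresonant_mem_spectrum_iff[of E] S unfolding low_fun_def by (simp add: less_imp_neq[symmetric])
qed

lemma low_fun_strict_antimono:
  assumes "E < E'" "\<And>j. E' \<le> 0 \<or> sqrt E' * a j \<le> pi"
  shows "low_fun E' < low_fun E"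
  unfolding low_fun_def
proof (rule sum_strict_mono)
  fix j
  have "sqrt E' * (a j / 2) < pi" if "sqrt E' * a j \<le> pi" using that pi_gt_zero by linarith
  then have "E' \<le> 0 \<or> sqrt E' * (a j / 2) < pi" using assms(2)[of j] by blast
  then show "fundC E' (a j / 2) / fundS E' (a j / 2) < fundC E (a j / 2) / fundS E (a j / 2)"
    using a[of j] assms(1) by (intro fund_quotient_strict_antimono) auto
qed auto

text \<open>For E = -k^2 the lower quantity is the sum of k tanh (k a_j / 2). It and
  \<open>low_fun\<close> both decrease in E, so the lower condition is inherited from
  \<open>E1\<close> and the upper one from \<open>E2\<close>. Hence no gap has a nonpositive upper
  endpoint.\<close>

lemma nonpositive_band_convex:
  assumes E: "E1 < E" "E < E2" "E2 \<le> 0" and m: "E1 \<in> delta_lattice_spectrum a \<alpha>" "E2 \<in> delta_lattice_spectrum a \<alpha>"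
  shows "E \<in> delta_lattice_spectrum a \<alpha>"
proof -
  have S: "0 < fundS E' (a j)" if "E' \<le> 0" for E' j using that a by (intro fundS_pos) auto
  have G: "fundC E' (a j) / fundS E' (a j) - 1 / \<bar>fundS E' (a j)\<bar> = sqrt (- E') * tanh (sqrt (- E') * (a j / 2))"
    if "E' < 0" for E' j
  proof -
    define k where "k = sqrt (- E')"
    define h where "h = a j / 2"
    have k: "0 < k" and h: "0 < h" using that a by (auto simp: k_def h_def)
    have x: "0 < sinh (k * h)" using k h by simp
    have C: "fundC E' (a j) = cosh (2 * (k * h))" and S: "fundS E' (a j) = sinh (2 * (k * h)) / k"
      using that by (auto simp: fundC_def fundS_def k_def h_def)
    have "fundC E' (a j) / fundS E' (a j) - 1 / \<bar>fundS E' (a j)\<bar> = k * ((cosh (2 * (k * h)) - 1) / sinh (2 * (k * h)))"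
      using k h unfolding C S by (simp add: diff_divide_distrib algebra_simps abs_mult)
    also have "(cosh (2 * (k * h)) - 1) / sinh (2 * (k * h)) = tanh (k * h)"
    proof -
      have "cosh (2 * (k * h)) - 1 = 2 * (sinh (k * h) * sinh (k * h))"
        by (simp add: cosh_double cosh_square_eq power2_eq_square[symmetric])
      then show ?thesis using x by (simp add: sinh_double tanh_def)
    qed
    finally show ?thesis by (simp add: k_def h_def)
  qed
  have "(\<Sum>j\<in>UNIV. fundC E (a j) / fundS E (a j) - 1 / \<bar>fundS E (a j)\<bar>)
      \<le> (\<Sum>j\<in>UNIV. fundC E1 (a j) / fundS E1 (a j) - 1 / \<bar>fundS E1 (a j)\<bar>)"
  proof (rule sum_mono)
    fix j
    have s: "sqrt (- E) \<le> sqrt (- E1)" using E by simp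
    then have "sqrt (- E) * (a j / 2) \<le> sqrt (- E1) * (a j / 2)" using a[of j] by (intro mult_right_mono) auto
    then have "tanh (sqrt (- E) * (a j / 2)) \<le> tanh (sqrt (- E1) * (a j / 2))" by simp
    then show "fundC E (a j) / fundS E (a j) - 1 / \<bar>fundS E (a j)\<bar> \<le> fundC E1 (a j) / fundS E1 (a j) - 1 / \<bar>fundS E1 (a j)\<bar>"
      using s E a[of j] by (subst (1 2) G) (auto intro!: mult_mono)
  qed
  moreover have "low_fun E2 < low_fun E" using E by (intro low_fun_strict_antimono) auto
  ultimately show ?thesis
    using m low_mem_spectrum_iff[OF S, of E] low_mem_spectrum_iff[OF S, of E1] low_mem_spectrum_iff[OF S, of E2] E by auto
qed

lemma low_fun_eq_band_fun:
  assumes k: "0 < k" and n: "\<And>j. \<lceil>k * a j / pi\<rceil> = 1"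
  shows "low_fun (k\<^sup>2) = band_fun k"
  unfolding low_fun_def band_fun_def
proof (rule sum.cong)
  fix j
  have eq: "pi / 2 * (of_int \<lceil>k * a j / pi\<rceil> - k * a j / pi) = pi / 2 - k * (a j / 2)"
    unfolding n by (simp add: field_simps)
  show "fundC (k\<^sup>2) (a j / 2) / fundS (k\<^sup>2) (a j / 2) = k * tan (pi / 2 * (of_int \<lceil>k * a j / pi\<rceil> - k * a j / pi))"
    unfolding eq using k by (simp add: fundC_def fundS_def tan_def sin_diff cos_diff)
qed simp

text \<open>The band function is below the threshold at \<open>k2\<close> and above it further down
  in the same block, so it crosses the threshold; by strict monotonicity the crossing is the lower
  endpoint. The large values come from very negative E on the first block, and from the pole at
  \<open>k1\<close> on all later ones.\<close>

lemma gap_exists: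
  assumes k2: "0 < k2" and lt: "band_fun k2 < \<bar>\<alpha>\<bar> / 2" and mem: "k2\<^sup>2 \<in> delta_lattice_spectrum a \<alpha>"
  shows "\<exists>E1. spectral_gap (delta_lattice_spectrum a \<alpha>) E1 (k2\<^sup>2)"
proof -
  obtain k1 where k1: "0 \<le> k1" "k1 < k2"
    and c: "\<And>k j. k1 < k \<Longrightarrow> k \<le> k2 \<Longrightarrow> \<lceil>k * a j / pi\<rceil> = \<lceil>k2 * a j / pi\<rceil>"
    and n: "\<And>j. 1 \<le> \<lceil>k2 * a j / pi\<rceil>"
    and d: "(\<forall>j. \<lceil>k2 * a j / pi\<rceil> = 1) \<or> (0 < k1 \<and> (\<exists>j. k1 * a j = (of_int \<lceil>k2 * a j / pi\<rceil> - 1) * pi))"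
    using previous_resonance[OF k2] by metis
  from d show ?thesis
  proof
    assume n1: "\<forall>j. \<lceil>k2 * a j / pi\<rceil> = 1"
    have k2a: "k2 * a j \<le> pi" for j
    proof -
      have "k2 * a j / pi \<le> 1" using n1 le_of_int_ceiling[of "k2 * a j / pi"] by simp
      then show ?thesis by (simp add: divide_le_eq)
    qed
    have low: "E \<le> 0 \<or> sqrt E * a j \<le> pi" if "E \<le> k2\<^sup>2" for E j
    proof -
      have "sqrt E \<le> k2" using that k2 by (intro real_le_lsqrt) auto
      then have "sqrt E * a j \<le> k2 * a j" using a[of j] by (intro mult_right_mono) auto
      then show ?thesis using k2a[of j] by linarith
    qed
    \<comment> \<open>The inequality is strict as \<open>k2\<close> may be resonant. At half the
      lengths the endpoint can be included, which keeps \<open>low_fun\<close> continuous up to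
      \<open>k2\<^sup>2\<close>.\<close>
    have S: "0 < fundS E (a j)" if "E < k2\<^sup>2" for E j
    proof (rule fundS_pos[OF a])
      have "sqrt E * a j < k2 * a j" using that k2 a[of j] by (intro mult_strict_right_mono real_less_lsqrt) auto
      then show "E \<le> 0 \<or> sqrt E * a j < pi" using k2a[of j] by linarith
    qed
    have S2: "0 < fundS E (a j / 2)" if "E \<le> k2\<^sup>2" for E j
    proof (rule fundS_pos)
      have "sqrt E * (a j / 2) < pi" if "sqrt E * a j \<le> pi" using that pi_gt_zero by linarith
      then show "E \<le> 0 \<or> sqrt E * (a j / 2) < pi" using low[OF that, of j] by blast
    qed (use a in simp)
    \<comment> \<open>At energy -\<kappa>^2 every term is \<kappa> coth (\<kappa> a_j / 2) \<ge>
      \<kappa>, so one term already exceeds the threshold.\<close>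
    define \<kappa> where "\<kappa> = \<bar>\<alpha>\<bar> + 1"
    have \<kappa>: "0 < \<kappa>" "\<bar>\<alpha>\<bar> < \<kappa>" by (auto simp: \<kappa>_def)
    define E0 where "E0 = - \<kappa>\<^sup>2"
    have E0: "E0 < 0" "sqrt (- E0) = \<kappa>" using \<kappa> by (auto simp: E0_def)
    have E02: "E0 < k2\<^sup>2" using E0 k2 by (smt (verit) zero_le_power2)
    have "\<bar>\<alpha>\<bar> / 2 \<le> low_fun E0"
    proof -
      have each: "\<kappa> \<le> fundC E0 (a j / 2) / fundS E0 (a j / 2)" for j
      proof -
        have x: "0 < sinh (\<kappa> * (a j / 2))" using \<kappa> a[of j] by simp
        have "\<kappa> * sinh (\<kappa> * (a j / 2)) \<le> \<kappa> * cosh (\<kappa> * (a j / 2))"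
          using \<kappa> sinh_le_cosh_real by (intro mult_left_mono) auto
        then have "\<kappa> \<le> \<kappa> * cosh (\<kappa> * (a j / 2)) / sinh (\<kappa> * (a j / 2))" using x by (simp add: le_divide_eq)
        then show ?thesis using E0 by (simp add: fundC_def fundS_def mult.commute)
      qed
      have "\<kappa> \<le> fundC E0 (a undefined / 2) / fundS E0 (a undefined / 2)" by (rule each)
      also have "\<dots> \<le> low_fun E0" unfolding low_fun_def
        by (rule member_le_sum) (use each \<kappa> in \<open>auto intro: order_trans[of 0 \<kappa>]\<close>)
      finally show ?thesis using \<kappa> by linarith
    qed
    moreover have "low_fun (k2\<^sup>2) < \<bar>\<alpha>\<bar> / 2" using lt low_fun_eq_band_fun[OF k2] n1 by simp
    moreover have "continuous_on {E0..k2\<^sup>2} low_fun"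
      unfolding low_fun_def
      by (intro continuous_intros continuous_fund_energy) (use S2 in \<open>auto simp: less_imp_neq[symmetric]\<close>)
    ultimately obtain E1 where E1: "E0 \<le> E1" "E1 \<le> k2\<^sup>2" "low_fun E1 = \<bar>\<alpha>\<bar> / 2"
      using IVT2'[of low_fun "k2\<^sup>2" "\<bar>\<alpha>\<bar> / 2" E0] E02 by auto
    then have E12: "E1 < k2\<^sup>2" using \<open>low_fun (k2\<^sup>2) < \<bar>\<alpha>\<bar> / 2\<close> by (cases "E1 = k2\<^sup>2") auto
    \<comment> \<open>At the crossing \<open>low_fun E1\<close> equals the threshold, so this bound
      is the lower condition there.\<close>
    have "(\<Sum>j\<in>UNIV. fundC E1 (a j) / fundS E1 (a j) - 1 / \<bar>fundS E1 (a j)\<bar>) \<le> low_fun E1"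
      unfolding low_fun_def
    proof (rule sum_mono)
      fix j
      have "fundC E1 (a j) / fundS E1 (a j) + 1 / \<bar>fundS E1 (a j)\<bar> = fundC E1 (a j / 2) / fundS E1 (a j / 2)"
        using fund_half[of E1 "a j / 2"] S[OF E12, of j] by simp
      moreover have "0 \<le> 1 / \<bar>fundS E1 (a j)\<bar>" by simp
      ultimately show "fundC E1 (a j) / fundS E1 (a j) - 1 / \<bar>fundS E1 (a j)\<bar> \<le> fundC E1 (a j / 2) / fundS E1 (a j / 2)"
        by linarith
    qed
    then have "E1 \<in> delta_lattice_spectrum a \<alpha>" using low_mem_spectrum_iff[OF S[OF E12]] E1(3) by simp
    moreover have "E \<notin> delta_lattice_spectrum a \<alpha>" if "E1 < E" "E < k2\<^sup>2" for E
      using low_mem_spectrum_iff[OF S[OF that(2)]] low_fun_strict_antimono[OF that(1) low] that E1(3) by auto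
    ultimately show ?thesis using E12 mem unfolding spectral_gap_def by (intro exI[of _ E1]) auto
  next
    assume "0 < k1 \<and> (\<exists>j. k1 * a j = (of_int \<lceil>k2 * a j / pi\<rceil> - 1) * pi)"
    then obtain j where k10: "0 < k1" and j: "k1 * a j = (of_int \<lceil>k2 * a j / pi\<rceil> - 1) * pi" by blast
    \<comment> \<open>The term of the direction resonant at \<open>k1\<close> is large just above
      it; the others are nonnegative, so it bounds \<open>band_fun\<close> from below.\<close>
    obtain k' where k': "k1 < k'" "k' < k2"
      "\<bar>\<alpha>\<bar> / 2 < k' * tan (pi / 2 * (of_int \<lceil>k2 * a j / pi\<rceil> - k' * a j / pi))"
      using branch_unbounded[OF k10 j a k1(2)] by blast
    have frac: "0 \<le> pi / 2 * (of_int \<lceil>x\<rceil> - x)" "pi / 2 * (of_int \<lceil>x\<rceil> - x) < pi / 2" for x :: real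
    proof -
      have "0 \<le> of_int \<lceil>x\<rceil> - x" "of_int \<lceil>x\<rceil> - x < 1" by linarith+
      then have "0 \<le> pi / 2 * (of_int \<lceil>x\<rceil> - x)" "pi / 2 * (of_int \<lceil>x\<rceil> - x) < pi / 2 * 1"
        by (intro mult_nonneg_nonneg mult_strict_left_mono; simp)+
      then show "0 \<le> pi / 2 * (of_int \<lceil>x\<rceil> - x)" "pi / 2 * (of_int \<lceil>x\<rceil> - x) < pi / 2" by auto
    qed
    have nonneg: "0 \<le> k' * tan (pi / 2 * (of_int \<lceil>k' * a i / pi\<rceil> - k' * a i / pi))" for i
    proof (rule mult_nonneg_nonneg)
      show "0 \<le> tan (pi / 2 * (of_int \<lceil>k' * a i / pi\<rceil> - k' * a i / pi))"
        using frac[of "k' * a i / pi"] tan_gt_zero by (metis less_eq_real_def tan_zero)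
    qed (use k10 k' in auto)
    have "\<bar>\<alpha>\<bar> / 2 < k' * tan (pi / 2 * (of_int \<lceil>k' * a j / pi\<rceil> - k' * a j / pi))"
      using k' c[of k' j] by simp
    also have "\<dots> \<le> band_fun k'"
      unfolding band_fun_def by (rule member_le_sum) (use nonneg in auto)
    finally have up: "\<bar>\<alpha>\<bar> / 2 \<le> band_fun k'" by simp
    \<comment> \<open>With the ceilings frozen at their common value the formula is continuous, the
      right end \<open>k2\<close> included.\<close>
    have "continuous_on {k'..k2} (\<lambda>k. \<Sum>j\<in>UNIV. k * tan (pi / 2 * (of_int \<lceil>k2 * a j / pi\<rceil> - k * a j / pi)))"
    proof (intro continuous_intros)
      fix i
      show "\<forall>k\<in>{k'..k2}. cos (pi / 2 * (of_int \<lceil>k2 * a i / pi\<rceil> - k * a i / pi)) \<noteq> 0"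
      proof
        fix k assume "k \<in> {k'..k2}"
        then have eq: "\<lceil>k2 * a i / pi\<rceil> = \<lceil>k * a i / pi\<rceil>" using c[of k i] k' by auto
        have "0 < cos (pi / 2 * (of_int \<lceil>k2 * a i / pi\<rceil> - k * a i / pi))"
          unfolding eq using frac[of "k * a i / pi"] pi_gt_zero by (intro cos_gt_zero_pi) linarith+
        then show "cos (pi / 2 * (of_int \<lceil>k2 * a i / pi\<rceil> - k * a i / pi)) \<noteq> 0" by simp
      qed
    qed auto
    also have "continuous_on {k'..k2} (\<lambda>k. \<Sum>j\<in>UNIV. k * tan (pi / 2 * (of_int \<lceil>k2 * a j / pi\<rceil> - k * a j / pi)))
        \<longleftrightarrow> continuous_on {k'..k2} band_fun"
    proof (rule continuous_on_cong[OF refl])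
      fix k assume "k \<in> {k'..k2}"
      then have "\<lceil>k * a i / pi\<rceil> = \<lceil>k2 * a i / pi\<rceil>" for i using c[of k i] k' by auto
      then show "(\<Sum>j\<in>UNIV. k * tan (pi / 2 * (of_int \<lceil>k2 * a j / pi\<rceil> - k * a j / pi))) = band_fun k"
        by (simp add: band_fun_def)
    qed
    finally obtain k where k: "k' \<le> k" "k \<le> k2" "band_fun k = \<bar>\<alpha>\<bar> / 2"
      using IVT2'[of band_fun k2 "\<bar>\<alpha>\<bar> / 2" k'] up lt k' by auto
    then have kk: "k1 < k" "k < k2" "0 < k" using lt k' k10 by (auto simp: less_le)
    have "k\<^sup>2 \<in> delta_lattice_spectrum a \<alpha>"
      using positive_mem_spectrum_iff[OF kk(3) block_nonresonant[OF c kk(1,2)]] k(3) by simp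
    moreover have "k\<^sup>2 < k2\<^sup>2" using kk by (intro power_strict_mono) auto
    moreover have "E \<notin> delta_lattice_spectrum a \<alpha>" if E: "k\<^sup>2 < E" "E < k2\<^sup>2" for E
    proof -
      define q where "q = sqrt E"
      have E0: "0 < E" using E(1) by (smt (verit) zero_le_power2)
      have q: "E = q\<^sup>2" "0 < q" using E0 by (auto simp: q_def)
      have "k < q" "q < k2" using E kk q by (auto simp: power2_less_imp_less[of k q] power2_less_imp_less[of q k2])
      then have "band_fun q < \<bar>\<alpha>\<bar> / 2" using band_fun_strict_antimono[OF c n kk(1), of q] k(3) by auto
      moreover have "k1 < q" using kk(1) \<open>k < q\<close> by simp
      ultimately show ?thesis
        using positive_mem_spectrum_iff[OF q(2) block_nonresonant[OF c \<open>k1 < q\<close> \<open>q < k2\<close>]] q(1) by simp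
    qed
    ultimately show ?thesis using mem unfolding spectral_gap_def by (intro exI[of _ "k\<^sup>2"]) auto
  qed
qed

end

theorem theorem3p4:
  fixes a :: "'d::finite \<Rightarrow> real" and \<alpha> :: real
  assumes "\<forall>j. a j > 0" and "\<alpha> < 0"
  shows "(\<forall>E1 E2. spectral_gap (delta_lattice_spectrum a \<alpha>) E1 E2 \<longrightarrow>
            (\<exists>j (m::nat). m \<ge> 1 \<and> E2 = (real m * pi / a j)^2)) \<and>
         (\<forall>l (m::nat). m \<ge> 1 \<longrightarrow>
            ((\<exists>E1. spectral_gap (delta_lattice_spectrum a \<alpha>) E1 ((real m * pi / a l)^2)) \<longleftrightarrow>
             2 * real m * pi / a l *
               (\<Sum>j\<in>UNIV. tan (pi / 2 * (of_int \<lceil>real m * a j / a l\<rceil> - real m * a j / a l)))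
             < \<bar>\<alpha>\<bar>))"
proof (intro conjI allI impI)
  have a: "0 < a j" for j using assms by simp
  let ?S = "delta_lattice_spectrum a \<alpha>"
  fix E1 E2 assume gap: "spectral_gap ?S E1 E2"
  show "\<exists>j (m::nat). m \<ge> 1 \<and> E2 = (real m * pi / a j)\<^sup>2"
  proof (rule ccontr)
    assume no: "\<not> ?thesis"
    show False
    proof (cases "0 < E2")
      case True
      define k where "k = sqrt E2"
      have k: "0 < k" "E2 = k\<^sup>2" using True by (auto simp: k_def)
      have nz: "sin (k * a j) \<noteq> 0" for j
      proof
        assume "sin (k * a j) = 0"
        then obtain i :: int where i: "k * a j = of_int i * pi" unfolding sin_zero_iff_int2 by blast
        have "0 < of_int i * pi" using k a[of j] unfolding i[symmetric] by simp
        then have "0 < i" by (simp add: zero_less_mult_iff)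
        then have "1 \<le> nat i" "real (nat i) = of_int i" by auto
        moreover have "E2 = (of_int i * pi / a j)\<^sup>2" unfolding i[symmetric] k(2) using a[of j] by simp
        ultimately show False using no by metis
      qed
      \<comment> \<open>A nonresonant positive point of the spectrum meets the threshold, and
        spectrum then accumulates at it from below.\<close>
      have "\<bar>\<alpha>\<bar> / 2 \<le> band_fun a k"
        using positive_mem_spectrum_iff[of a \<alpha> k, OF a assms(2) k(1) nz] gap k(2) by (simp add: spectral_gap_def)
      from spectrum_below_positive[of a \<alpha> k, OF a assms(2) k(1) this] gap k(2)
      show False unfolding spectral_gap_def by fastforce
    next
      case False
      obtain E where "E1 < E" "E < E2" using gap dense unfolding spectral_gap_def by blast
      then show False
        using nonpositive_band_convex[of a \<alpha> E1 E E2, OF a assms(2)] gap False unfolding spectral_gap_def by fastforce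
    qed
  qed
next
  have a: "0 < a j" for j using assms by simp
  let ?S = "delta_lattice_spectrum a \<alpha>"
  fix l and m :: nat assume m: "1 \<le> m"
  define k where "k = real m * pi / a l"
  have k: "0 < k" using m a[of l] by (simp add: k_def)
  have mem: "k\<^sup>2 \<in> ?S" unfolding k_def by (rule dirichlet_mem_spectrum[OF a m])
  have ka: "k * a j / pi = real m * a j / a l" for j by (simp add: k_def)
  \<comment> \<open>At this k the quotients k a_j / pi are m a_j / a_l, so the stated condition
    compares \<open>band_fun\<close> with half of |\<alpha>|.\<close>
  have eq: "2 * real m * pi / a l * (\<Sum>j\<in>UNIV. tan (pi / 2 * (of_int \<lceil>real m * a j / a l\<rceil> - real m * a j / a l)))
      = 2 * band_fun a k"
  proof -
    have "band_fun a k = k * (\<Sum>j\<in>UNIV. tan (pi / 2 * (of_int \<lceil>real m * a j / a l\<rceil> - real m * a j / a l)))"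
      unfolding band_fun_def[of a \<alpha>, OF a assms(2)] ka by (simp add: sum_distrib_left)
    then show ?thesis by (simp add: k_def)
  qed
  show "(\<exists>E1. spectral_gap ?S E1 ((real m * pi / a l)\<^sup>2)) \<longleftrightarrow>
      2 * real m * pi / a l * (\<Sum>j\<in>UNIV. tan (pi / 2 * (of_int \<lceil>real m * a j / a l\<rceil> - real m * a j / a l))) < \<bar>\<alpha>\<bar>"
    unfolding eq k_def[symmetric]
  proof
    assume "\<exists>E1. spectral_gap ?S E1 (k\<^sup>2)"
    then obtain E1 where gap: "spectral_gap ?S E1 (k\<^sup>2)" ..
    show "2 * band_fun a k < \<bar>\<alpha>\<bar>"
    proof (rule ccontr)
      assume "\<not> 2 * band_fun a k < \<bar>\<alpha>\<bar>"
      then have "\<bar>\<alpha>\<bar> / 2 \<le> band_fun a k" by simp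
      from spectrum_below_positive[of a \<alpha> k, OF a assms(2) k this] gap
      show False unfolding spectral_gap_def by fastforce
    qed
  next
    assume "2 * band_fun a k < \<bar>\<alpha>\<bar>"
    then show "\<exists>E1. spectral_gap ?S E1 (k\<^sup>2)" by (intro gap_exists[of a \<alpha> k, OF a assms(2) k _ mem]) simp
  qed
qed

end
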